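(* Let $0<p<\infty$ and let $f=h+\overline{g}:\mathbb{D}\to\mathbb{C}$ be a uniformly locally univalent, sense-preserving harmonic mapping whose dilatation $w$ belongs to $Q_p$ and satisfies $\|w\|<1$. Then $F=\log J_f\in\widetilde{\mathcal{Q}}_p$ if and only if the measure $d\mu(z)=|S_f(z)|^2(1-|z|^2)^{2+p}\,dA(z)$ is a $p$-Carleson measure.
   Context: $\mathbb{D}$ is the unit disk and $dA$ is Lebesgue area measure. A sense-preserving locally univalent harmonic mapping $f:\mathbb{D}\to\mathbb{C}$ is written $f=h+\overline{g}$ with $h,g$ analytic in $\mathbb{D}$, $h(0)=g(0)=0$, $h'\neq 0$ in $\mathbb{D}$; its dilatation is $w=g'/h'$, an analytic function with $|w|<1$ in $\mathbb{D}$, and its Jacobian is $J_f=|h'|^2-|g'|^2>0$. Write $\|w\|=\sup_{z\in\mathbb{D}}|w(z)|$. With $\partial_z=\frac12(\partial_x-i\partial_y)$, $\partial_{\bar z}=\frac12(\partial_x+i\partial_y)$ and $F=\log J_f$, the Schwarzian derivative of $f$ is $S_f=F_{zz}-\frac12 F_z^2$; explicitly $S_f=S_h+\frac{\overline{w}}{1-|w|^2}\big(w'\frac{h''}{h'}-w''\big)-\frac32\big(\frac{w'\overline{w}}{1-|w|^2}\big)^2$, where $S_h=(h''/h')'-\frac12(h''/h')^2$. The hyperbolic distance is $d_h(z,\xi)=\frac12\log\frac{1+p(z,\xi)}{1-p(z,\xi)}$ with $p(z,\xi)=\left|\frac{z-\xi}{1-\overline{\xi}z}\right|$; $f$ is uniformly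 locally univalent if there is $\rho\in(0,\infty]$ such that $f$ is univalent on every hyperbolic disk of radius $\rho$. For $a\in\mathbb{D}$ let $\varphi_a(z)=\frac{a-z}{1-\overline{a}z}$. For $0<p<\infty$: $Q_p$ is the space of analytic $u$ on $\mathbb{D}$ with $\sup_{a\in\mathbb{D}}\int_{\mathbb{D}}|u'(z)|^2(1-|\varphi_a(z)|^2)^p\,dA(z)<\infty$; $\widetilde{\mathcal{Q}}_p$ is the class of smooth $G:\mathbb{D}\to\mathbb{C}$ with $\sup_{a\in\mathbb{D}}\int_{\mathbb{D}}(|G_z(z)|+|G_{\bar z}(z)|)^2(1-|\varphi_a(z)|^2)^p\,dA(z)<\infty$. A positive Borel measure $\mu$ on $\mathbb{D}$ is a $p$-Carleson measure if $\sup_{a\in\mathbb{D}}\int_{\mathbb{D}}|\varphi_a'(z)|^p\,d\mu(z)<\infty$. *)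

theory Defs
  imports "HOL-Analysis.Analysis"
begin

definition disk_aut :: "complex \<Rightarrow> complex \<Rightarrow> complex" where
  "disk_aut a z = (a - z) / (1 - cnj a * z)"

definition pseudo_hyp :: "complex \<Rightarrow> complex \<Rightarrow> real" where
  "pseudo_hyp z \<xi> = norm ((z - \<xi>) / (1 - cnj \<xi> * z))"

definition hyp_dist :: "complex \<Rightarrow> complex \<Rightarrow> real" where
  "hyp_dist z \<xi> = ln ((1 + pseudo_hyp z \<xi>) / (1 - pseudo_hyp z \<xi>)) / 2"

definition hyp_disk :: "complex \<Rightarrow> real \<Rightarrow> complex set" where
  "hyp_disk c \<rho> = {z \<in> ball 0 1. hyp_dist z c < \<rho>}"

text \<open>Uniform local univalence: univalent on every hyperbolic disk of some radius
  \<open>\<rho> \<in> (0,\<infinity>]\<close>; the case \<open>\<rho> = \<infinity>\<close> (global univalence) implies the condition for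
  every finite \<open>\<rho>\<close>, so it suffices to quantify over positive reals.\<close>
definition unif_loc_univalent :: "(complex \<Rightarrow> complex) \<Rightarrow> bool" where
  "unif_loc_univalent f \<longleftrightarrow>
     (\<exists>\<rho>>0. \<forall>c\<in>ball 0 1. inj_on f (hyp_disk c \<rho>))"

definition wirt_z :: "(complex \<Rightarrow> complex) \<Rightarrow> complex \<Rightarrow> complex" where
  "wirt_z G z = (frechet_derivative G (at z) 1 - \<i> * frechet_derivative G (at z) \<i>) / 2"

definition wirt_zbar :: "(complex \<Rightarrow> complex) \<Rightarrow> complex \<Rightarrow> complex" where
  "wirt_zbar G z = (frechet_derivative G (at z) 1 + \<i> * frechet_derivative G (at z) \<i>) / 2"

definition Qp :: "real \<Rightarrow> (complex \<Rightarrow> complex) \<Rightarrow> bool" where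
  "Qp p u \<longleftrightarrow> u holomorphic_on ball 0 1 \<and>
     (\<exists>C::real. \<forall>a\<in>ball 0 1.
        (\<integral>\<^sup>+ z \<in> ball 0 1. ennreal ((norm (deriv u z))\<^sup>2 * (1 - (norm (disk_aut a z))\<^sup>2) powr p) \<partial>lborel)
          \<le> ennreal C)"

definition Qp_tilde :: "real \<Rightarrow> (complex \<Rightarrow> complex) \<Rightarrow> bool" where
  "Qp_tilde p G \<longleftrightarrow> (\<forall>z\<in>ball 0 1. G differentiable (at z)) \<and>
     (\<exists>C::real. \<forall>a\<in>ball 0 1.
        (\<integral>\<^sup>+ z \<in> ball 0 1. ennreal ((norm (wirt_z G z) + norm (wirt_zbar G z))\<^sup>2
              * (1 - (norm (disk_aut a z))\<^sup>2) powr p) \<partial>lborel)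
          \<le> ennreal C)"

definition p_carleson :: "real \<Rightarrow> complex measure \<Rightarrow> bool" where
  "p_carleson p \<mu> \<longleftrightarrow>
     (\<exists>C::real. \<forall>a\<in>ball 0 1.
        (\<integral>\<^sup>+ z. ennreal ((norm (deriv (disk_aut a) z)) powr p) \<partial>\<mu>) \<le> ennreal C)"

definition harm :: "(complex \<Rightarrow> complex) \<Rightarrow> (complex \<Rightarrow> complex) \<Rightarrow> complex \<Rightarrow> complex" where
  "harm h g z = h z + cnj (g z)"

definition jac :: "(complex \<Rightarrow> complex) \<Rightarrow> (complex \<Rightarrow> complex) \<Rightarrow> complex \<Rightarrow> real" where
  "jac h g z = (norm (deriv h z))\<^sup>2 - (norm (deriv g z))\<^sup>2"

definition dilat :: "(complex \<Rightarrow> complex) \<Rightarrow> (complex \<Rightarrow> complex) \<Rightarrow> complex \<Rightarrow> complex" where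
  "dilat h g z = deriv g z / deriv h z"

definition logjac :: "(complex \<Rightarrow> complex) \<Rightarrow> (complex \<Rightarrow> complex) \<Rightarrow> complex \<Rightarrow> complex" where
  "logjac h g z = complex_of_real (ln (jac h g z))"

definition schwarzian :: "(complex \<Rightarrow> complex) \<Rightarrow> (complex \<Rightarrow> complex) \<Rightarrow> complex \<Rightarrow> complex" where
  "schwarzian h g z =
     wirt_z (wirt_z (logjac h g)) z - (wirt_z (logjac h g) z)\<^sup>2 / 2"

end

theory Submission
  imports Defs "HOL-Complex_Analysis.Complex_Analysis"
begin

text \<open>
  With \<open>P = h''/h'\<close>, \<open>T = 1 - |z|\<^sup>2\<close> and \<open>S = P' - P\<^sup>2/2\<close>, the terms of \<open>\<partial>F/\<partial>z\<close> and of the Schwarzian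
  that contain the dilatation \<open>w\<close> are controlled by \<open>w'\<close> and \<open>w''\<close>, once \<open>|P| T\<close> is known to be bounded.
  That bound follows by rescaling: were it false, \<open>f\<close> would look like a real linear image of the
  exponential on small disks and could not be uniformly locally univalent. What remains is that \<open>P\<close> is
  square integrable against the weights \<open>(1 - |\<phi>\<^sub>a|\<^sup>2)\<close> to the power \<open>p\<close>, uniformly in \<open>a\<close>, iff \<open>S T\<close> is.

  One direction is a Cauchy estimate. For the other, Moebius invariance reduces to \<open>a = 0\<close>. The
  Riccati equation \<open>P' = P\<^sup>2/2 + S\<close> and Green's formula give the energy estimate provided
  \<open>Re (z P)\<close> is almost at least \<open>|P|\<^sup>2 T / 4 - 1\<close>, which says that the pole \<open>z + 2 / P z\<close> of the
  osculating Moebius map lies almost outside the disk. Where this fails, \<open>|S| T\<^sup>2\<close> is bounded below at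
  some point within bounded hyperbolic distance, so these places are absorbed by the integral of \<open>|S|\<^sup>2\<close>.
\<close>

section \<open>Boundedness of the pre-Schwarzian\<close>

text \<open>The term P^2/2 in the Riccati equation cannot be absorbed by size. Since |P| T is
  bounded but not small, |P|^4 T^(p+2) is controlled only by a large multiple of |P|^2 T^p, and
  estimates in absolute value return the integral to be bounded with an uncontrolled factor. The
  sign of Re (z P) is what saves the argument, and it is only available where the osculating pole is
  not inside the disk.

  Absorbing a term on the left requires that it be finite. Hence the weight 1 - |z|^2 is first
  replaced by the positive part of r^2 - |z|^2 with r < 1, with constants independent of r. All
  constants depend only on p and on the bound for |P| T; this bound survives composition with an
  automorphism of the disk up to an additive constant, so one estimate at a = 0 gives the supremum
  over a.

  The Carleson condition belongs to the same scale because |\<phi>_a'| T = 1 - |\<phi>_a|^2. The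
  theorem thus becomes a comparison of functions in one weighted class.\<close>

lemma norm_deriv_le_bound:
  fixes f :: "complex \<Rightarrow> complex"
  assumes "f holomorphic_on ball z r" "0 < r" "\<And>x. x \<in> ball z r \<Longrightarrow> norm (f x) \<le> B"
  shows "norm (deriv f z) \<le> 2 * B / r"
proof -
  have "norm ((deriv ^^ 1) f z) \<le> fact 1 * B / (r / 2) ^ 1"
  proof (rule Cauchy_inequality)
    show "f holomorphic_on ball z (r / 2)"
      using assms(1,2) by (elim holomorphic_on_subset) auto
    show "continuous_on (cball z (r / 2)) f"
      using assms(1,2) by (intro holomorphic_on_imp_continuous_on) (elim holomorphic_on_subset, auto)
    show "norm (f x) \<le> B" if "norm (z - x) = r / 2" for x
      using that assms(2,3) by (auto simp: dist_norm)
  qed (use assms in auto)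
  then show ?thesis by (simp add: field_simps)
qed

text \<open>A quantitative Liouville theorem: a function bounded by \<open>B\<close> on a ball whose
  radius is huge compared with \<open>B\<close> is almost constant near the centre. It freezes the
  rescaled pre-Schwarzian and dilatation.\<close>

lemma norm_diff_le_of_bounded:
  fixes f :: "complex \<Rightarrow> complex"
  assumes f: "f holomorphic_on ball 0 R" and "0 < R"
    and B: "\<And>x. x \<in> ball 0 R \<Longrightarrow> norm (f x) \<le> B" and z: "norm z < R / 2"
  shows "norm (f z - f 0) \<le> 4 * B / R * norm z"
proof -
  have "norm (f z - f 0) \<le> 4 * B / R * norm (z - 0)"
  proof (rule field_differentiable_bound)
    show "convex (ball (0::complex) (R/2))" by simp
    fix x :: complex assume x: "x \<in> ball 0 (R/2)"
    have sub: "ball x (R/2) \<subseteq> ball 0 R"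
    proof
      fix y assume "y \<in> ball x (R/2)"
      then show "y \<in> ball 0 R" using x dist_triangle[of 0 y x] by auto
    qed
    show "(f has_field_derivative deriv f x) (at x within ball 0 (R / 2))"
      using f x \<open>0 < R\<close>
      by (intro has_field_derivative_at_within[OF holomorphic_derivI[where S="ball 0 R"]]) auto
    have "norm (deriv f x) \<le> 2 * B / (R / 2)"
      using sub B \<open>0 < R\<close> holomorphic_on_subset[OF f sub] by (intro norm_deriv_le_bound) auto
    then show "norm (deriv f x) \<le> 4 * B / R" by (simp add: field_simps)
  qed (use assms in auto)
  then show ?thesis by simp
qed

lemma norm_le_of_deriv_bound:
  fixes f :: "complex \<Rightarrow> complex"
  assumes f: "\<And>x. x \<in> ball 0 r \<Longrightarrow> (f has_field_derivative f' x) (at x)" "f 0 = 0"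
    and B: "\<And>x. x \<in> ball 0 r \<Longrightarrow> norm (f' x) \<le> B" and z: "z \<in> ball 0 r"
  shows "norm (f z) \<le> B * r"
proof -
  have r: "0 < r" using z by (auto intro: le_less_trans[OF norm_ge_zero])
  have "norm (f z - f 0) \<le> B * norm (z - 0)"
    by (rule field_differentiable_bound[where S = "ball 0 r"])
      (use f B z r in \<open>auto intro: has_field_derivative_at_within\<close>)
  also have "\<dots> \<le> B * r"
    using z B[of z] by (intro mult_left_mono) (auto intro: order_trans[OF norm_ge_zero])
  finally show ?thesis using f by simp
qed

text \<open>The linear map \<open>u \<mapsto> u + \<kappa> u\<^sup>*\<close> is invertible, so the equation reads
  \<open>exp \<zeta> = 1 - x(\<zeta>)\<close> with a small perturbation \<open>x\<close>, which Brouwer's theorem solves near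
  \<open>2\<pi>\<i>\<close>.\<close>
lemma perturbed_exp_zero:
  assumes k: "0 \<le> k" "k < 1" "norm \<kappa> \<le> k"
    and cont: "continuous_on (cball (2 * pi * \<i>) 1) err"
    and small: "\<And>\<zeta>. \<zeta> \<in> cball (2 * pi * \<i>) 1 \<Longrightarrow> norm (err \<zeta>) \<le> (1 - k) / 4"
  obtains \<zeta> where "\<zeta> \<in> cball (2 * pi * \<i>) 1" "(exp \<zeta> - 1) + \<kappa> * cnj (exp \<zeta> - 1) + err \<zeta> = 0"
proof -
  define d where "d = 1 - (norm \<kappa>)\<^sup>2"
  \<comment> \<open>\<open>x\<close> is the preimage of \<open>err\<close> under the real linear map
    u + \<kappa> u*, whose determinant is \<open>d\<close>.\<close>
  define x where "x \<zeta> = (err \<zeta> - \<kappa> * cnj (err \<zeta>)) / d" for \<zeta>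
  have k2: "(norm \<kappa>)\<^sup>2 \<le> k\<^sup>2" using k by (intro power_mono) auto
  have dk: "d \<ge> (1 - k) * (1 + k)" using k2 by (simp add: d_def algebra_simps power2_eq_square)
  have d: "d > 0" using dk k mult_pos_pos[of "1 - k" "1 + k"] by linarith
  have \<kappa>\<kappa>: "\<kappa> * cnj \<kappa> = of_real (1 - d)"
    by (simp add: d_def complex_norm_square del: of_real_power)
  have xn: "norm (x \<zeta>) \<le> 1 / 4" if "\<zeta> \<in> cball (2 * pi * \<i>) 1" for \<zeta>
  proof -
    have "norm (err \<zeta> - \<kappa> * cnj (err \<zeta>)) \<le> norm (err \<zeta>) + norm \<kappa> * norm (err \<zeta>)"
      by (metis norm_triangle_ineq4 norm_mult complex_mod_cnj)
    also have "\<dots> = (1 + norm \<kappa>) * norm (err \<zeta>)" by (simp add: algebra_simps)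
    also have "\<dots> \<le> (1 + k) * ((1 - k) / 4)"
      using k small[OF that] by (intro mult_mono) auto
    also have "\<dots> \<le> d / 4" using dk by (simp add: algebra_simps)
    finally show ?thesis using d by (simp add: x_def norm_divide field_simps)
  qed
  \<comment> \<open>A fixed point satisfies exp \<zeta> = 1 - x(\<zeta>). The branch of the
    logarithm that sends 1 to 2 pi i keeps the solution away from the trivial zero at the
    origin.\<close>
  define f where "f \<zeta> = 2 * pi * \<i> + Ln (1 + (- x \<zeta>))" for \<zeta>
  have nonneg: "1 + (- x \<zeta>) \<notin> \<real>\<^sub>\<le>\<^sub>0" if "\<zeta> \<in> cball (2 * pi * \<i>) 1" for \<zeta>
  proof
    assume "1 + (- x \<zeta>) \<in> \<real>\<^sub>\<le>\<^sub>0"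
    then have "Re (1 + (- x \<zeta>)) \<le> 0" by (auto simp: complex_nonpos_Reals_iff)
    then show False using xn[OF that] complex_Re_le_cmod[of "x \<zeta>"] by simp
  qed
  obtain \<zeta> where \<zeta>: "\<zeta> \<in> cball (2 * pi * \<i>) 1" "f \<zeta> = \<zeta>"
  proof (rule brouwer_ball[of 1 "2 * pi * \<i>" f])
    have "continuous_on (cball (2 * pi * \<i>) 1) x"
      unfolding x_def using d cont by (intro continuous_intros) auto
    then show "continuous_on (cball (2 * pi * \<i>) 1) f"
      unfolding f_def using nonneg by (intro continuous_intros) auto
    show "f \<in> cball (2 * pi * \<i>) 1 \<rightarrow> cball (2 * pi * \<i>) 1"
    proof
      fix \<zeta> assume z: "\<zeta> \<in> cball (2 * pi * \<i>) 1"
      have "norm (Ln (1 + (- x \<zeta>))) \<le> 2 * norm (- x \<zeta>)"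
        using xn[OF z] by (intro norm_Ln_le) auto
      also have "\<dots> \<le> 1" using xn[OF z] by simp
      finally show "f \<zeta> \<in> cball (2 * pi * \<i>) 1" by (simp add: f_def dist_norm)
    qed
  qed auto
  have "exp \<zeta> = exp (f \<zeta>)" using \<zeta> by simp
  also have "\<dots> = 1 + (- x \<zeta>)"
  proof -
    have "1 + (- x \<zeta>) \<noteq> 0" using nonneg[OF \<zeta>(1)] by auto
    then have "exp (Ln (1 + (- x \<zeta>))) = 1 + (- x \<zeta>)" by (rule exp_Ln)
    moreover have "exp (complex_of_real (2 * pi) * \<i>) = 1"
      using exp_two_pi_i by simp
    ultimately show ?thesis by (simp only: f_def exp_add mult_1_left)
  qed
  finally have e: "exp \<zeta> - 1 = - x \<zeta>" by simp
  have "x \<zeta> + \<kappa> * cnj (x \<zeta>) = (err \<zeta> - \<kappa> * cnj \<kappa> * err \<zeta>) / d"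
    by (simp add: x_def add_divide_distrib[symmetric] right_diff_distrib)
  also have "\<dots> = err \<zeta>" using d by (simp add: \<kappa>\<kappa> left_diff_distrib)
  finally have "(exp \<zeta> - 1) + \<kappa> * cnj (exp \<zeta> - 1) + err \<zeta> = 0"
    unfolding e by (simp add: algebra_simps add_eq_0_iff)
  then show ?thesis using that \<zeta>(1) by blast
qed

text \<open>If U is the primitive of Q - 1 with U 0 = 0, then F = exp (\<zeta> + U), because the
  quotient has derivative zero. On the ball of radius 8 one has |U| \<le> 8 \<delta> \<le> 1/2,
  which makes |exp U - 1| \<le> 3/2 |U|. Radius 8 leaves room for the unit ball around 2 pi
  i.\<close>

lemma near_exponential:
  assumes F: "\<And>\<zeta>. \<zeta> \<in> ball 0 8 \<Longrightarrow> (F has_field_derivative Q \<zeta> * F \<zeta>) (at \<zeta>)" "F 0 = 1"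
    and Q: "Q holomorphic_on ball 0 8" "\<And>\<zeta>. \<zeta> \<in> ball 0 8 \<Longrightarrow> norm (Q \<zeta> - 1) \<le> \<delta>" "16 * \<delta> \<le> 1"
    and \<zeta>: "\<zeta> \<in> ball 0 8"
  shows "norm (F \<zeta> - exp \<zeta>) \<le> 12 * \<delta> * exp 8"
proof -
  have "(\<lambda>\<zeta>. Q \<zeta> - 1) holomorphic_on ball 0 8" by (intro holomorphic_intros Q)
  then obtain U0 where U0: "\<And>x. x \<in> ball 0 8 \<Longrightarrow> (U0 has_field_derivative Q x - 1) (at x within ball 0 8)"
    using holomorphic_convex_primitive'[of "ball 0 8" "\<lambda>\<zeta>. Q \<zeta> - 1"] by auto
  define U where "U x = U0 x - U0 0" for x
  have U: "(U has_field_derivative Q x - 1) (at x)" if "x \<in> ball 0 8" for x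
    unfolding U_def using U0[OF that] that at_within_open[OF that open_ball]
    by (auto intro!: derivative_eq_intros)
  have Un: "norm (U x) \<le> \<delta> * 8" if "x \<in> ball 0 8" for x
    by (rule norm_le_of_deriv_bound[OF U]) (use Q that in \<open>auto simp: U_def\<close>)
  have "(\<lambda>x. F x * exp (- x - U x)) constant_on ball 0 8"
  proof (rule has_field_derivative_0_imp_constant_on)
    fix x :: complex assume x: "x \<in> ball 0 8"
    show "((\<lambda>x. F x * exp (- x - U x)) has_field_derivative 0) (at x)"
      by (rule derivative_eq_intros F U x refl | simp add: algebra_simps)+
  qed auto
  then obtain c where c: "\<And>x. x \<in> ball 0 8 \<Longrightarrow> F x * exp (- x - U x) = c"
    by (auto simp: constant_on_def)
  have "F 0 * exp (- 0 - U 0) = c" by (rule c) auto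
  then have "c = 1" using F(2) by (simp add: U_def)
  then have "F \<zeta> = exp (\<zeta> + U \<zeta>)"
    using c[OF \<zeta>] by (simp add: exp_diff exp_minus exp_add field_simps)
  then have "F \<zeta> - exp \<zeta> = exp \<zeta> * (exp (U \<zeta>) - 1)" by (simp add: exp_add algebra_simps)
  then have "norm (F \<zeta> - exp \<zeta>) = norm (exp \<zeta>) * norm (exp (U \<zeta>) - 1)"
    by (simp only: norm_mult)
  also have "\<dots> \<le> exp 8 * (3 / 2 * norm (U \<zeta>))"
  proof (intro mult_mono norm_exp_bounds(2))
    show "norm (exp \<zeta>) \<le> exp 8"
      using \<zeta> complex_Re_le_cmod[of \<zeta>] by (simp add: norm_exp_eq_Re)
    show "norm (U \<zeta>) \<le> 1 / 2" using Un[OF \<zeta>] Q by linarith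
  qed auto
  also have "\<dots> \<le> exp 8 * (3 / 2 * (\<delta> * 8))"
    using Un[OF \<zeta>] by (intro mult_left_mono) auto
  finally show ?thesis by (simp add: algebra_simps)
qed

text \<open>The hypotheses are those of a rescaled map: \<open>Q\<close> is its pre-Schwarzian,
  \<open>W\<close> its dilatation, \<open>H\<close> and \<open>G\<close> its two parts. As R grows,
  Q tends to 1 and W to a constant, so the map tends to u + c cnj(W 0) cnj(u) with u = exp - 1,
  which has a second zero at 2 pi i. Because the dilatation stays below k < 1 this zero persists,
  for an \<open>R\<close> that depends on \<open>k\<close> alone.\<close>

lemma harmonic_second_zero:
  assumes k: "0 \<le> k" "k < 1"
  obtains R where "16 \<le> R"
    "\<And>Q W F H G c. Q holomorphic_on ball 0 R \<Longrightarrow> W holomorphic_on ball 0 R \<Longrightarrow>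
      (\<And>\<zeta>. \<zeta> \<in> ball 0 R \<Longrightarrow> norm (Q \<zeta>) \<le> 2) \<Longrightarrow> (\<And>\<zeta>. \<zeta> \<in> ball 0 R \<Longrightarrow> norm (W \<zeta>) \<le> k) \<Longrightarrow>
      Q 0 = 1 \<Longrightarrow> F 0 = 1 \<Longrightarrow> H 0 = 0 \<Longrightarrow> G 0 = 0 \<Longrightarrow> norm c = 1 \<Longrightarrow>
      (\<And>\<zeta>. \<zeta> \<in> ball 0 R \<Longrightarrow> (F has_field_derivative Q \<zeta> * F \<zeta>) (at \<zeta>)) \<Longrightarrow>
      (\<And>\<zeta>. \<zeta> \<in> ball 0 R \<Longrightarrow> (H has_field_derivative F \<zeta>) (at \<zeta>)) \<Longrightarrow>
      (\<And>\<zeta>. \<zeta> \<in> ball 0 R \<Longrightarrow> (G has_field_derivative W \<zeta> * F \<zeta>) (at \<zeta>)) \<Longrightarrow>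
      \<exists>\<zeta>\<in>ball 0 8. \<zeta> \<noteq> 0 \<and> H \<zeta> + c * cnj (G \<zeta>) = 0"
proof -
  \<comment> \<open>The errors of \<open>H\<close> and \<open>G\<close> add up to 8 * (12 + 13) *
    \<delta> * exp 8, which must stay below (1 - k) / 4. The choice R = 64 / \<delta> makes Q
    oscillate by at most \<delta> on the ball of radius 8.\<close>
  define \<delta> where "\<delta> = (1 - k) / (1000 * exp 8)"
  define R where "R = 64 / \<delta>"
  have \<delta>0: "0 < \<delta>" using k by (simp add: \<delta>_def)
  have "1 \<le> exp (8::real)" by simp
  then have "\<delta> \<le> 1 / 1000" using k unfolding \<delta>_def by (intro frac_le) auto
  then have \<delta>1: "16 * \<delta> \<le> 1" by simp
  have "R * \<delta> = 64" using \<delta>0 by (simp add: R_def)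
  moreover have "16 * \<delta> < 64" using \<delta>1 by simp
  ultimately have "16 * \<delta> \<le> R * \<delta>" by simp
  then have R: "16 \<le> R" using \<delta>0 by simp
  have \<delta>e: "8 * (25 * \<delta> * exp 8) \<le> (1 - k) / 4" using k by (simp add: \<delta>_def field_simps)
  show ?thesis
  proof (rule that[OF R], goal_cases)
    case (1 Q W F H G c)
    have sub: "ball 0 8 \<subseteq> ball (0::complex) R" using R by auto
    have W01: "norm (W \<zeta>) \<le> 1" if "\<zeta> \<in> ball 0 R" for \<zeta>
      using 1(4)[OF that] k by linarith
    have Q1: "norm (Q \<zeta> - 1) \<le> \<delta>" if "\<zeta> \<in> ball 0 8" for \<zeta>
    proof -
      have "norm (Q \<zeta> - Q 0) \<le> 4 * 2 / R * norm \<zeta>"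
        by (rule norm_diff_le_of_bounded[OF 1(1)]) (use 1(3) R that in auto)
      also have "\<dots> \<le> 4 * 2 / R * 8" using that R by (intro mult_left_mono) auto
      also have "\<dots> = \<delta>" using \<delta>0 by (simp add: R_def)
      finally show ?thesis using 1(5) by simp
    qed
    have W1: "norm (W \<zeta> - W 0) \<le> \<delta>" if "\<zeta> \<in> ball 0 8" for \<zeta>
    proof -
      have "norm (W \<zeta> - W 0) \<le> 4 * 1 / R * norm \<zeta>"
        by (rule norm_diff_le_of_bounded[OF 1(2)]) (use R W01 that in auto)
      also have "\<dots> \<le> 4 * 1 / R * 8" using that R by (intro mult_left_mono) auto
      also have "\<dots> \<le> \<delta>" using \<delta>0 by (simp add: R_def)
      finally show ?thesis .
    qed
    have Fe: "norm (F \<zeta> - exp \<zeta>) \<le> 12 * \<delta> * exp 8" if "\<zeta> \<in> ball 0 8" for \<zeta>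
      by (rule near_exponential[of F Q, OF 1(10)[OF subsetD[OF sub]] 1(6)
            holomorphic_on_subset[OF 1(1) sub] Q1 \<delta>1 that])
    have H: "norm (H \<zeta> - (exp \<zeta> - 1)) \<le> (12 * \<delta> * exp 8) * 8" if "\<zeta> \<in> ball 0 8" for \<zeta>
    proof (rule norm_le_of_deriv_bound[where f = "\<lambda>\<zeta>. H \<zeta> - (exp \<zeta> - 1)" and f' = "\<lambda>\<zeta>. F \<zeta> - exp \<zeta>"])
      show "((\<lambda>\<zeta>. H \<zeta> - (exp \<zeta> - 1)) has_field_derivative F x - exp x) (at x)" if "x \<in> ball 0 8" for x
        by (rule derivative_eq_intros 1(11) subsetD[OF sub that] refl | simp)+
      show "H 0 - (exp 0 - 1) = 0" using 1(7) by simp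
    qed (fact Fe that)+
    have GW: "norm (W \<zeta> * F \<zeta> - W 0 * exp \<zeta>) \<le> 13 * \<delta> * exp 8" if z: "\<zeta> \<in> ball 0 8" for \<zeta>
    proof -
      have "norm (exp \<zeta>) \<le> exp 8"
        using z complex_Re_le_cmod[of \<zeta>] by (simp add: norm_exp_eq_Re)
      moreover have "norm (W \<zeta>) \<le> 1" by (rule W01[OF subsetD[OF sub z]])
      ultimately have "norm (W \<zeta>) * norm (F \<zeta> - exp \<zeta>) + norm (W \<zeta> - W 0) * norm (exp \<zeta>)
          \<le> 1 * (12 * \<delta> * exp 8) + \<delta> * exp 8"
        using Fe[OF z] W1[OF z] \<delta>0 by (intro add_mono mult_mono) auto
      moreover have "W \<zeta> * F \<zeta> - W 0 * exp \<zeta> = W \<zeta> * (F \<zeta> - exp \<zeta>) + (W \<zeta> - W 0) * exp \<zeta>"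
        by (simp add: algebra_simps)
      ultimately show ?thesis
        using norm_triangle_ineq[of "W \<zeta> * (F \<zeta> - exp \<zeta>)" "(W \<zeta> - W 0) * exp \<zeta>"] \<delta>0
        by (simp add: norm_mult)
    qed
    have G: "norm (G \<zeta> - W 0 * (exp \<zeta> - 1)) \<le> (13 * \<delta> * exp 8) * 8" if "\<zeta> \<in> ball 0 8" for \<zeta>
    proof (rule norm_le_of_deriv_bound[where f = "\<lambda>\<zeta>. G \<zeta> - W 0 * (exp \<zeta> - 1)"
          and f' = "\<lambda>\<zeta>. W \<zeta> * F \<zeta> - W 0 * exp \<zeta>"])
      show "((\<lambda>\<zeta>. G \<zeta> - W 0 * (exp \<zeta> - 1)) has_field_derivative W x * F x - W 0 * exp x) (at x)"
        if "x \<in> ball 0 8" for x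
        by (rule derivative_eq_intros 1(12) subsetD[OF sub that] refl | simp)+
      show "G 0 - W 0 * (exp 0 - 1) = 0" using 1(8) by simp
    qed (fact GW that)+
    \<comment> \<open>What remains after both parts are replaced by their limits. The equation then
      has the form solved by \<open>perturbed_exp_zero\<close>, with \<kappa> = c cnj(W 0).\<close>
    define err where "err \<zeta> = (H \<zeta> - (exp \<zeta> - 1)) + c * cnj (G \<zeta> - W 0 * (exp \<zeta> - 1))" for \<zeta>
    have pi: "cball (2 * pi * \<i>) 1 \<subseteq> ball 0 8"
    proof
      fix x assume "x \<in> cball (2 * pi * \<i>) 1"
      then have "norm (2 * pi * \<i> - x) \<le> 1" by (simp add: dist_norm)
      moreover have "norm x \<le> norm (2 * pi * \<i>) + norm (2 * pi * \<i> - x)"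
        by (metis norm_triangle_sub add.commute norm_minus_commute)
      moreover have "norm (2 * pi * \<i>) < 6.4" using pi_approx by (simp add: norm_mult)
      ultimately show "x \<in> ball 0 8" by simp
    qed
    obtain \<zeta> where \<zeta>: "\<zeta> \<in> cball (2 * pi * \<i>) 1"
      "(exp \<zeta> - 1) + (c * cnj (W 0)) * cnj (exp \<zeta> - 1) + err \<zeta> = 0"
    proof (rule perturbed_exp_zero[OF k])
      show "norm (c * cnj (W 0)) \<le> k" using 1(4)[of 0] 1(9) R by (simp add: norm_mult)
      have "continuous_on (ball 0 8) H" "continuous_on (ball 0 8) G"
        by (rule DERIV_continuous_on[OF has_field_derivative_at_within[OF 1(11)[OF subsetD[OF sub]]]]
            DERIV_continuous_on[OF has_field_derivative_at_within[OF 1(12)[OF subsetD[OF sub]]]]; assumption)+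
      then have "continuous_on (ball 0 8) err"
        unfolding err_def by (intro continuous_intros)
      then show "continuous_on (cball (2 * pi * \<i>) 1) err"
        using pi continuous_on_subset by blast
      show "norm (err \<zeta>) \<le> (1 - k) / 4" if z: "\<zeta> \<in> cball (2 * pi * \<i>) 1" for \<zeta>
      proof -
        have "norm (err \<zeta>) \<le> norm (H \<zeta> - (exp \<zeta> - 1)) + norm (G \<zeta> - W 0 * (exp \<zeta> - 1))"
          unfolding err_def using 1(9) by (metis norm_triangle_ineq norm_mult complex_mod_cnj mult_1)
        moreover have "\<zeta> \<in> ball 0 8" using pi z by blast
        ultimately show ?thesis using H[of \<zeta>] G[of \<zeta>] \<delta>e by simp
      qed
    qed
    have "H \<zeta> + c * cnj (G \<zeta>) = 0"
      using \<zeta>(2) by (simp add: err_def algebra_simps)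
    moreover have "\<zeta> \<noteq> 0" 
    proof
      assume "\<zeta> = 0"
      then have "2 * pi \<le> 1" using \<zeta>(1) by (simp add: norm_mult)
      then show False using pi_gt3 by linarith
    qed
    ultimately show ?case using \<zeta>(1) pi by auto
  qed
qed

text \<open>The quotient in the hypothesis is tanh \<rho>, the pseudo-hyperbolic radius of the
  hyperbolic disk, and |1 - cnj c z| \<ge> 1 - |c|.\<close>

lemma ball_subset_hyp_disk:
  assumes c: "norm c < 1" and \<tau>: "0 < \<tau>" "\<tau> \<le> (exp (2 * \<rho>) - 1) / (exp (2 * \<rho>) + 1)" "\<tau> \<le> 1"
  shows "ball c (\<tau> * (1 - norm c)) \<subseteq> hyp_disk c \<rho>"
proof
  fix z assume "z \<in> ball c (\<tau> * (1 - norm c))"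
  then have zc: "norm (z - c) < \<tau> * (1 - norm c)" by (simp add: dist_norm norm_minus_commute)
  also have "\<dots> \<le> 1 - norm c" using c \<tau> by (simp add: mult_left_le_one_le)
  finally have z: "norm z < 1" using norm_triangle_sub[of z c] by simp
  have "norm c * norm z \<le> norm c" using z by (simp add: mult_left_le)
  then have "1 - norm c \<le> 1 - norm (cnj c * z)" by (simp add: norm_mult)
  also have "\<dots> \<le> norm (1 - cnj c * z)" by (metis norm_one norm_triangle_ineq2)
  finally have den: "1 - norm c \<le> norm (1 - cnj c * z)" .
  define p where "p = pseudo_hyp z c"
  have "\<tau> * (1 - norm c) \<le> \<tau> * norm (1 - cnj c * z)" using den \<tau> by (intro mult_left_mono) auto
  with zc have "norm (z - c) < \<tau> * norm (1 - cnj c * z)" by simp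
  then have p: "p < \<tau>" "0 \<le> p"
    using den c by (auto simp: p_def pseudo_hyp_def norm_divide divide_less_eq)
  have "p < (exp (2 * \<rho>) - 1) / (exp (2 * \<rho>) + 1)" "p < 1" using p \<tau> by auto
  then have "p * (exp (2 * \<rho>) + 1) < exp (2 * \<rho>) - 1"
    by (simp add: less_divide_eq add_pos_pos)
  then have "(1 + p) / (1 - p) < exp (2 * \<rho>)"
    using \<open>p < 1\<close> by (simp add: divide_less_eq algebra_simps)
  then have "ln ((1 + p) / (1 - p)) < ln (exp (2 * \<rho>))"
    using p \<open>p < 1\<close> by (subst ln_less_cancel_iff) auto
  then have "hyp_dist z c < \<rho>" by (simp add: hyp_dist_def p_def)
  then show "z \<in> hyp_disk c \<rho>" using z by (simp add: hyp_disk_def)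
qed

text \<open>Bloch's maximality trick: where \<open>(r - |z|) |h''/h'|\<close> is maximal and large, \<open>h\<close> rescales to a
  map close to the exponential, and \<open>exp\<close> composed with a real linear isomorphism is not injective.\<close>
proposition preschwarzian_bounded:
  assumes h: "h holomorphic_on ball 0 1" and g: "g holomorphic_on ball 0 1"
    and h0: "\<And>z. z \<in> ball 0 1 \<Longrightarrow> deriv h z \<noteq> 0"
    and ulu: "unif_loc_univalent (harm h g)"
    and k: "k < 1" "\<And>z. z \<in> ball 0 1 \<Longrightarrow> norm (dilat h g z) \<le> k"
  obtains M where "0 < M" "\<And>z. z \<in> ball 0 1 \<Longrightarrow> norm (deriv (deriv h) z / deriv h z) * (1 - norm z) \<le> M"
proof -
  define P where "P z = deriv (deriv h) z / deriv h z" for z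
  have h': "deriv h holomorphic_on ball 0 1" "deriv (deriv h) holomorphic_on ball 0 1"
    "deriv g holomorphic_on ball 0 1"
    using h g by (auto intro!: holomorphic_deriv)
  have P: "P holomorphic_on ball 0 1"
    unfolding P_def using h0 h g h' by (intro holomorphic_intros) auto
  have w: "dilat h g holomorphic_on ball 0 1"
    unfolding dilat_def using h0 h g h' by (intro holomorphic_intros) auto
  have k0: "0 \<le> k" using k(2)[of 0] norm_ge_zero[of "dilat h g 0"] by (simp del: norm_ge_zero)
  obtain \<rho> where \<rho>: "\<rho> > 0" "\<And>c. c \<in> ball 0 1 \<Longrightarrow> inj_on (harm h g) (hyp_disk c \<rho>)"
    using ulu unfolding unif_loc_univalent_def by blast
  define \<tau> where "\<tau> = (exp (2 * \<rho>) - 1) / (exp (2 * \<rho>) + 1)"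
  have \<tau>: "0 < \<tau>" "\<tau> \<le> 1" using \<rho> by (auto simp: \<tau>_def add_pos_pos divide_le_eq)
  show ?thesis
  proof (rule harmonic_second_zero[OF k0 k(1)], goal_cases)
    case (1 R)
    note R = 1(1) and zero = 1(2)
    \<comment> \<open>M \<ge> 2 R keeps the rescaled ball within half of the distance d, where
      maximality is useful; \<tau> M \<ge> R keeps it inside the hyperbolic disk on which f is
      injective.\<close>
    define M where "M = (2 + 1 / \<tau>) * R"
    have M: "M > 0" "M \<ge> 2 * R" "\<tau> * M \<ge> R"
      using \<tau> R by (auto simp: M_def field_simps add_pos_pos)
    have bd: "norm (P z1) * (1 - norm z1) \<le> M" if z1: "z1 \<in> ball 0 1" for z1
    proof (rule ccontr)
      assume "\<not> norm (P z1) * (1 - norm z1) \<le> M"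
      then have big: "norm (P z1) * (1 - norm z1) > M" by simp
      then have P1: "norm (P z1) > 0" using M by (cases "P z1 = 0") auto
      have lt: "M / norm (P z1) < 1 - norm z1" using big P1 by (simp add: divide_less_eq mult.commute)
      define t where "t = M / norm (P z1)"
      \<comment> \<open>Midpoint of |z1| + t and 1: shrinking the disk to radius r < 1 guarantees
        that the maximum is attained, while the value at z1 still exceeds M.\<close>
      define r where "r = (1 + norm z1 + t) / 2"
      have r: "r < 1" "r - norm z1 > M / norm (P z1)"
      proof -
        show "r < 1" using lt by (simp add: r_def t_def)
        show "r - norm z1 > M / norm (P z1)" using lt by (simp add: r_def t_def[symmetric] field_simps)
      qed
      have rz1: "r > norm z1" using r divide_pos_pos[OF M(1) P1] by linarith
      have cb: "cball 0 r \<subseteq> ball (0::complex) 1" using r by auto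
      have "continuous_on (cball 0 r) (\<lambda>z. (r - norm z) * norm (P z))"
        using holomorphic_on_imp_continuous_on[OF P] cb
        by (intro continuous_intros) (auto intro: continuous_on_subset)
      moreover have "compact (cball (0::complex) r)" "cball (0::complex) r \<noteq> {}"
        using rz1 norm_ge_zero[of z1] by (auto simp del: norm_ge_zero)
      ultimately obtain z0 where z0: "z0 \<in> cball 0 r"
        "\<And>z. z \<in> cball 0 r \<Longrightarrow> (r - norm z) * norm (P z) \<le> (r - norm z0) * norm (P z0)"
        using continuous_attains_sup[of "cball 0 r" "\<lambda>z. (r - norm z) * norm (P z)"] by blast
      define m where "m = P z0"
      define d where "d = r - norm z0"
      have "M < (r - norm z1) * norm (P z1)" using r P1 by (simp add: divide_less_eq)
      also have "\<dots> \<le> d * norm m" unfolding d_def m_def using rz1 by (intro z0) auto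
      finally have dm: "M < d * norm m" .
      have d: "d > 0" using dm M z0(1) by (cases "d = 0") (auto simp: d_def)
      have m: "m \<noteq> 0" using dm M by auto
      have z01: "norm z0 < 1" using z0(1) r by auto
      define \<eta> where "\<eta> = R / norm m"
      have Rm: "\<eta> \<le> d / 2" "\<eta> \<le> \<tau> * d"
      proof -
        show "\<eta> \<le> d / 2" using dm M m by (simp add: \<eta>_def field_simps)
        have "R \<le> \<tau> * (d * norm m)"
          using M(3) dm \<tau> mult_left_mono[of M "d * norm m" \<tau>] by linarith
        then show "\<eta> \<le> \<tau> * d" using m by (simp add: \<eta>_def divide_le_eq algebra_simps)
      qed
      have sz: "norm (\<zeta> / m) < \<eta>" if "\<zeta> \<in> ball 0 R" for \<zeta>
        using that m by (simp add: \<eta>_def norm_divide divide_strict_right_mono)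
      have inr: "r - norm (z0 + \<zeta> / m) \<ge> d / 2" if "\<zeta> \<in> ball 0 R" for \<zeta>
        using sz[OF that] Rm(1) norm_triangle_ineq[of z0 "\<zeta> / m"] by (simp add: d_def)
      have in1: "z0 + \<zeta> / m \<in> ball 0 1" if "\<zeta> \<in> ball 0 R" for \<zeta>
        using inr[OF that] d r by auto
      have hyp: "z0 + \<zeta> / m \<in> hyp_disk z0 \<rho>" if "\<zeta> \<in> ball 0 R" for \<zeta>
      proof -
        have "\<tau> * d \<le> \<tau> * (1 - norm z0)" using \<tau> r by (intro mult_left_mono) (auto simp: d_def)
        then have "norm (\<zeta> / m) < \<tau> * (1 - norm z0)" using sz[OF that] Rm(2) by linarith
        then have "z0 + \<zeta> / m \<in> ball z0 (\<tau> * (1 - norm z0))" by (simp add: dist_norm)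
        then show ?thesis using ball_subset_hyp_disk[OF z01, of \<tau> \<rho>] \<tau> by (auto simp: \<tau>_def)
      qed
      \<comment> \<open>This factor normalizes the derivative of the rescaled analytic part to 1 at
        the origin. It also multiplies g, and the unimodular constant q / cnj q repairs the
        conjugation, so that the combination is q times a difference of values of f.\<close>
      define q where "q = m / deriv h z0"
      have h0z: "deriv h z0 \<noteq> 0" using h0 z01 by auto
      have q: "q \<noteq> 0" using m h0z by (simp add: q_def)
      have lin: "((\<lambda>\<zeta>. z0 + \<zeta> / m) has_field_derivative 1 / m) (at x)" for x
        using m by (auto intro!: derivative_eq_intros)
      have img: "(\<lambda>\<zeta>. z0 + \<zeta> / m) ` ball 0 R \<subseteq> ball 0 1" using in1 by blast
      have comp: "(\<lambda>\<zeta>. f (z0 + \<zeta> / m)) holomorphic_on ball 0 R" if "f holomorphic_on ball 0 1" for f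
      proof -
        have "(\<lambda>\<zeta>. z0 + \<zeta> / m) holomorphic_on ball 0 R" using m by (intro holomorphic_intros) auto
        from holomorphic_on_compose_gen[OF this that img] show ?thesis by (simp add: o_def)
      qed
      have der: "((\<lambda>\<zeta>. f (z0 + \<zeta> / m)) has_field_derivative deriv f (z0 + \<zeta> / m) * (1 / m)) (at \<zeta>)"
        if "f holomorphic_on ball 0 1" "\<zeta> \<in> ball 0 R" for f and \<zeta> :: complex
        using DERIV_chain2[OF holomorphic_derivI[OF that(1) _ in1[OF that(2)]] lin] by auto
      have "\<exists>\<zeta>\<in>ball 0 8. \<zeta> \<noteq> 0 \<and> q * (h (z0 + \<zeta> / m) - h z0) +
          (q / cnj q) * cnj (q * (g (z0 + \<zeta> / m) - g z0)) = 0"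
      proof (rule zero[where Q = "\<lambda>\<zeta>. P (z0 + \<zeta> / m) / m" and W = "\<lambda>\<zeta>. dilat h g (z0 + \<zeta> / m)"
            and F = "\<lambda>\<zeta>. deriv h (z0 + \<zeta> / m) / deriv h z0"])
        fix \<zeta> :: complex assume \<zeta>: "\<zeta> \<in> ball 0 R"
        \<comment> \<open>On the rescaled ball r - |z| is still at least half of its value at the
          maximum point, so maximality loses only a factor 2.\<close>
        have "(d / 2) * norm (P (z0 + \<zeta> / m)) \<le> (r - norm (z0 + \<zeta> / m)) * norm (P (z0 + \<zeta> / m))"
          using inr[OF \<zeta>] by (intro mult_right_mono) auto
        also have "\<dots> \<le> d * norm m"
          unfolding d_def using z0(2)[of "z0 + \<zeta> / m"] inr[OF \<zeta>] d by (simp add: m_def)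
        finally have "norm (P (z0 + \<zeta> / m)) \<le> 2 * norm m" using d by (simp add: field_simps)
        then show "norm (P (z0 + \<zeta> / m) / m) \<le> 2" using m by (simp add: norm_divide divide_le_eq)
        show "norm (dilat h g (z0 + \<zeta> / m)) \<le> k" using k in1 \<zeta> by blast
        show "((\<lambda>\<zeta>. deriv h (z0 + \<zeta> / m) / deriv h z0) has_field_derivative
            P (z0 + \<zeta> / m) / m * (deriv h (z0 + \<zeta> / m) / deriv h z0)) (at \<zeta>)"
          using DERIV_cdivide[OF der[OF h'(1) \<zeta>], of "deriv h z0"] h0[OF in1[OF \<zeta>]]
          by (simp add: P_def field_simps)
        show "((\<lambda>\<zeta>. q * (h (z0 + \<zeta> / m) - h z0)) has_field_derivative
            deriv h (z0 + \<zeta> / m) / deriv h z0) (at \<zeta>)"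
          by (rule derivative_eq_intros der[OF h \<zeta>] refl)+ (use m in \<open>simp add: q_def\<close>)
        show "((\<lambda>\<zeta>. q * (g (z0 + \<zeta> / m) - g z0)) has_field_derivative
            dilat h g (z0 + \<zeta> / m) * (deriv h (z0 + \<zeta> / m) / deriv h z0)) (at \<zeta>)"
          by (rule derivative_eq_intros der[OF g \<zeta>] refl)+
            (use m h0[OF in1[OF \<zeta>]] in \<open>simp add: q_def dilat_def\<close>)
      next
        show "(\<lambda>\<zeta>. P (z0 + \<zeta> / m) / m) holomorphic_on ball 0 R"
          using comp[OF P] m by (intro holomorphic_intros) auto
      qed (use comp[OF w] m h0z q in \<open>auto simp: m_def norm_divide\<close>)
      then obtain \<zeta> where \<zeta>: "\<zeta> \<in> ball 0 8" "\<zeta> \<noteq> 0" "q * (h (z0 + \<zeta> / m) - h z0) +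
          (q / cnj q) * cnj (q * (g (z0 + \<zeta> / m) - g z0)) = 0" by blast
      have "q * (harm h g (z0 + \<zeta> / m) - harm h g z0) = 0"
      proof -
        have "(q / cnj q) * cnj (q * x) = q * cnj x" for x using q by simp
        with \<zeta>(3) q show ?thesis by (simp add: harm_def algebra_simps)
      qed
      then have "harm h g (z0 + \<zeta> / m) = harm h g z0" using q by simp
      moreover have "z0 + \<zeta> / m \<in> hyp_disk z0 \<rho>" "z0 \<in> hyp_disk z0 \<rho>"
        using hyp[of \<zeta>] hyp[of 0] \<zeta>(1) R by auto
      moreover have "inj_on (harm h g) (hyp_disk z0 \<rho>)" using \<rho>(2) z01 by auto
      ultimately have "z0 + \<zeta> / m = z0" by (blast dest: inj_onD)
      then show False using \<zeta>(2) m by simp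
    qed
    show ?case by (rule that[OF M(1)]) (use bd in \<open>simp add: P_def\<close>)
  qed
qed

section \<open>Green's formula with a radial weight\<close>

lemma nn_integral_lborel_shift:
  fixes c :: "'a::euclidean_space"
  assumes [measurable]: "F \<in> borel_measurable borel"
  shows "(\<integral>\<^sup>+x. F (c + x) \<partial>lborel) = (\<integral>\<^sup>+x. F x \<partial>lborel)"
  using nn_integral_distr[of "(+) c" lborel borel F] by (simp add: lborel_distr_plus)

lemma measurable_ennreal_indicator:
  fixes g :: "'a::euclidean_space \<Rightarrow> real"
  assumes "continuous_on A g" "open A"
  shows "(\<lambda>x. ennreal (g x) * indicator A x) \<in> borel_measurable borel"
proof -
  have "(\<lambda>x. ennreal (indicator A x *\<^sub>R g x)) \<in> borel_measurable borel"
    using assms by (intro measurable_compose[OF _ measurable_ennreal] borel_measurable_continuous_on_indicator) auto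
  also have "(\<lambda>x. ennreal (indicator A x *\<^sub>R g x)) = (\<lambda>x. ennreal (g x) * indicator A x)"
    by (auto simp: indicator_def)
  finally show ?thesis .
qed

text \<open>The integrals of the difference quotients vanish by translation invariance.\<close>
lemma integral_derivative_compact_support:
  fixes \<Phi> :: "complex \<Rightarrow> complex"
  assumes der: "\<And>z. (\<Phi> has_derivative D z) (at z)"
    and bd: "\<And>z u. norm (D z u) \<le> K * norm u"
    and supp: "\<And>z. norm z \<ge> R \<Longrightarrow> \<Phi> z = 0"
  shows "integrable lborel (\<lambda>z. D z v)" "integral\<^sup>L lborel (\<lambda>z. D z v) = 0"
proof -
  have cont: "continuous_on UNIV \<Phi>"
    by (rule has_derivative_continuous_on[OF der])
  have [measurable]: "\<Phi> \<in> borel_measurable borel"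
    using cont by (rule borel_measurable_continuous_onI)
  have "\<Phi> z = indicator (cball 0 R) z *\<^sub>R \<Phi> z" for z
    using supp[of z] by (cases "norm z \<le> R") auto
  then have int\<Phi>: "integrable lborel \<Phi>"
    using borel_integrable_compact[of "cball 0 R" \<Phi>] continuous_on_subset[OF cont] by simp
  have shift: "integrable lborel (\<lambda>z. \<Phi> (c + z)) \<and> integral\<^sup>L lborel (\<lambda>z. \<Phi> (c + z)) = integral\<^sup>L lborel \<Phi>" for c
    using integrable_distr_eq[of "(+) c" lborel borel \<Phi>] integral_distr[of "(+) c" lborel borel \<Phi>] int\<Phi>
    by (simp add: lborel_distr_plus)
  define t :: "nat \<Rightarrow> real" where "t n = 1 / (Suc n)" for n
  have t: "0 < t n" "t n \<le> 1" "t \<longlonglongrightarrow> 0" for n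
    unfolding t_def using LIMSEQ_inverse_real_of_nat by (auto simp: inverse_eq_divide)
  define s where "s n z = (1 / t n) *\<^sub>R (\<Phi> (t n *\<^sub>R v + z) - \<Phi> z)" for n z
  have [measurable]: "s n \<in> borel_measurable borel" for n unfolding s_def by measurable
  have lim: "(\<lambda>n. s n z) \<longlonglongrightarrow> D z v" for z
  proof -
    interpret bounded_linear "D z" using der has_derivative_bounded_linear by blast
    have "((\<lambda>x. \<Phi> (z + x *\<^sub>R v)) has_derivative (\<lambda>h. D z (h *\<^sub>R v))) (at 0)"
      by (rule has_derivative_compose[of "\<lambda>x. z + x *\<^sub>R v" "\<lambda>h. h *\<^sub>R v" 0 UNIV \<Phi> "D z"])
        (auto intro!: derivative_eq_intros der)
    then have "((\<lambda>h. norm (\<Phi> (z + h *\<^sub>R v) - \<Phi> z - h *\<^sub>R D z v) / norm h) \<longlongrightarrow> 0) (at 0)"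
      by (simp add: has_derivative_at scale)
    moreover have "norm (\<Phi> (z + h *\<^sub>R v) - \<Phi> z - h *\<^sub>R D z v) / norm h
        = norm ((1 / h) *\<^sub>R (\<Phi> (z + h *\<^sub>R v) - \<Phi> z) - D z v)" if "h \<noteq> 0" for h :: real
    proof -
      have "(1 / h) *\<^sub>R (\<Phi> (z + h *\<^sub>R v) - \<Phi> z) - D z v = (1 / h) *\<^sub>R (\<Phi> (z + h *\<^sub>R v) - \<Phi> z - h *\<^sub>R D z v)"
        using that by (simp add: scaleR_diff_right)
      then show ?thesis by (simp only: norm_scaleR) simp
    qed
    ultimately have "((\<lambda>h. norm ((1 / h) *\<^sub>R (\<Phi> (z + h *\<^sub>R v) - \<Phi> z) - D z v)) \<longlongrightarrow> 0) (at 0)"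
      by (elim Lim_transform_eventually) (simp add: eventually_at_filter)
    then have "((\<lambda>h. (1 / h) *\<^sub>R (\<Phi> (z + h *\<^sub>R v) - \<Phi> z)) \<longlongrightarrow> D z v) (at 0)"
      by (simp add: tendsto_norm_zero_iff LIM_zero_iff)
    moreover have "filterlim t (at 0) sequentially"
      using t by (auto simp: filterlim_at order_less_imp_not_eq2 intro!: always_eventually)
    ultimately show ?thesis
      unfolding s_def by (subst add.commute) (rule filterlim_compose)
  qed
  have lip: "norm (\<Phi> x - \<Phi> y) \<le> K * norm (x - y)" for x y
  proof (rule differentiable_bound[of UNIV])
    show "onorm (D z) \<le> K" for z by (rule onorm_le) (rule bd)
  qed (use der in auto)
  have K: "0 \<le> K"
    using order_trans[OF norm_ge_zero bd[of 0 1]] by simp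
  \<comment> \<open>The steps satisfy t n \<le> 1, so all difference quotients vanish outside radius
    R + |v|; inside, the Lipschitz bound applies.\<close>
  define w :: "complex \<Rightarrow> real" where "w z = indicator (cball 0 (R + norm v)) z *\<^sub>R (K * norm v)" for z
  have w: "integrable lborel w"
    unfolding w_def by (rule borel_integrable_compact) auto
  have dom: "norm (s n z) \<le> w z" for n z
  proof (cases "norm z \<le> R + norm v")
    case True
    have "norm (s n z) \<le> (1 / t n) * (K * norm (t n *\<^sub>R v))"
      unfolding s_def norm_scaleR using lip[of "t n *\<^sub>R v + z" z] t(1)[of n]
      by (intro mult_mono) auto
    then show ?thesis using True t(1)[of n] by (simp add: w_def)
  next
    case False
    have "norm (t n *\<^sub>R v) \<le> norm v" using t(1,2)[of n] by (simp add: mult_left_le_one_le)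
    then have "norm (t n *\<^sub>R v + z) \<ge> R"
      using False norm_triangle_ineq4[of "t n *\<^sub>R v + z" "t n *\<^sub>R v"] by simp
    moreover have "norm z \<ge> R" using False norm_ge_zero[of v] by linarith
    ultimately show ?thesis using False by (simp add: s_def supp w_def)
  qed
  have meas: "(\<lambda>z. D z v) \<in> borel_measurable lborel"
    by (rule borel_measurable_LIMSEQ_metric[OF _ lim]) simp
  show "integrable lborel (\<lambda>z. D z v)"
    by (rule integrable_dominated_convergence[OF meas _ w, of s]) (use lim dom in auto)
  have "(\<lambda>n. integral\<^sup>L lborel (s n)) \<longlonglongrightarrow> integral\<^sup>L lborel (\<lambda>z. D z v)"
    by (rule integral_dominated_convergence[OF meas _ w]) (use lim dom in auto)
  moreover have "integral\<^sup>L lborel (s n) = 0" for n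
    unfolding s_def using shift[of "t n *\<^sub>R v"] int\<Phi> by simp
  ultimately show "integral\<^sup>L lborel (\<lambda>z. D z v) = 0"
    using LIMSEQ_unique by (simp add: LIMSEQ_const_iff)
qed

lemma has_derivative_max_powr:
  fixes s x :: real
  assumes "1 < s"
  shows "((\<lambda>x. max 0 x powr s) has_real_derivative s * max 0 x powr (s - 1)) (at x)"
proof -
  consider "x > 0" | "x < 0" | "x = 0" by linarith
  then show ?thesis
  proof cases
    case 1
    have "((\<lambda>x. x powr s) has_real_derivative s * x powr (s - 1)) (at x)"
      using 1 by (auto intro!: derivative_eq_intros)
    then have "((\<lambda>x. max 0 x powr s) has_real_derivative s * x powr (s - 1)) (at x)"
      by (rule has_field_derivative_transform_within_open[where S = "{0<..}"]) (use 1 in auto)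
    then show ?thesis using 1 by simp
  next
    case 2
    have "((\<lambda>x. max 0 x powr s) has_real_derivative 0) (at x)"
      by (rule has_field_derivative_transform_within_open[where S = "{..<0}" and f = "\<lambda>_. 0"]) (use 2 in auto)
    then show ?thesis using 2 by simp
  next
    case 3
    \<comment> \<open>At the corner the difference quotient is at most |h| to the power s - 1, which
      tends to 0 since s > 1.\<close>
    have "((\<lambda>h::real. \<bar>h\<bar> powr (s - 1)) \<longlongrightarrow> 0) (at 0)"
      using assms by (auto intro!: tendsto_eq_intros)
    then have "((\<lambda>h. (max 0 (0 + h) powr s - max 0 0 powr s) / h) \<longlongrightarrow> 0) (at 0)"
    proof (rule Lim_null_comparison[rotated], intro always_eventually allI)
      fix h :: real
      show "norm ((max 0 (0 + h) powr s - max 0 0 powr s) / h) \<le> \<bar>h\<bar> powr (s - 1)"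
      proof (cases "h > 0")
        case False
        then have "max 0 (0 + h) = 0" by simp
        then show ?thesis using assms by simp
      qed (use assms in \<open>simp add: powr_diff\<close>)
    qed
    then show ?thesis using 3 assms by (simp add: DERIV_def)
  qed
qed

text \<open>A truncation of r^2 - |z|^2, extended by zero to the plane. For r < 1 its support is a
  compact subset of the disk, so weighted integrals of continuous functions are finite. Powers above
  1 are differentiable everywhere, so Green's formula has no boundary terms. On the disk,
  \<open>tw 1\<close> is the full weight 1 - |z|^2.\<close>

definition tw :: "real \<Rightarrow> complex \<Rightarrow> real" where
  "tw r z = max 0 (r\<^sup>2 - (norm z)\<^sup>2)"

lemma tw_nonneg [simp]: "0 \<le> tw r z" by (simp add: tw_def)

lemma tw_eq_0: "0 \<le> r \<Longrightarrow> r \<le> norm z \<Longrightarrow> tw r z = 0"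
  by (simp add: tw_def power_mono max_def)

lemma continuous_on_tw_powr [continuous_intros]: "0 < q \<Longrightarrow> continuous_on A (\<lambda>z. tw r z powr q)"
  unfolding tw_def by (intro continuous_on_powr' continuous_intros) auto

lemma integrable_tw_powr:
  fixes f :: "complex \<Rightarrow> 'a::{banach, second_countable_topology}"
  assumes "continuous_on (ball 0 R) f" "0 < r" "r < R" "0 < q"
  shows "integrable lborel (\<lambda>z. tw r z powr q *\<^sub>R f z)"
proof -
  have "integrable lborel (\<lambda>z. indicator (cball 0 r) z *\<^sub>R (tw r z powr q *\<^sub>R f z))"
    using assms by (intro borel_integrable_compact continuous_intros) (auto elim: continuous_on_subset)
  also have "(\<lambda>z. indicator (cball 0 r) z *\<^sub>R (tw r z powr q *\<^sub>R f z)) = (\<lambda>z. tw r z powr q *\<^sub>R f z)"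
  proof
    fix z :: complex
    show "indicator (cball 0 r) z *\<^sub>R (tw r z powr q *\<^sub>R f z) = tw r z powr q *\<^sub>R f z"
      using assms tw_eq_0[of r z] by (cases "norm z \<le> r") auto
  qed
  finally show ?thesis .
qed

lemma has_derivative_tw_powr:
  assumes "1 < s"
  shows "((\<lambda>z. complex_of_real (tw r z powr s)) has_derivative
      (\<lambda>v. - of_real (s * tw r z powr (s - 1)) * (cnj z * v + z * cnj v))) (at z)"
proof -
  have "((\<lambda>z. r\<^sup>2 - (norm z)\<^sup>2) has_derivative (\<lambda>v. - (2 * (z \<bullet> v)))) (at z)"
    unfolding power2_norm_eq_inner by (auto intro!: derivative_eq_intros simp: inner_commute)
  from has_derivative_compose[OF this has_derivative_max_powr[OF assms, unfolded has_field_derivative_def]]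
  have "((\<lambda>z. tw r z powr s) has_derivative (\<lambda>v. (s * tw r z powr (s - 1)) * - (2 * (z \<bullet> v)))) (at z)"
    by (simp add: tw_def)
  from bounded_linear.has_derivative[OF bounded_linear_of_real this]
  show ?thesis
    by (rule has_derivative_eq_rhs) (auto simp: fun_eq_iff complex_eq_iff inner_complex_def algebra_simps)
qed

text \<open>Here \<open>az\<close> and \<open>azb\<close> are the two Wirtinger derivatives of
  \<open>a\<close>. The product of \<open>a\<close> with the s-th power of the weight has compact
  support, so its derivatives integrate to zero, and the weight contributes - s tw^(s-1) cnj z and -
  s tw^(s-1) z.\<close>

lemma green_weight:
  fixes a az azb :: "complex \<Rightarrow> complex"
  assumes r: "0 < r" "r < R" and s: "1 < s"
    and der: "\<And>z. z \<in> ball 0 R \<Longrightarrow> (a has_derivative (\<lambda>v. az z * v + azb z * cnj v)) (at z)"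
    and cont: "continuous_on (ball 0 R) az" "continuous_on (ball 0 R) azb"
  shows "integral\<^sup>L lborel (\<lambda>z::complex. tw r z powr s *\<^sub>R az z - tw r z powr (s - 1) *\<^sub>R (of_real s * cnj z * a z)) = 0"
    and "integral\<^sup>L lborel (\<lambda>z::complex. tw r z powr s *\<^sub>R azb z - tw r z powr (s - 1) *\<^sub>R (of_real s * z * a z)) = 0"
proof -
  define A :: "complex \<Rightarrow> complex" where "A z = tw r z powr s *\<^sub>R az z - tw r z powr (s - 1) *\<^sub>R (of_real s * cnj z * a z)" for z :: complex
  define B :: "complex \<Rightarrow> complex" where "B z = tw r z powr s *\<^sub>R azb z - tw r z powr (s - 1) *\<^sub>R (of_real s * z * a z)" for z :: complex
  define \<Phi> where "\<Phi> z = of_real (tw r z powr s) * a z" for z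
  have ca: "continuous_on (ball 0 R) a"
    by (rule has_derivative_continuous_on[OF has_derivative_at_withinI[OF der]])
  have der\<Phi>: "(\<Phi> has_derivative (\<lambda>v. A z * v + B z * cnj v)) (at z)" for z :: complex
  proof (cases "norm z < R")
    case True
    show ?thesis unfolding \<Phi>_def
      by (rule has_derivative_eq_rhs[OF has_derivative_mult[OF has_derivative_tw_powr[OF s] der]])
        (use True in \<open>auto simp: fun_eq_iff A_def B_def scaleR_conv_of_real algebra_simps\<close>)
  next
    case False
    \<comment> \<open>Nothing is known about \<open>a\<close> out here, but the weight vanishes in a
      neighbourhood because r < R.\<close>
    have "(\<Phi> has_derivative (\<lambda>v. 0)) (at z)"
      by (rule has_derivative_transform_within_open[of "\<lambda>_. 0" "\<lambda>v. 0" z UNIV "- cball 0 r" \<Phi>])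
        (use False r in \<open>auto simp: \<Phi>_def tw_eq_0\<close>)
    moreover have "A z = 0" "B z = 0" using False r by (auto simp: A_def B_def tw_eq_0)
    ultimately show ?thesis by simp
  qed
  have "compact ((\<lambda>z. norm (A z) + norm (B z)) ` cball 0 r)"
  proof -
    have sub: "cball 0 r \<subseteq> ball (0::complex) R" using r by auto
    note c = cont[THEN continuous_on_subset, OF sub] ca[THEN continuous_on_subset, OF sub]
    show ?thesis
      unfolding A_def B_def by (intro compact_continuous_image continuous_intros c) (use s in auto)
  qed
  then obtain K where "\<forall>x\<in>cball 0 r. \<bar>norm (A x) + norm (B x)\<bar> \<le> K"
    by (auto dest!: compact_imp_bounded simp: bounded_iff)
  then have K: "norm (A z) + norm (B z) \<le> K" if "z \<in> cball 0 r" for z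
    using that by fastforce
  have K': "norm (A z) + norm (B z) \<le> max 0 K" for z
  proof (cases "norm z \<le> r")
    case True then show ?thesis using K[of z] by simp
  next
    case False then show ?thesis using r by (simp add: A_def B_def tw_eq_0)
  qed
  have bd: "norm (A z * u + B z * cnj u) \<le> max 0 K * norm u" for z u
  proof -
    have "norm (A z * u + B z * cnj u) \<le> (norm (A z) + norm (B z)) * norm u"
      using norm_triangle_ineq[of "A z * u" "B z * cnj u"] by (simp add: norm_mult algebra_simps)
    then show ?thesis using mult_right_mono[OF K'[of z] norm_ge_zero[of u]] by linarith
  qed
  note int = integral_derivative_compact_support[of \<Phi> "\<lambda>z v. A z * v + B z * cnj v" "max 0 K" r, OF der\<Phi> bd]
  have supp: "\<Phi> z = 0" if "norm z \<ge> r" for z using that r by (simp add: \<Phi>_def tw_eq_0)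
  \<comment> \<open>The directions 1 and \<i> give A + B and \<i> (A - B); the two Wirtinger
    coefficients are recovered as half sum and half difference.\<close>
  have i1: "integrable lborel (\<lambda>z. A z + B z)" "integral\<^sup>L lborel (\<lambda>z. A z + B z) = 0"
    using int[of 1, OF supp] by auto
  have i2: "integrable lborel (\<lambda>z. \<i> * (A z - B z))" "integral\<^sup>L lborel (\<lambda>z. \<i> * (A z - B z)) = 0"
    using int[of \<i>, OF supp] by (auto simp: algebra_simps)
  have i3: "integrable lborel (\<lambda>z. A z - B z)" "integral\<^sup>L lborel (\<lambda>z. A z - B z) = 0"
    using integrable_mult_right[OF i2(1), of "- \<i>"] i2(2) by auto
  have "integral\<^sup>L lborel (\<lambda>z. (A z + B z) + (A z - B z)) = 0"
    using i1 i3 by (subst Bochner_Integration.integral_add) auto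
  moreover have "(\<lambda>z. (A z + B z) + (A z - B z)) = (\<lambda>z. 2 * A z)" by auto
  ultimately show "integral\<^sup>L lborel (\<lambda>z::complex. tw r z powr s *\<^sub>R az z - tw r z powr (s - 1) *\<^sub>R (of_real s * cnj z * a z)) = 0"
    unfolding A_def[symmetric] by simp
  have "integral\<^sup>L lborel (\<lambda>z. (A z + B z) - (A z - B z)) = 0"
    using i1 i3 by (subst Bochner_Integration.integral_diff) auto
  moreover have "(\<lambda>z. (A z + B z) - (A z - B z)) = (\<lambda>z. 2 * B z)" by auto
  ultimately show "integral\<^sup>L lborel (\<lambda>z::complex. tw r z powr s *\<^sub>R azb z - tw r z powr (s - 1) *\<^sub>R (of_real s * z * a z)) = 0"
    unfolding B_def[symmetric] by simp
qed

section \<open>Area means of holomorphic functions\<close>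

text \<open>On the disk of radius r/2 the weight is at least 3/4 r^2. The exact value is pi r^4 / 2,
  but the bound only serves to normalize an area mean.\<close>

lemma integral_tw_lower:
  assumes "0 < r"
  shows "integral\<^sup>L lborel (tw r) \<ge> 3 * pi / 16 * r ^ 4"
proof -
  have i: "integrable lborel (tw r)"
    using integrable_tw_powr[of "r + 1" "\<lambda>_. 1::real" r 1] assms by simp
  have "integral\<^sup>L lborel (\<lambda>z::complex. indicator (ball 0 (r / 2)) z *\<^sub>R (3 / 4 * r\<^sup>2)) = measure lborel (ball (0::complex) (r/2)) * (3 / 4 * r\<^sup>2)"
    by simp
  also have "measure lborel (ball (0::complex) (r/2)) = pi * (r/2)\<^sup>2"
    using assms content_ball[of "r/2" "0::complex"] by (simp add: unit_ball_vol_2)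
  also have "pi * (r/2)\<^sup>2 * (3 / 4 * r\<^sup>2) = 3 * pi / 16 * r ^ 4"
    by (simp add: power2_eq_square power4_eq_xxxx)
  finally have "3 * pi / 16 * r ^ 4 = integral\<^sup>L lborel (\<lambda>z::complex. indicator (ball 0 (r / 2)) z *\<^sub>R (3 / 4 * r\<^sup>2))"
    by simp
  also have "\<dots> \<le> integral\<^sup>L lborel (tw r)"
  proof (rule integral_mono)
    fix z :: complex
    show "indicator (ball 0 (r / 2)) z *\<^sub>R (3 / 4 * r\<^sup>2) \<le> tw r z"
    proof (cases "z \<in> ball 0 (r / 2)")
      case True
      then have "(norm z)\<^sup>2 \<le> (r / 2)\<^sup>2" by (intro power_mono) auto
      then show ?thesis using True by (simp add: tw_def power_divide le_max_iff_disj)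
    qed auto
    show "integrable lborel (\<lambda>z::complex. indicator (ball 0 (r / 2)) z *\<^sub>R (3 / 4 * r\<^sup>2))"
      by (intro integrable_scaleR_left integrable_real_indicator emeasure_bounded_finite) auto
  qed (rule i)
  finally show ?thesis .
qed

text \<open>Mean value property without polar coordinates: f - f 0 = z k with k holomorphic, and
  Green's formula for the conjugate derivative of k, which is zero, with s = 2 says that z k has
  weighted integral zero.\<close>

lemma integral_tw_holomorphic:
  assumes f: "f holomorphic_on ball 0 R" and r: "0 < r" "r < R"
  shows "integral\<^sup>L lborel (\<lambda>z. tw r z *\<^sub>R f z) = integral\<^sup>L lborel (tw r) *\<^sub>R f 0"
proof -
  define k where "k z = (if z = 0 then deriv f 0 else (f z - f 0) / (z - 0))" for z
  have k: "k holomorphic_on ball 0 R"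
    unfolding k_def by (rule pole_lemma_open[OF f]) auto
  have "integral\<^sup>L lborel (\<lambda>z::complex. tw r z powr 2 *\<^sub>R 0 - tw r z powr (2 - 1) *\<^sub>R (of_real 2 * z * k z)) = 0"
  proof (rule green_weight(2)[OF r])
    show "(k has_derivative (\<lambda>v. deriv k z * v + 0 * cnj v)) (at z)" if "z \<in> ball 0 R" for z
      using holomorphic_derivI[OF k _ that] by (simp add: has_field_derivative_def)
    show "continuous_on (ball 0 R) (deriv k)"
      using k by (intro holomorphic_on_imp_continuous_on holomorphic_deriv) auto
  qed auto
  also have "(\<lambda>z::complex. tw r z powr 2 *\<^sub>R 0 - tw r z powr (2 - 1) *\<^sub>R (of_real 2 * z * k z))
      = (\<lambda>z. (-2) * (tw r z *\<^sub>R (f z - f 0)))"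
  proof
    fix z :: complex
    have "of_real 2 * z * k z = 2 * (f z - f 0)" by (simp add: k_def)
    then show "tw r z powr 2 *\<^sub>R 0 - tw r z powr (2 - 1) *\<^sub>R (of_real 2 * z * k z)
      = (-2) * (tw r z *\<^sub>R (f z - f 0))"
      by (simp only:) (simp add: scaleR_conv_of_real algebra_simps)
  qed
  finally have "integral\<^sup>L lborel (\<lambda>z. tw r z *\<^sub>R (f z - f 0)) = 0"
    by (simp only: integral_mult_right_zero) simp
  moreover have "integrable lborel (\<lambda>z. tw r z *\<^sub>R f z)" "integrable lborel (\<lambda>z. tw r z *\<^sub>R f 0)" "integrable lborel (tw r)"
    using integrable_tw_powr[of R f r 1] integrable_tw_powr[of R "\<lambda>_. f 0" r 1]
      integrable_tw_powr[of R "\<lambda>_. 1::real" r 1] r holomorphic_on_imp_continuous_on[OF f] by auto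
  ultimately show ?thesis by (simp add: scaleR_diff_right)
qed

text \<open>The mean value property is applied to f^2, whose modulus is the quantity wanted. The
  computation gives 64 / (3 pi), rounded up to 8. With extended nonnegative values the bound also
  covers functions that are not square integrable.\<close>

lemma norm_power2_le_area_mean:
  assumes f: "f holomorphic_on ball z \<rho>" and \<rho>: "0 < \<rho>"
  shows "ennreal ((norm (f z))\<^sup>2) \<le> ennreal (8 / \<rho>\<^sup>2) * (\<integral>\<^sup>+x\<in>ball z \<rho>. ennreal ((norm (f x))\<^sup>2) \<partial>lborel)"
proof -
  define F where "F x = (f (z + x))\<^sup>2" for x
  define r where "r = \<rho> / 2"
  have r: "0 < r" "r < \<rho>" using \<rho> by (auto simp: r_def)
  have "(\<lambda>x. f (z + x)) holomorphic_on ball 0 \<rho>"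
  proof -
    have "(\<lambda>x. z + x) holomorphic_on ball 0 \<rho>" by (intro holomorphic_intros)
    moreover have "(\<lambda>x. z + x) ` ball 0 \<rho> \<subseteq> ball z \<rho>" by (auto simp: dist_norm)
    ultimately show ?thesis using holomorphic_on_compose_gen[OF _ f] by (fastforce simp: o_def)
  qed
  then have F: "F holomorphic_on ball 0 \<rho>" unfolding F_def by (intro holomorphic_intros)
  define I where "I = integral\<^sup>L lborel (\<lambda>x. tw r x * norm (F x))"
  define c where "c = 3 * pi / 16 * r ^ 4"
  have c: "c > 0" using r by (simp add: c_def)
  have "c * norm (F 0) \<le> integral\<^sup>L lborel (tw r) * norm (F 0)"
    using integral_tw_lower[OF r(1)] by (intro mult_right_mono) (auto simp: c_def)
  also have "\<dots> = norm (integral\<^sup>L lborel (tw r) *\<^sub>R F 0)" by (simp add: integral_nonneg_AE)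
  also have "\<dots> = norm (integral\<^sup>L lborel (\<lambda>x. tw r x *\<^sub>R F x))"
    using integral_tw_holomorphic[OF F r] by simp
  also have "\<dots> \<le> integral\<^sup>L lborel (\<lambda>x. norm (tw r x *\<^sub>R F x))" by (rule integral_norm_bound)
  also have "\<dots> = I" by (simp add: I_def)
  finally have cI: "norm (F 0) \<le> (1 / c) * I" using c by (simp add: field_simps)
  have intI: "integrable lborel (\<lambda>x. tw r x * norm (F x))"
    using integrable_tw_powr[of \<rho> "\<lambda>x. norm (F x)" r 1] r holomorphic_on_imp_continuous_on[OF F]
    by (simp add: continuous_on_norm)
  have cont: "continuous_on (ball z \<rho>) (\<lambda>x. (norm (f x))\<^sup>2)"
    using holomorphic_on_imp_continuous_on[OF f] by (intro continuous_intros)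
  define N where "N = (\<integral>\<^sup>+x\<in>ball z \<rho>. ennreal ((norm (f x))\<^sup>2) \<partial>lborel)"
  have "ennreal I = (\<integral>\<^sup>+x. ennreal (tw r x * norm (F x)) \<partial>lborel)"
    unfolding I_def using intI by (subst nn_integral_eq_integral) auto
  also have "\<dots> \<le> (\<integral>\<^sup>+x. ennreal (r\<^sup>2) * (ennreal ((norm (f (z + x)))\<^sup>2) * indicator (ball z \<rho>) (z + x)) \<partial>lborel)"
  proof (rule nn_integral_mono)
    fix x :: complex
    show "ennreal (tw r x * norm (F x)) \<le> ennreal (r\<^sup>2) * (ennreal ((norm (f (z + x)))\<^sup>2) * indicator (ball z \<rho>) (z + x))"
    proof (cases "norm x < r")
      case True
      have "tw r x * norm (F x) \<le> r\<^sup>2 * (norm (f (z + x)))\<^sup>2"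
        by (intro mult_mono) (auto simp: tw_def F_def norm_power)
      then show ?thesis
        using True r by (simp add: dist_norm ennreal_mult[symmetric] ennreal_leI)
    qed (use r tw_eq_0 in simp)
  qed
  also have "\<dots> = ennreal (r\<^sup>2) * N"
    unfolding N_def using measurable_ennreal_indicator[OF cont open_ball]
    by (subst nn_integral_lborel_shift[of "\<lambda>x. ennreal (r\<^sup>2) * (ennreal ((norm (f x))\<^sup>2) * indicator (ball z \<rho>) x)" z])
      (auto simp: nn_integral_cmult)
  finally have IN: "ennreal I \<le> ennreal (r\<^sup>2) * N" .
  have "ennreal ((norm (f z))\<^sup>2) = ennreal (norm (F 0))" by (simp add: F_def norm_power)
  also have "\<dots> \<le> ennreal (1 / c) * ennreal I"
    using cI c by (subst ennreal_mult'[symmetric]) (auto intro: ennreal_leI)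
  also have "\<dots> \<le> ennreal (1 / c) * (ennreal (r\<^sup>2) * N)" by (intro mult_left_mono IN) auto
  also have "\<dots> = ennreal (1 / c * r\<^sup>2) * N" using c by (subst ennreal_mult) (auto simp: mult.assoc)
  also have "\<dots> \<le> ennreal (8 / \<rho>\<^sup>2) * N"
  proof (intro mult_right_mono ennreal_leI)
    have "1 / c * r\<^sup>2 = 64 / (3 * pi) / \<rho>\<^sup>2"
      using \<rho> by (simp add: c_def r_def field_simps power2_eq_square power4_eq_xxxx)
    also have "\<dots> \<le> 8 / \<rho>\<^sup>2" using pi_gt3 by (intro divide_right_mono) (auto simp: divide_le_eq)
    finally show "1 / c * r\<^sup>2 \<le> 8 / \<rho>\<^sup>2" .
  qed auto
  finally show ?thesis by (simp add: N_def)
qed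

text \<open>The area mean bounds u on the ball of half the radius by the square root of 32 n /
  \<rho>^2; Cauchy's estimate on that ball costs 4 / \<rho>, and 16 * 32 = 512.\<close>

lemma norm_deriv_power2_le_area_mean:
  assumes u: "u holomorphic_on ball z \<rho>" and \<rho>: "0 < \<rho>"
  shows "ennreal ((norm (deriv u z))\<^sup>2) \<le> ennreal (512 / \<rho> ^ 4) * (\<integral>\<^sup>+x\<in>ball z \<rho>. ennreal ((norm (u x))\<^sup>2) \<partial>lborel)"
    (is "_ \<le> _ * ?N")
proof (cases "?N = \<infinity>")
  case True
  then show ?thesis using \<rho> by (simp add: ennreal_mult_top)
next
  case False
  then obtain n where n: "?N = ennreal n" "0 \<le> n" by (cases ?N) auto
  have bd: "norm (u x) \<le> sqrt (32 * n / \<rho>\<^sup>2)" if x: "x \<in> ball z (\<rho> / 2)" for x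
  proof -
    have sub: "ball x (\<rho> / 2) \<subseteq> ball z \<rho>"
    proof
      fix y assume "y \<in> ball x (\<rho> / 2)"
      then show "y \<in> ball z \<rho>" using x dist_triangle[of z y x] by auto
    qed
    have "ennreal ((norm (u x))\<^sup>2) \<le> ennreal (8 / (\<rho> / 2)\<^sup>2) * (\<integral>\<^sup>+x\<in>ball x (\<rho> / 2). ennreal ((norm (u x))\<^sup>2) \<partial>lborel)"
      using \<rho> holomorphic_on_subset[OF u sub] by (intro norm_power2_le_area_mean) auto
    also have "\<dots> \<le> ennreal (8 / (\<rho> / 2)\<^sup>2) * ?N"
      using sub by (intro mult_left_mono nn_integral_mono) (auto simp: indicator_def)
    also have "\<dots> = ennreal (32 * n / \<rho>\<^sup>2)"
      using n \<rho> by (simp add: ennreal_mult[symmetric] power_divide)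
    finally have "(norm (u x))\<^sup>2 \<le> 32 * n / \<rho>\<^sup>2" using n by (simp add: ennreal_le_iff)
    then show ?thesis by (rule real_le_rsqrt)
  qed
  have "norm (deriv u z) \<le> 2 * sqrt (32 * n / \<rho>\<^sup>2) / (\<rho> / 2)"
  proof (rule norm_deriv_le_bound[OF _ _ bd])
    show "u holomorphic_on ball z (\<rho> / 2)" using \<rho> by (intro holomorphic_on_subset[OF u]) auto
  qed (use \<rho> in auto)
  then have "(norm (deriv u z))\<^sup>2 \<le> (2 * sqrt (32 * n / \<rho>\<^sup>2) / (\<rho> / 2))\<^sup>2" by (intro power_mono) auto
  also have "\<dots> = 512 / \<rho> ^ 4 * n"
    using n \<rho> by (simp add: power_divide power_mult_distrib field_simps power2_eq_square power4_eq_xxxx)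
  finally have "ennreal ((norm (deriv u z))\<^sup>2) \<le> ennreal (512 / \<rho> ^ 4 * n)" by (rule ennreal_leI)
  then show ?thesis using n \<rho> by (simp add: ennreal_mult[symmetric])
qed

text \<open>Tonelli: the radius of the averaging disk is measured at x and not at z, so for fixed x
  the points z form a disk of area pi A^2 (t x)^2. This turns pointwise bounds by local means into
  integral bounds.\<close>

lemma nn_integral_averaging:
  fixes \<Phi> \<Psi> :: "complex \<Rightarrow> ennreal" and t :: "complex \<Rightarrow> real"
  assumes [measurable]: "\<Psi> \<in> borel_measurable borel" "t \<in> borel_measurable borel"
    and t: "\<And>x. 0 \<le> t x" and A: "0 \<le> A"
    and le: "\<And>z. \<Phi> z \<le> C * (\<integral>\<^sup>+x. \<Psi> x * (if dist z x \<le> A * t x then 1 else 0) \<partial>lborel)"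
  shows "(\<integral>\<^sup>+z. \<Phi> z \<partial>lborel) \<le> C * ennreal (pi * A\<^sup>2) * (\<integral>\<^sup>+x. \<Psi> x * ennreal ((t x)\<^sup>2) \<partial>lborel)"
proof -
  let ?K = "\<lambda>z x. \<Psi> x * (if dist z x \<le> A * t x then 1 else 0)"
  have [measurable]: "(\<lambda>(z, x). ?K z x) \<in> borel_measurable (lborel \<Otimes>\<^sub>M lborel)"
    unfolding case_prod_beta by measurable
  have "(\<integral>\<^sup>+z. \<Phi> z \<partial>lborel) \<le> (\<integral>\<^sup>+z. C * (\<integral>\<^sup>+x. ?K z x \<partial>lborel) \<partial>lborel)"
    by (intro nn_integral_mono le)
  also have "\<dots> = C * (\<integral>\<^sup>+z. (\<integral>\<^sup>+x. ?K z x \<partial>lborel) \<partial>lborel)"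
    by (intro nn_integral_cmult) measurable
  also have "(\<integral>\<^sup>+z. (\<integral>\<^sup>+x. ?K z x \<partial>lborel) \<partial>lborel) = (\<integral>\<^sup>+x. (\<integral>\<^sup>+z. ?K z x \<partial>lborel) \<partial>lborel)"
    by (rule lborel_pair.Fubini'[symmetric]) measurable
  also have "\<dots> = (\<integral>\<^sup>+x. ennreal (pi * A\<^sup>2) * (\<Psi> x * ennreal ((t x)\<^sup>2)) \<partial>lborel)"
  proof (rule nn_integral_cong)
    fix x :: complex
    have "(\<integral>\<^sup>+z. ?K z x \<partial>lborel) = (\<integral>\<^sup>+z. \<Psi> x * indicator (cball x (A * t x)) z \<partial>lborel)"
      by (intro nn_integral_cong) (auto simp: indicator_def dist_commute)
    also have "\<dots> = \<Psi> x * emeasure lborel (cball x (A * t x))"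
      by (rule nn_integral_cmult_indicator) auto
    also have "emeasure lborel (cball x (A * t x)) = ennreal (pi * (A * t x)\<^sup>2)"
      using A t by (subst emeasure_cball) (auto simp: unit_ball_vol_2)
    also have "ennreal (pi * (A * t x)\<^sup>2) = ennreal (pi * A\<^sup>2) * ennreal ((t x)\<^sup>2)"
      by (subst ennreal_mult[symmetric]) (auto simp: power_mult_distrib)
    finally show "(\<integral>\<^sup>+z. ?K z x \<partial>lborel) = ennreal (pi * A\<^sup>2) * (\<Psi> x * ennreal ((t x)\<^sup>2))"
      by (simp add: mult_ac)
  qed
  also have "\<dots> = ennreal (pi * A\<^sup>2) * (\<integral>\<^sup>+x. \<Psi> x * ennreal ((t x)\<^sup>2) \<partial>lborel)"
    by (intro nn_integral_cmult) measurable
  finally show ?thesis by (simp add: mult.assoc)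
qed

section \<open>Weighted integrals over the disk and comparability on hyperbolically small
  disks\<close>

abbreviation disk_integral :: "(complex \<Rightarrow> real) \<Rightarrow> ennreal" (binder "\<integral>\<^sub>D " 10) where
  "disk_integral f \<equiv> (\<integral>\<^sup>+z\<in>ball 0 1. ennreal (f z) \<partial>lborel)"

abbreviation disk_weight :: "real \<Rightarrow> complex \<Rightarrow> complex \<Rightarrow> real" where
  "disk_weight p a z \<equiv> (1 - (norm (disk_aut a z))\<^sup>2) powr p"

lemma one_minus_norm_disk_aut:
  assumes "norm a < 1" "norm z < 1"
  shows "1 - (norm (disk_aut a z))\<^sup>2 = (1 - (norm a)\<^sup>2) * (1 - (norm z)\<^sup>2) / (norm (1 - cnj a * z))\<^sup>2"
    and "1 - cnj a * z \<noteq> 0"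
proof -
  have "norm (cnj a * z) < 1"
    using assms mult_strict_mono[of "norm a" 1 "norm z" 1] by (simp add: norm_mult)
  then show nz: "1 - cnj a * z \<noteq> 0" by auto
  have "(norm (1 - cnj a * z))\<^sup>2 - (norm (a - z))\<^sup>2 = (1 - (norm a)\<^sup>2) * (1 - (norm z)\<^sup>2)"
    unfolding cmod_power2 by (simp add: algebra_simps power2_eq_square)
  then show "1 - (norm (disk_aut a z))\<^sup>2 = (1 - (norm a)\<^sup>2) * (1 - (norm z)\<^sup>2) / (norm (1 - cnj a * z))\<^sup>2"
    using nz by (simp add: disk_aut_def norm_divide power_divide diff_divide_eq_iff)
qed

lemma one_minus_norm_power2:
  assumes "norm (z::complex) < 1"
  shows "0 < 1 - (norm z)\<^sup>2" "1 - norm z \<le> 1 - (norm z)\<^sup>2" "1 - (norm z)\<^sup>2 \<le> 2 * (1 - norm z)"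
proof -
  have "1 - (norm z)\<^sup>2 = (1 - norm z) * (1 + norm z)" by (simp add: algebra_simps power2_eq_square)
  moreover have "(1 - norm z) * 1 \<le> (1 - norm z) * (1 + norm z)" "(1 - norm z) * (1 + norm z) \<le> (1 - norm z) * 2"
    using assms by (intro mult_left_mono; simp)+
  moreover have "0 < (1 - norm z) * (1 + norm z)"
    using assms by (intro mult_pos_pos add_pos_nonneg) auto
  ultimately show "0 < 1 - (norm z)\<^sup>2" "1 - norm z \<le> 1 - (norm z)\<^sup>2" "1 - (norm z)\<^sup>2 \<le> 2 * (1 - norm z)"
    using assms by auto
qed

text \<open>Within half of the distance to the circle all relevant quantities change by bounded
  factors, uniformly in z and in the parameter a. The last factor 9 is 4 * 9/4: the first from 1 -
  |z|^2, the second from |1 - cnj a x| \<le> 3/2 |1 - cnj a z|.\<close>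

lemma disk_comparable:
  assumes z: "norm z < 1" and x: "norm (x - z) < (1 - norm z) / 2"
  shows "norm x < 1" "1 - (norm z)\<^sup>2 \<le> 4 * (1 - (norm x)\<^sup>2)" "1 - (norm x)\<^sup>2 \<le> 3 * (1 - (norm z)\<^sup>2)"
    "norm (x - z) \<le> 1 - (norm x)\<^sup>2"
    "norm a < 1 \<Longrightarrow> 1 - (norm (disk_aut a z))\<^sup>2 \<le> 9 * (1 - (norm (disk_aut a x))\<^sup>2)"
proof -
  have 1: "norm x \<le> norm z + norm (x - z)" "norm z \<le> norm x + norm (x - z)"
    using norm_triangle_sub[of x z] norm_triangle_sub[of z x] by (simp_all add: norm_minus_commute)
  show x1: "norm x < 1" using 1 x z by simp
  note Tz = one_minus_norm_power2[OF z] and Tx = one_minus_norm_power2[OF x1]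
  show 2: "1 - (norm z)\<^sup>2 \<le> 4 * (1 - (norm x)\<^sup>2)" "1 - (norm x)\<^sup>2 \<le> 3 * (1 - (norm z)\<^sup>2)"
    "norm (x - z) \<le> 1 - (norm x)\<^sup>2"
    using 1 x Tz Tx by argo+
  assume a: "norm a < 1"
  define X where "X = norm (1 - cnj a * x)"
  define Z where "Z = norm (1 - cnj a * z)"
  have "(1 - cnj a * x) - (1 - cnj a * z) = cnj a * (z - x)" by (simp add: algebra_simps)
  then have "norm ((1 - cnj a * x) - (1 - cnj a * z)) = norm a * norm (x - z)"
    by (simp add: norm_mult norm_minus_commute)
  then have d: "norm ((1 - cnj a * x) - (1 - cnj a * z)) \<le> norm (x - z)"
    using a by (simp add: mult_left_le_one_le)
  have "norm a * norm z \<le> norm z" using a by (simp add: mult_left_le_one_le)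
  moreover have "1 - norm a * norm z \<le> Z"
    unfolding Z_def using norm_triangle_ineq2[of 1 "cnj a * z"] by (simp add: norm_mult)
  ultimately have "1 - norm z \<le> Z" by simp
  moreover have "X \<le> Z + norm (x - z)"
    using d norm_triangle_sub[of "1 - cnj a * x" "1 - cnj a * z"] by (simp add: X_def Z_def)
  ultimately have "X \<le> 3 / 2 * Z" using x by simp
  then have "X\<^sup>2 \<le> (3 / 2 * Z)\<^sup>2" by (intro power_mono) (auto simp: X_def)
  then have XZ: "X\<^sup>2 \<le> 9 / 4 * Z\<^sup>2" by (simp add: power2_eq_square)
  have pos: "0 < X" "0 < Z" using one_minus_norm_disk_aut(2)[OF a] z x1 by (auto simp: X_def Z_def)
  have aa: "0 < 1 - (norm a)\<^sup>2" using one_minus_norm_power2[OF a] by simp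
  have "(1 - (norm a)\<^sup>2) * (1 - (norm z)\<^sup>2) * X\<^sup>2 \<le> (1 - (norm a)\<^sup>2) * (4 * (1 - (norm x)\<^sup>2)) * (9 / 4 * Z\<^sup>2)"
    using aa 2(1) XZ Tx(1) Tz(1) by (intro mult_mono mult_nonneg_nonneg) auto
  also have "\<dots> = (9 * ((1 - (norm a)\<^sup>2) * (1 - (norm x)\<^sup>2))) * Z\<^sup>2" by simp
  finally have "(1 - (norm a)\<^sup>2) * (1 - (norm z)\<^sup>2) / Z\<^sup>2 \<le> (9 * ((1 - (norm a)\<^sup>2) * (1 - (norm x)\<^sup>2))) / X\<^sup>2"
    using pos by (simp only: pos_divide_le_eq pos_le_divide_eq zero_less_power times_divide_eq_left)
  then show "1 - (norm (disk_aut a z))\<^sup>2 \<le> 9 * (1 - (norm (disk_aut a x))\<^sup>2)"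
    using one_minus_norm_disk_aut(1)[OF a z] one_minus_norm_disk_aut(1)[OF a x1] by (simp add: X_def Z_def)
qed

lemma continuous_on_disk_aut: "norm a < 1 \<Longrightarrow> continuous_on (ball 0 1) (disk_aut a)"
  unfolding disk_aut_def using one_minus_norm_disk_aut(2)[of a] by (intro continuous_intros) auto

lemma one_minus_norm_disk_aut_pos:
  "norm a < 1 \<Longrightarrow> norm z < 1 \<Longrightarrow> 0 < 1 - (norm (disk_aut a z))\<^sup>2"
  using one_minus_norm_disk_aut[of a z] one_minus_norm_power2(1)[of a] one_minus_norm_power2(1)[of z] by simp

lemma continuous_on_weight:
  "norm a < 1 \<Longrightarrow> continuous_on (ball 0 1) (\<lambda>z. disk_weight p a z)"
  using one_minus_norm_disk_aut_pos[of a]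
  by (intro continuous_on_powr continuous_intros continuous_on_disk_aut) (fastforce dest: less_imp_neq)+

lemma tw_1: "norm z < 1 \<Longrightarrow> tw 1 z = 1 - (norm z)\<^sup>2"
  using one_minus_norm_power2(1)[of z] by (simp add: tw_def)

text \<open>The local Cauchy estimate on the ball of radius (1 - |z|) / 2, where the weight is
  nearly constant, followed by averaging. The constant is chosen before \<open>u\<close> and
  \<open>a\<close>, which is what suprema over \<open>a\<close> require.\<close>

lemma nn_integral_deriv_weighted_le:
  assumes p: "0 < p"
  shows "\<exists>C\<ge>0. \<forall>u a. u holomorphic_on ball 0 1 \<longrightarrow> norm a < 1 \<longrightarrow>
    (\<integral>\<^sub>D z. (norm (deriv u z) * (1 - (norm z)\<^sup>2))\<^sup>2 * disk_weight p a z)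
      \<le> ennreal C * (\<integral>\<^sub>D z. (norm (u z))\<^sup>2 * disk_weight p a z)"
proof -
  \<comment> \<open>131072 = 512 * 4^4, from the Cauchy constant and \<rho> \<ge> T z / 4; the
    factor 9 compares the squares of T x and T z, and \<open>9 powr p\<close> compares the
    weights.\<close>
  define C where "C = 131072 * 9 * 9 powr p"
  have C: "C > 0" by (simp add: C_def)
  show ?thesis
  proof (intro exI[of _ "C * (pi * 1\<^sup>2)"] conjI allI impI)
    fix u a assume u: "u holomorphic_on ball 0 1" and a: "norm (a::complex) < 1"
    define om where "om z = disk_weight p a z" for z
    define T where "T z = 1 - (norm z)\<^sup>2" for z :: complex
    define \<Phi> where "\<Phi> z = ennreal ((norm (deriv u z) * T z)\<^sup>2 * om z) * indicator (ball 0 1) z" for z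
    \<comment> \<open>The division by the square of T x cancels the area of the averaging disks,
      whose radius is \<open>tw 1 x\<close>.\<close>
    define \<Psi> where "\<Psi> x = ennreal ((norm (u x))\<^sup>2 * om x / (T x)\<^sup>2) * indicator (ball 0 1) x" for x
    have T: "T z > 0" if "norm z < 1" for z using one_minus_norm_power2(1)[OF that] by (simp add: T_def)
    have com: "continuous_on (ball 0 1) om" unfolding om_def by (rule continuous_on_weight[OF a])
    have cu: "continuous_on (ball 0 1) u" by (rule holomorphic_on_imp_continuous_on[OF u])
    have m\<Psi>: "\<Psi> \<in> borel_measurable borel"
      unfolding \<Psi>_def T_def using T
      by (intro measurable_ennreal_indicator continuous_intros com cu) (fastforce simp: T_def)+
    have mt: "tw 1 \<in> borel_measurable borel"
      unfolding tw_def by (intro borel_measurable_continuous_onI continuous_intros)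
    note [measurable] = m\<Psi> mt
    have "(\<integral>\<^sup>+z. \<Phi> z \<partial>lborel) \<le> ennreal C * ennreal (pi * 1\<^sup>2) * (\<integral>\<^sup>+x. \<Psi> x * ennreal ((tw 1 x)\<^sup>2) \<partial>lborel)"
    proof (rule nn_integral_averaging[OF m\<Psi> mt])
      fix z :: complex
      show "\<Phi> z \<le> ennreal C * (\<integral>\<^sup>+x. \<Psi> x * (if dist z x \<le> 1 * tw 1 x then 1 else 0) \<partial>lborel)"
      proof (cases "norm z < 1")
        case z: True
        define \<rho> where "\<rho> = (1 - norm z) / 2"
        define K where "K = (T z)\<^sup>2 * om z * (512 / \<rho> ^ 4)"
        have \<rho>: "0 < \<rho>" using z by (simp add: \<rho>_def)
        have om0: "0 \<le> om x" for x by (simp add: om_def)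
        have sub: "ball z \<rho> \<subseteq> ball 0 1"
          using disk_comparable(1)[OF z] by (auto simp: \<rho>_def dist_norm norm_minus_commute)
        have uz: "u holomorphic_on ball z \<rho>" using u sub by (rule holomorphic_on_subset)
        have mu: "(\<lambda>x. ennreal ((norm (u x))\<^sup>2) * indicator (ball z \<rho>) x) \<in> borel_measurable borel"
          using continuous_on_subset[OF cu sub] by (intro measurable_ennreal_indicator continuous_intros) auto
        have "\<Phi> z = ennreal ((T z)\<^sup>2 * om z) * ennreal ((norm (deriv u z))\<^sup>2)"
          using z om0[of z] by (simp add: \<Phi>_def ennreal_mult[symmetric] power_mult_distrib mult_ac)
        also have "\<dots> \<le> ennreal ((T z)\<^sup>2 * om z) * (ennreal (512 / \<rho> ^ 4) * (\<integral>\<^sup>+x\<in>ball z \<rho>. ennreal ((norm (u x))\<^sup>2) \<partial>lborel))"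
          by (intro mult_left_mono norm_deriv_power2_le_area_mean[OF uz \<rho>]) auto
        also have "\<dots> = ennreal K * (\<integral>\<^sup>+x\<in>ball z \<rho>. ennreal ((norm (u x))\<^sup>2) \<partial>lborel)"
          unfolding K_def using om0 \<rho> by (subst ennreal_mult) (auto simp: mult.assoc)
        also have "\<dots> = (\<integral>\<^sup>+x. ennreal K * (ennreal ((norm (u x))\<^sup>2) * indicator (ball z \<rho>) x) \<partial>lborel)"
          using mu by (intro nn_integral_cmult[symmetric]) simp
        also have "\<dots> \<le> (\<integral>\<^sup>+x. ennreal C * (\<Psi> x * (if dist z x \<le> 1 * tw 1 x then 1 else 0)) \<partial>lborel)"
        proof (rule nn_integral_mono)
          fix x :: complex
          show "ennreal K * (ennreal ((norm (u x))\<^sup>2) * indicator (ball z \<rho>) x)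
              \<le> ennreal C * (\<Psi> x * (if dist z x \<le> 1 * tw 1 x then 1 else 0))"
          proof (cases "x \<in> ball z \<rho>")
            case True
            then have xz: "norm (x - z) < (1 - norm z) / 2" by (simp add: \<rho>_def dist_norm norm_minus_commute)
            note cmp = disk_comparable[OF z xz]
            have Tx: "0 < T x" "0 < T z" using T cmp(1) z by auto
            have "om z \<le> (9 * (1 - (norm (disk_aut a x))\<^sup>2)) powr p"
              unfolding om_def using cmp(5)[OF a] p one_minus_norm_disk_aut_pos[OF a z] by (intro powr_mono2) auto
            also have "\<dots> = 9 powr p * om x"
              using one_minus_norm_disk_aut_pos[OF a cmp(1)] unfolding om_def by (intro powr_mult)
            finally have o: "om z \<le> 9 powr p * om x" .
            have r: "T z / 4 \<le> \<rho>" using one_minus_norm_power2(3)[OF z] by (simp add: T_def \<rho>_def)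
            have "T x \<le> 3 * T z" using cmp(3) by (simp add: T_def)
            then have "(T x)\<^sup>2 \<le> (3 * T z)\<^sup>2" using Tx by (intro power_mono) auto
            then have t: "(T x)\<^sup>2 \<le> 9 * (T z)\<^sup>2" by (simp add: power2_eq_square)
            have "(T z / 4) ^ 4 \<le> \<rho> ^ 4" using r Tx by (intro power_mono) auto
            then have "512 / \<rho> ^ 4 \<le> 512 / (T z / 4) ^ 4" using Tx \<rho> by (intro divide_left_mono mult_pos_pos) auto
            also have "\<dots> = 131072 / (T z) ^ 4" by (simp add: power_divide)
            finally have "K \<le> (T z)\<^sup>2 * (9 powr p * om x) * (131072 / (T z) ^ 4)"
              unfolding K_def using o om0 \<rho> by (intro mult_mono) auto
            also have "\<dots> = 131072 * 9 powr p * om x * (1 / (T z)\<^sup>2)"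
              using Tx by (simp add: field_simps power2_eq_square power4_eq_xxxx)
            also have "\<dots> \<le> 131072 * 9 powr p * om x * (9 / (T x)\<^sup>2)"
            proof (intro mult_left_mono)
              show "1 / (T z)\<^sup>2 \<le> 9 / (T x)\<^sup>2" using t Tx by (simp add: divide_le_eq le_divide_eq mult.commute)
            qed (use om0 in auto)
            also have "\<dots> = C * om x / (T x)\<^sup>2" by (simp add: C_def)
            finally have "K * (norm (u x))\<^sup>2 \<le> C * om x / (T x)\<^sup>2 * (norm (u x))\<^sup>2"
              by (intro mult_right_mono) auto
            then have "K * (norm (u x))\<^sup>2 \<le> C * ((norm (u x))\<^sup>2 * om x / (T x)\<^sup>2)"
              by (simp add: mult_ac)
            moreover have "dist z x \<le> 1 * tw 1 x"
              using cmp(1,4) by (simp add: tw_1 dist_norm norm_minus_commute)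
            moreover have "0 \<le> K" using om0 \<rho> by (simp add: K_def)
            ultimately show ?thesis
              using True cmp(1) C om0 Tx
              by (simp add: \<Psi>_def ennreal_mult[symmetric] ennreal_leI)
          qed auto
        qed
        also have "\<dots> = ennreal C * (\<integral>\<^sup>+x. \<Psi> x * (if dist z x \<le> 1 * tw 1 x then 1 else 0) \<partial>lborel)"
          by (intro nn_integral_cmult) measurable
        finally show ?thesis .
      qed (simp add: \<Phi>_def)
    qed auto
    also have "(\<integral>\<^sup>+x. \<Psi> x * ennreal ((tw 1 x)\<^sup>2) \<partial>lborel) = (\<integral>\<^sub>D x. (norm (u x))\<^sup>2 * om x)"
    proof (rule nn_integral_cong)
      fix x :: complex
      show "\<Psi> x * ennreal ((tw 1 x)\<^sup>2) = ennreal ((norm (u x))\<^sup>2 * om x) * indicator (ball 0 1) x"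
      proof (cases "norm x < 1")
        case True
        then have "ennreal ((norm (u x))\<^sup>2 * om x / (T x)\<^sup>2) * ennreal ((T x)\<^sup>2) = ennreal ((norm (u x))\<^sup>2 * om x)"
          using T[of x] by (subst ennreal_mult[symmetric]) (auto simp: om_def)
        then show ?thesis using True by (simp add: \<Psi>_def tw_1 T_def)
      qed (simp add: \<Psi>_def)
    qed
    finally show "(\<integral>\<^sub>D z. (norm (deriv u z) * (1 - (norm z)\<^sup>2))\<^sup>2 * disk_weight p a z)
      \<le> ennreal (C * (pi * 1\<^sup>2)) * (\<integral>\<^sub>D z. (norm (u z))\<^sup>2 * disk_weight p a z)"
      using C by (simp add: \<Phi>_def om_def T_def ennreal_mult)
  qed (use C in auto)
qed

section \<open>The energy estimate\<close>

text \<open>If \<open>P = h''/h'\<close>, then \<open>c = z + 2 / P z\<close> is the pole of the Moebius transformation that agrees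
  with \<open>h\<close> at \<open>z\<close> to second order. Up to a positive factor, the hypothesis says that \<open>c\<close> lies well
  inside the disk; since \<open>h\<close> has no pole, its Schwarzian cannot be small on the segment from \<open>z\<close> to
  \<open>c\<close>. Quantitatively, \<open>y = (h')\<close> to the power \<open>-1/2\<close> satisfies \<open>y'' = -(S/2) y\<close> and its first order
  Taylor polynomial at \<open>z\<close> vanishes at \<open>c\<close>.\<close>
lemma schwarzian_large_near_interior_pole:
  fixes C0 \<delta> :: real
  assumes C0: "0 < C0" and \<delta>: "0 < \<delta>" "\<delta> \<le> 1"
  shows "\<exists>\<epsilon>>0. \<exists>A\<ge>1. \<forall>P z. P holomorphic_on ball 0 1 \<longrightarrow>
    (\<forall>x. norm x < 1 \<longrightarrow> norm (P x) * (1 - (norm x)\<^sup>2) \<le> C0) \<longrightarrow> norm z < 1 \<longrightarrow>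
    \<delta> < (norm (P z) * (1 - (norm z)\<^sup>2))\<^sup>2 / 4 - (1 - (norm z)\<^sup>2) - Re (z * P z) * (1 - (norm z)\<^sup>2) \<longrightarrow>
    (\<exists>\<zeta>. norm \<zeta> < 1 \<and> norm (\<zeta> - z) \<le> A * (1 - (norm \<zeta>)\<^sup>2) \<and>
      1 - (norm z)\<^sup>2 \<le> A * (1 - (norm \<zeta>)\<^sup>2) \<and> 1 - (norm \<zeta>)\<^sup>2 \<le> A * (1 - (norm z)\<^sup>2) \<and>
      \<epsilon> \<le> norm (deriv P \<zeta> - (P \<zeta>)\<^sup>2 / 2) * (1 - (norm \<zeta>)\<^sup>2)\<^sup>2)"
proof -
  \<comment> \<open>\<open>\<kappa>\<close> bounds T from below, relative to T z, along the segment
    to the pole. \<open>\<Lambda>\<close> bounds a primitive of P on that segment.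
    \<open>\<epsilon>\<close> makes the Taylor remainder at most half of the lower bound exp (-
    \<Lambda> / 2) for |y|. \<open>A\<close> measures how far the point found can lie from
    z.\<close>
  define \<kappa> where "\<kappa> = min 1 (4 * \<delta> / C0\<^sup>2)"
  define \<Lambda> where "\<Lambda> = 4 * C0 / (\<delta> * \<kappa>)"
  define \<epsilon> where "\<epsilon> = exp (- \<Lambda>) * \<delta>\<^sup>2 * \<kappa>\<^sup>2 / 16"
  define A where "A = 1 + 8 / (\<delta> * \<kappa>)"
  have \<kappa>: "0 < \<kappa>" "\<kappa> \<le> 1" using C0 \<delta> by (auto simp: \<kappa>_def)
  have \<Lambda>: "0 \<le> \<Lambda>" using C0 \<delta> \<kappa> by (simp add: \<Lambda>_def)
  have \<epsilon>: "0 < \<epsilon>" using \<delta> \<kappa> by (simp add: \<epsilon>_def)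
  have A: "1 \<le> A" using \<delta> \<kappa> by (simp add: A_def)
  show ?thesis
  proof (rule exI[of _ \<epsilon>], intro conjI \<epsilon>, rule exI[of _ A], intro conjI A allI impI, goal_cases)
    case (1 P z)
    note P = 1(1) and bl = 1(2) and z = 1(3) and big = 1(4)
    define T where "T x = 1 - (norm x)\<^sup>2" for x :: complex
    define S where "S x = deriv P x - (P x)\<^sup>2 / 2" for x
    have bl: "norm (P x) * T x \<le> C0" if "norm x < 1" for x using bl that by (simp add: T_def)
    have Tz: "0 < T z" "T z \<le> 1" using one_minus_norm_power2(1)[OF z] by (auto simp: T_def)
    define \<beta> where "\<beta> = norm (P z) * T z"
    have \<beta>0: "0 \<le> \<beta>" "\<beta> \<le> C0" using Tz bl[OF z] by (auto simp: \<beta>_def)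
    have big: "\<delta> < \<beta>\<^sup>2 / 4 - T z - Re (z * P z) * T z" using big by (simp add: \<beta>_def T_def)
    have "- Re (z * P z) \<le> norm (z * P z)" using abs_Re_le_cmod[of "z * P z"] by linarith
    also have "\<dots> \<le> norm (P z)" using z by (simp add: norm_mult mult_left_le_one_le)
    finally have "- Re (z * P z) * T z \<le> \<beta>" unfolding \<beta>_def using Tz by (intro mult_right_mono) auto
    with big Tz have b1: "\<delta> < \<beta>\<^sup>2 / 4 + \<beta>" by linarith
    \<comment> \<open>Otherwise \<beta> < 1/2, hence \<beta>^2 / 4 + \<beta> \<le> 5/4 \<beta> <
      \<delta>. This lower bound keeps the pole within distance 4 T z / \<delta> of z.\<close>
    have \<beta>: "\<delta> / 2 \<le> \<beta>"
    proof (rule ccontr)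
      assume n: "\<not> \<delta> / 2 \<le> \<beta>"
      then have "\<beta> * \<beta> \<le> \<beta> * 1" using \<beta>0 \<delta> by (intro mult_left_mono) auto
      then show False using b1 n \<delta> \<beta>0 by (simp add: power2_eq_square)
    qed
    then have \<beta>pos: "0 < \<beta>" using \<delta> by simp
    then have Pz: "P z \<noteq> 0" by (auto simp: \<beta>_def)
    define c where "c = z + 2 / P z"
    have cz: "norm (c - z) \<le> 4 * T z / \<delta>"
    proof -
      have "norm (c - z) = 2 * T z / \<beta>" using Tz Pz by (simp add: c_def norm_divide \<beta>_def)
      also have "\<dots> \<le> 2 * T z / (\<delta> / 2)" using \<beta> \<delta> Tz by (intro divide_left_mono) auto
      finally show ?thesis by simp
    qed
    \<comment> \<open>Expanding |c P z|^2 gives the exact relation between the hypothesis and the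
      pole: T c times \<beta>^2 is 4 T z times the quantity assumed to exceed \<delta>. So c lies in
      the disk, and T c is at least a fixed multiple of T z.\<close>
    have "c * P z = z * P z + 2" using Pz by (simp add: c_def field_simps)
    then have "(norm c)\<^sup>2 * (norm (P z))\<^sup>2 = (norm (z * P z + 2))\<^sup>2"
      by (metis norm_mult power_mult_distrib)
    also have "\<dots> = (norm z)\<^sup>2 * (norm (P z))\<^sup>2 + 4 * Re (z * P z) + 4"
      unfolding cmod_power2 by (simp add: algebra_simps power2_eq_square)
    finally have "T c * (norm (P z))\<^sup>2 = T z * (norm (P z))\<^sup>2 - 4 * Re (z * P z) - 4"
      by (simp add: T_def algebra_simps)
    then have "(T c * (norm (P z))\<^sup>2) * (T z)\<^sup>2 = (T z * (norm (P z))\<^sup>2 - 4 * Re (z * P z) - 4) * (T z)\<^sup>2"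
      by simp
    then have "T c * \<beta>\<^sup>2 = 4 * T z * (\<beta>\<^sup>2 / 4 - T z - Re (z * P z) * T z)"
      by (simp add: \<beta>_def algebra_simps power2_eq_square)
    also have "\<dots> \<ge> 4 * T z * \<delta>" using big Tz by (intro mult_left_mono) auto
    finally have Tc1: "4 * T z * \<delta> \<le> T c * \<beta>\<^sup>2" .
    have Tcpos: "0 < T c"
    proof (rule ccontr)
      assume "\<not> 0 < T c"
      then have "T c * \<beta>\<^sup>2 \<le> 0" by (simp add: mult_nonpos_nonneg)
      moreover have "0 < 4 * T z * \<delta>" using Tz \<delta> by simp
      ultimately show False using Tc1 by linarith
    qed
    have "\<beta>\<^sup>2 \<le> C0\<^sup>2" using \<beta>0 by (intro power_mono) auto
    then have "T c * \<beta>\<^sup>2 \<le> T c * C0\<^sup>2" using Tcpos by (intro mult_left_mono) auto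
    then have "4 * \<delta> / C0\<^sup>2 * T z \<le> T c" using Tc1 C0 by (simp add: field_simps)
    moreover have "\<kappa> * T z \<le> 4 * \<delta> / C0\<^sup>2 * T z" "\<kappa> * T z \<le> 1 * T z"
      using Tz by (intro mult_right_mono; simp add: \<kappa>_def)+
    ultimately have \<kappa>T: "\<kappa> * T z \<le> T c" "\<kappa> * T z \<le> T z" by simp_all
    define \<sigma> where "\<sigma> = closed_segment z c"
    \<comment> \<open>The modulus is convex, so its maximum on the segment is at an endpoint and the
      lower bound for T at z and c holds in between.\<close>
    have "closed_segment z c \<subseteq> cball 0 (max (norm z) (norm c))"
      by (intro closed_segment_subset) auto
    then have T\<sigma>: "\<kappa> * T z \<le> T x" if "x \<in> \<sigma>" for x
    proof -
      have "norm x \<le> norm z \<or> norm x \<le> norm c" using that \<open>closed_segment z c \<subseteq> _\<close> by (auto simp: \<sigma>_def le_max_iff_disj)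
      then have "(norm x)\<^sup>2 \<le> (norm z)\<^sup>2 \<or> (norm x)\<^sup>2 \<le> (norm c)\<^sup>2" by (auto intro: power_mono)
      then show ?thesis using \<kappa>T unfolding T_def by (elim disjE) linarith+
    qed
    have \<kappa>Tpos: "0 < \<kappa> * T z" using \<kappa> Tz by simp
    have in1: "norm x < 1" if "x \<in> \<sigma>" for x
    proof -
      have "(norm x)\<^sup>2 < 1\<^sup>2" using T\<sigma>[OF that] \<kappa>Tpos by (simp add: T_def)
      then show ?thesis by (rule power2_less_imp_less) simp
    qed
    have d\<sigma>: "norm (x - z) \<le> 4 * T z / \<delta>" "norm (c - x) \<le> 4 * T z / \<delta>" if "x \<in> \<sigma>" for x
      using segment_bound[of x z c] that cz by (auto simp: \<sigma>_def norm_minus_commute)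
    have zc: "z \<in> \<sigma>" "c \<in> \<sigma>" "convex \<sigma>" by (auto simp: \<sigma>_def)
    obtain U0 where U0: "\<And>x. x \<in> ball 0 1 \<Longrightarrow> (U0 has_field_derivative P x) (at x within ball 0 1)"
      using holomorphic_convex_primitive'[of "ball 0 1" P] P by auto
    define U where "U x = U0 x - U0 z" for x
    have U: "(U has_field_derivative P x) (at x)" if "norm x < 1" for x
      unfolding U_def using U0[of x] that at_within_open[of x "ball 0 1"]
      by (auto intro!: derivative_eq_intros)
    have Un: "norm (U x) \<le> \<Lambda>" if x: "x \<in> \<sigma>" for x
    proof -
      have "norm (U x - U z) \<le> C0 / (\<kappa> * T z) * norm (x - z)"
      proof (rule field_differentiable_bound[OF zc(3)])
        show "(U has_field_derivative P y) (at y within \<sigma>)" if "y \<in> \<sigma>" for y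
          by (rule has_field_derivative_at_within[OF U[OF in1[OF that]]])
        show "norm (P y) \<le> C0 / (\<kappa> * T z)" if "y \<in> \<sigma>" for y
        proof -
          have "norm (P y) * (\<kappa> * T z) \<le> norm (P y) * T y" using T\<sigma>[OF that] by (intro mult_left_mono) auto
          then show ?thesis using bl[OF in1[OF that]] \<kappa>Tpos by (simp only: pos_le_divide_eq)
        qed
      qed (use zc x in auto)
      also have "\<dots> \<le> C0 / (\<kappa> * T z) * (4 * T z / \<delta>)"
        using d\<sigma>[OF x] C0 \<kappa>Tpos by (intro mult_left_mono) auto
      also have "\<dots> = \<Lambda>" using Tz \<kappa> by (simp add: \<Lambda>_def field_simps)
      finally show ?thesis by (simp add: U_def)
    qed
    define y where "y x = exp (- U x / 2)" for x
    have ylow: "exp (- \<Lambda> / 2) \<le> norm (y x)" and yup: "norm (y x) \<le> exp (\<Lambda> / 2)" if "x \<in> \<sigma>" for x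
      using abs_Re_le_cmod[of "U x"] Un[OF that] by (auto simp: y_def norm_exp_eq_Re)
    \<comment> \<open>The first order Taylor polynomial of y with base point x, evaluated at the
      fixed point c. As x moves from z to c its value goes from 0 to y c, while its derivative is (c
      - x) y'', which a small S would keep too small.\<close>
    define \<phi> where "\<phi> x = y x + (c - x) * (- (P x / 2) * y x)" for x
    have der: "(\<phi> has_field_derivative - ((c - x) / 2 * S x * y x)) (at x)" if "norm x < 1" for x
    proof -
      have "(P has_field_derivative deriv P x) (at x)"
        using that by (intro holomorphic_derivI[OF P]) auto
      then show ?thesis unfolding \<phi>_def y_def
        by (auto intro!: derivative_eq_intros U that simp: S_def field_simps power2_eq_square)
    qed
    have "\<exists>x\<in>\<sigma>. \<epsilon> \<le> norm (S x) * (T x)\<^sup>2"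
    proof (rule ccontr)
      assume "\<not> (\<exists>x\<in>\<sigma>. \<epsilon> \<le> norm (S x) * (T x)\<^sup>2)"
      then have small: "norm (S x) * (T x)\<^sup>2 \<le> \<epsilon>" if "x \<in> \<sigma>" for x using that by force
      have "norm (\<phi> c - \<phi> z) \<le> (4 * T z / \<delta>) / 2 * (\<epsilon> / (\<kappa> * T z)\<^sup>2) * exp (\<Lambda> / 2) * norm (c - z)"
      proof (rule field_differentiable_bound[OF zc(3)])
        show "(\<phi> has_field_derivative - ((c - x) / 2 * S x * y x)) (at x within \<sigma>)" if "x \<in> \<sigma>" for x
          by (rule has_field_derivative_at_within[OF der[OF in1[OF that]]])
        show "norm (- ((c - x) / 2 * S x * y x)) \<le> (4 * T z / \<delta>) / 2 * (\<epsilon> / (\<kappa> * T z)\<^sup>2) * exp (\<Lambda> / 2)"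
          if x: "x \<in> \<sigma>" for x
        proof -
          have "(\<kappa> * T z)\<^sup>2 \<le> (T x)\<^sup>2" using T\<sigma>[OF x] \<kappa>Tpos by (intro power_mono) auto
          then have "norm (S x) * (\<kappa> * T z)\<^sup>2 \<le> norm (S x) * (T x)\<^sup>2" by (intro mult_left_mono) auto
          then have "norm (S x) \<le> \<epsilon> / (\<kappa> * T z)\<^sup>2"
            using small[OF x] \<kappa>Tpos by (simp only: pos_le_divide_eq zero_less_power)
          moreover have "norm ((c - x) / 2) \<le> 4 * T z / \<delta> / 2"
            using d\<sigma>(2)[OF x] by (simp add: norm_divide)
          ultimately show ?thesis
            unfolding norm_minus_cancel norm_mult using yup[OF x] \<epsilon> Tz \<delta>
            by (intro mult_mono mult_nonneg_nonneg) auto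
        qed
      qed (use zc in auto)
      also have "\<dots> \<le> (4 * T z / \<delta>) / 2 * (\<epsilon> / (\<kappa> * T z)\<^sup>2) * exp (\<Lambda> / 2) * (4 * T z / \<delta>)"
        using cz \<epsilon> Tz \<delta> by (intro mult_left_mono) auto
      also have "\<dots> = exp (- \<Lambda>) * exp (\<Lambda> / 2) / 2"
        using Tz \<delta> \<kappa> by (simp add: \<epsilon>_def field_simps power2_eq_square)
      also have "exp (- \<Lambda>) * exp (\<Lambda> / 2) = exp (- \<Lambda> / 2)"
        by (simp add: exp_add[symmetric])
      finally have "norm (\<phi> c - \<phi> z) \<le> exp (- \<Lambda> / 2) / 2" .
      moreover have "\<phi> z = 0" using Pz by (simp add: \<phi>_def c_def y_def U_def)
      moreover have "\<phi> c = y c" by (simp add: \<phi>_def)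
      ultimately have "norm (y c) \<le> exp (- \<Lambda> / 2) / 2" by simp
      then show False using ylow[OF zc(2)] exp_gt_zero[of "- \<Lambda> / 2"] by linarith
    qed
    then obtain x where x: "x \<in> \<sigma>" "\<epsilon> \<le> norm (S x) * (T x)\<^sup>2" by blast
    have \<delta>\<kappa>: "0 < \<delta> * \<kappa>" using \<delta> \<kappa> by simp
    have Ax: "T z * 8 / \<delta> \<le> (A - 1) * T x"
    proof -
      have "(A - 1) * (\<kappa> * T z) \<le> (A - 1) * T x" using T\<sigma>[OF x(1)] A by (intro mult_left_mono) auto
      moreover have "(A - 1) * (\<kappa> * T z) = T z * 8 / \<delta>" using \<delta> \<kappa> by (simp add: A_def)
      ultimately show ?thesis by simp
    qed
    have Txpos: "0 < T x" using T\<sigma>[OF x(1)] \<kappa>Tpos by linarith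
    have "norm (x - z) \<le> A * T x"
    proof -
      have "4 * T z / \<delta> \<le> T z * 8 / \<delta>" using Tz \<delta> by (simp add: divide_right_mono)
      then show ?thesis using d\<sigma>(1)[OF x(1)] Ax Txpos by (simp add: algebra_simps)
    qed
    moreover have "T z \<le> A * T x"
    proof -
      have "T z * 1 \<le> T z * (8 / \<delta>)" using Tz \<delta> by (intro mult_left_mono) (auto simp: le_divide_eq)
      then show ?thesis using Ax Txpos by (simp add: algebra_simps)
    qed
    moreover have "T x \<le> A * T z"
    proof -
      have nz: "norm z \<le> norm x + norm (x - z)" using norm_triangle_sub[of z x] by (simp add: norm_minus_commute)
      have "T x - T z = (norm z - norm x) * (norm z + norm x)" by (simp add: T_def algebra_simps power2_eq_square)
      also have "\<dots> \<le> norm (x - z) * 2"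
        using nz z in1[OF x(1)] by (intro mult_mono) auto
      also have "\<dots> \<le> 8 * T z / \<delta>" using d\<sigma>(1)[OF x(1)] by simp
      also have "\<dots> \<le> 8 * T z / (\<delta> * \<kappa>)" using \<delta> \<kappa> Tz by (intro divide_left_mono) (auto simp: mult_left_le)
      finally show ?thesis by (simp add: A_def algebra_simps)
    qed
    ultimately show ?case using x in1[OF x(1)] unfolding T_def S_def by blast
  qed
qed

lemma continuous_on_one_minus_norm_powr:
  "continuous_on (ball 0 1) (\<lambda>x::complex. (1 - (norm x)\<^sup>2) powr q)"
  by (intro continuous_on_powr continuous_intros)
    (use one_minus_norm_power2(1) in \<open>force dest: less_imp_neq\<close>)

text \<open>Near each bad z there is \<zeta> with |S| T^2 \<ge> \<epsilon>, and subharmonicity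
  spreads this over a disk around \<zeta>. How \<zeta> depends on z is uncontrolled, so that disk is
  replaced by a condition on \<open>dist z x\<close> alone before averaging. The weight T^(p-2) is
  the one that dominates |P|^2 T^p when |P| T is bounded.\<close>

lemma nn_integral_bad_set_le:
  fixes C0 \<delta> p :: real
  assumes C0: "0 < C0" and \<delta>: "0 < \<delta>" "\<delta> \<le> 1" and p: "0 < p"
  shows "\<exists>C\<ge>0. \<forall>P. P holomorphic_on ball 0 1 \<longrightarrow>
    (\<forall>x. norm x < 1 \<longrightarrow> norm (P x) * (1 - (norm x)\<^sup>2) \<le> C0) \<longrightarrow>
    (\<integral>\<^sup>+z. ennreal ((1 - (norm z)\<^sup>2) powr (p - 2)) * (if norm z < 1 \<and>
       \<delta> < (norm (P z) * (1 - (norm z)\<^sup>2))\<^sup>2 / 4 - (1 - (norm z)\<^sup>2) - Re (z * P z) * (1 - (norm z)\<^sup>2)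
       then 1 else 0) \<partial>lborel)
    \<le> ennreal C * (\<integral>\<^sub>D z. (norm (deriv P z - (P z)\<^sup>2 / 2))\<^sup>2 * (1 - (norm z)\<^sup>2) powr (p + 2))"
proof -
  obtain \<epsilon> A where \<epsilon>: "0 < \<epsilon>" and A: "1 \<le> A" and pole: "\<And>P z. P holomorphic_on ball 0 1 \<Longrightarrow>
    (\<forall>x. norm x < 1 \<longrightarrow> norm (P x) * (1 - (norm x)\<^sup>2) \<le> C0) \<Longrightarrow> norm z < 1 \<Longrightarrow>
    \<delta> < (norm (P z) * (1 - (norm z)\<^sup>2))\<^sup>2 / 4 - (1 - (norm z)\<^sup>2) - Re (z * P z) * (1 - (norm z)\<^sup>2) \<Longrightarrow>
    (\<exists>\<zeta>. norm \<zeta> < 1 \<and> norm (\<zeta> - z) \<le> A * (1 - (norm \<zeta>)\<^sup>2) \<and>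
      1 - (norm z)\<^sup>2 \<le> A * (1 - (norm \<zeta>)\<^sup>2) \<and> 1 - (norm \<zeta>)\<^sup>2 \<le> A * (1 - (norm z)\<^sup>2) \<and>
      \<epsilon> \<le> norm (deriv P \<zeta> - (P \<zeta>)\<^sup>2 / 2) * (1 - (norm \<zeta>)\<^sup>2)\<^sup>2)"
    using schwarzian_large_near_interior_pole[OF C0 \<delta>] by metis
  \<comment> \<open>128 = 8 * 4^2 comes from the area mean on a disk of radius at least T \<zeta> /
    4; \<open>A\<close> squared compares T \<zeta> with T z, and \<open>(4 * A) powr p\<close>
    compares T z with T x.\<close>
  define C1 where "C1 = 128 * A\<^sup>2 * (4 * A) powr p / \<epsilon>\<^sup>2"
  have C1: "0 < C1" using A \<epsilon> by (simp add: C1_def)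
  show ?thesis
  proof (intro exI[of _ "C1 * (pi * (4 * A + 1)\<^sup>2)"] conjI allI impI)
    fix P :: "complex \<Rightarrow> complex"
    assume P: "P holomorphic_on ball 0 1" and bl: "\<forall>x. norm x < 1 \<longrightarrow> norm (P x) * (1 - (norm x)\<^sup>2) \<le> C0"
    define T where "T z = 1 - (norm z)\<^sup>2" for z :: complex
    define S where "S z = deriv P z - (P z)\<^sup>2 / 2" for z
    define bad where "bad z \<longleftrightarrow> norm z < 1 \<and> \<delta> < (norm (P z) * T z)\<^sup>2 / 4 - T z - Re (z * P z) * T z" for z
    define \<Psi> where "\<Psi> x = ennreal ((norm (S x))\<^sup>2 * T x powr p) * indicator (ball 0 1) x" for x
    have T: "T z > 0" if "norm z < 1" for z using one_minus_norm_power2(1)[OF that] by (simp add: T_def)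
    have S: "S holomorphic_on ball 0 1"
      unfolding S_def using P by (intro holomorphic_intros holomorphic_deriv) auto
    have cS: "continuous_on (ball 0 1) S" by (rule holomorphic_on_imp_continuous_on[OF S])
    have cT: "continuous_on (ball 0 1) (\<lambda>x. T x powr p)"
      unfolding T_def by (rule continuous_on_one_minus_norm_powr)
    have [measurable]: "\<Psi> \<in> borel_measurable borel"
      unfolding \<Psi>_def by (intro measurable_ennreal_indicator continuous_intros cS cT) auto
    have [measurable]: "tw 1 \<in> borel_measurable borel"
      unfolding tw_def by (intro borel_measurable_continuous_onI continuous_intros)
    have "(\<integral>\<^sup>+z. ennreal (T z powr (p - 2)) * (if bad z then 1 else 0) \<partial>lborel)
      \<le> ennreal C1 * ennreal (pi * (4 * A + 1)\<^sup>2) * (\<integral>\<^sup>+x. \<Psi> x * ennreal ((tw 1 x)\<^sup>2) \<partial>lborel)"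
    proof (rule nn_integral_averaging)
      fix z :: complex
      show "ennreal (T z powr (p - 2)) * (if bad z then 1 else 0)
        \<le> ennreal C1 * (\<integral>\<^sup>+x. \<Psi> x * (if dist z x \<le> (4 * A + 1) * tw 1 x then 1 else 0) \<partial>lborel)"
      proof (cases "bad z")
        case True
        then have z: "norm z < 1" by (simp add: bad_def)
        obtain \<zeta> where \<zeta>: "norm \<zeta> < 1" "norm (\<zeta> - z) \<le> A * T \<zeta>" "T z \<le> A * T \<zeta>" "T \<zeta> \<le> A * T z"
          "\<epsilon> \<le> norm (S \<zeta>) * (T \<zeta>)\<^sup>2"
          using pole[OF P bl z] True unfolding bad_def T_def S_def by blast
        note T\<zeta> = T[OF \<zeta>(1)] and Tz = T[OF z]
        define \<rho> where "\<rho> = (1 - norm \<zeta>) / 2"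
        have \<rho>: "0 < \<rho>" "T \<zeta> / 4 \<le> \<rho>"
          using \<zeta>(1) one_minus_norm_power2(3)[OF \<zeta>(1)] by (auto simp: \<rho>_def T_def)
        define K where "K = T z powr (p - 2) * (T \<zeta>) ^ 4 / \<epsilon>\<^sup>2 * (8 / \<rho>\<^sup>2)"
        have K0: "0 \<le> K" using T\<zeta> by (simp add: K_def)
        have sub: "ball \<zeta> \<rho> \<subseteq> ball 0 1"
          using disk_comparable(1)[OF \<zeta>(1)] by (auto simp: \<rho>_def dist_norm norm_minus_commute)
        have mS: "(\<lambda>x. ennreal ((norm (S x))\<^sup>2) * indicator (ball \<zeta> \<rho>) x) \<in> borel_measurable borel"
          using continuous_on_subset[OF cS sub] by (intro measurable_ennreal_indicator continuous_intros) auto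
        have "\<epsilon>\<^sup>2 \<le> (norm (S \<zeta>) * (T \<zeta>)\<^sup>2)\<^sup>2" using \<zeta>(5) \<epsilon> by (intro power_mono) auto
        also have "\<dots> = (norm (S \<zeta>))\<^sup>2 * (T \<zeta>) ^ 4" by (simp add: power_mult_distrib flip: power_mult)
        finally have "1 \<le> (T \<zeta>) ^ 4 / \<epsilon>\<^sup>2 * (norm (S \<zeta>))\<^sup>2" using \<epsilon> by (simp add: le_divide_eq mult.commute)
        then have "T z powr (p - 2) * 1 \<le> T z powr (p - 2) * ((T \<zeta>) ^ 4 / \<epsilon>\<^sup>2 * (norm (S \<zeta>))\<^sup>2)"
          by (intro mult_left_mono) auto
        then have "ennreal (T z powr (p - 2)) \<le> ennreal (T z powr (p - 2) * (T \<zeta>) ^ 4 / \<epsilon>\<^sup>2 * (norm (S \<zeta>))\<^sup>2)"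
          by (intro ennreal_leI) (simp add: mult_ac)
        also have "\<dots> = ennreal (T z powr (p - 2) * (T \<zeta>) ^ 4 / \<epsilon>\<^sup>2) * ennreal ((norm (S \<zeta>))\<^sup>2)"
          using T\<zeta> by (intro ennreal_mult) auto
        also have "\<dots> \<le> ennreal (T z powr (p - 2) * (T \<zeta>) ^ 4 / \<epsilon>\<^sup>2) *
          (ennreal (8 / \<rho>\<^sup>2) * (\<integral>\<^sup>+x\<in>ball \<zeta> \<rho>. ennreal ((norm (S x))\<^sup>2) \<partial>lborel))"
          by (intro mult_left_mono norm_power2_le_area_mean holomorphic_on_subset[OF S sub] \<rho>) auto
        also have "\<dots> = ennreal K * (\<integral>\<^sup>+x\<in>ball \<zeta> \<rho>. ennreal ((norm (S x))\<^sup>2) \<partial>lborel)"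
          unfolding K_def using T\<zeta> by (subst ennreal_mult) (auto simp: mult.assoc)
        also have "\<dots> = (\<integral>\<^sup>+x. ennreal K * (ennreal ((norm (S x))\<^sup>2) * indicator (ball \<zeta> \<rho>) x) \<partial>lborel)"
          using mS by (intro nn_integral_cmult[symmetric]) simp
        also have "\<dots> \<le> (\<integral>\<^sup>+x. ennreal C1 * (\<Psi> x * (if dist z x \<le> (4 * A + 1) * tw 1 x then 1 else 0)) \<partial>lborel)"
        proof (rule nn_integral_mono)
          fix x :: complex
          show "ennreal K * (ennreal ((norm (S x))\<^sup>2) * indicator (ball \<zeta> \<rho>) x)
              \<le> ennreal C1 * (\<Psi> x * (if dist z x \<le> (4 * A + 1) * tw 1 x then 1 else 0))"
          proof (cases "x \<in> ball \<zeta> \<rho>")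
            case True
            then have x\<zeta>: "norm (x - \<zeta>) < (1 - norm \<zeta>) / 2" by (simp add: \<rho>_def dist_norm norm_minus_commute)
            note cmp = disk_comparable[OF \<zeta>(1) x\<zeta>]
            note Tx = T[OF cmp(1)]
            have T4: "T \<zeta> \<le> 4 * T x" using cmp(2) by (simp add: T_def)
            then have AT: "A * T \<zeta> \<le> A * (4 * T x)" using A by (intro mult_left_mono) auto
            have "(T \<zeta> / 4)\<^sup>2 \<le> \<rho>\<^sup>2" using \<rho> T\<zeta> by (intro power_mono) auto
            then have "8 / \<rho>\<^sup>2 \<le> 8 / (T \<zeta> / 4)\<^sup>2"
              using T\<zeta> \<rho> by (intro divide_left_mono mult_pos_pos) auto
            then have "K \<le> T z powr (p - 2) * (T \<zeta>) ^ 4 / \<epsilon>\<^sup>2 * (8 / (T \<zeta> / 4)\<^sup>2)"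
              unfolding K_def using T\<zeta> by (intro mult_left_mono) auto
            also have "\<dots> = 128 / \<epsilon>\<^sup>2 * T z powr (p - 2) * (T \<zeta>)\<^sup>2"
              using T\<zeta> \<epsilon> by (simp add: field_simps power2_eq_square power4_eq_xxxx)
            also have "\<dots> \<le> 128 / \<epsilon>\<^sup>2 * T z powr (p - 2) * (A * T z)\<^sup>2"
              using \<zeta>(4) T\<zeta> by (intro mult_left_mono power_mono) auto
            also have "\<dots> = 128 / \<epsilon>\<^sup>2 * A\<^sup>2 * (T z powr (p - 2) * T z powr 2)"
              using Tz by (simp add: power_mult_distrib)
            also have "\<dots> = 128 / \<epsilon>\<^sup>2 * A\<^sup>2 * T z powr p"
              by (simp flip: powr_add)
            also have "\<dots> \<le> 128 / \<epsilon>\<^sup>2 * A\<^sup>2 * (4 * A * T x) powr p"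
              using \<zeta>(3) AT Tz p by (intro mult_left_mono powr_mono2) auto
            also have "(4 * A * T x) powr p = (4 * A) powr p * T x powr p" by (rule powr_mult)
            finally have "K \<le> C1 * T x powr p" by (simp add: C1_def)
            then have "K * (norm (S x))\<^sup>2 \<le> C1 * T x powr p * (norm (S x))\<^sup>2" by (intro mult_right_mono) auto
            then have "K * (norm (S x))\<^sup>2 \<le> C1 * ((norm (S x))\<^sup>2 * T x powr p)" by (simp add: mult_ac)
            moreover have "dist z x \<le> (4 * A + 1) * tw 1 x"
            proof -
              have "dist z x \<le> norm (\<zeta> - z) + norm (x - \<zeta>)"
                using dist_triangle[of z x \<zeta>] by (simp add: dist_norm norm_minus_commute)
              also have "\<dots> \<le> A * (4 * T x) + T x" using \<zeta>(2) AT cmp(4) by (simp add: T_def)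
              finally show ?thesis using cmp(1) by (simp add: tw_1 T_def algebra_simps)
            qed
            ultimately show ?thesis
              using True cmp(1) C1 K0
              by (simp add: \<Psi>_def ennreal_mult[symmetric] ennreal_leI)
          qed auto
        qed
        also have "\<dots> = ennreal C1 * (\<integral>\<^sup>+x. \<Psi> x * (if dist z x \<le> (4 * A + 1) * tw 1 x then 1 else 0) \<partial>lborel)"
          by (intro nn_integral_cmult) measurable
        finally show ?thesis using True by simp
      qed auto
    qed (use A in auto)
    also have "(\<integral>\<^sup>+x. \<Psi> x * ennreal ((tw 1 x)\<^sup>2) \<partial>lborel) = (\<integral>\<^sub>D x. (norm (S x))\<^sup>2 * T x powr (p + 2))"
    proof (rule nn_integral_cong)
      fix x :: complex
      show "\<Psi> x * ennreal ((tw 1 x)\<^sup>2) = ennreal ((norm (S x))\<^sup>2 * T x powr (p + 2)) * indicator (ball 0 1) x"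
      proof (cases "norm x < 1")
        case True
        have "ennreal ((norm (S x))\<^sup>2 * T x powr p) * ennreal ((T x)\<^sup>2) = ennreal ((norm (S x))\<^sup>2 * T x powr (p + 2))"
          using T[OF True] by (subst ennreal_mult[symmetric]) (auto simp: powr_add mult.assoc)
        then show ?thesis using True by (simp add: \<Psi>_def tw_1 T_def)
      qed (simp add: \<Psi>_def)
    qed
    finally show "(\<integral>\<^sup>+z. ennreal ((1 - (norm z)\<^sup>2) powr (p - 2)) * (if norm z < 1 \<and>
       \<delta> < (norm (P z) * (1 - (norm z)\<^sup>2))\<^sup>2 / 4 - (1 - (norm z)\<^sup>2) - Re (z * P z) * (1 - (norm z)\<^sup>2)
       then 1 else 0) \<partial>lborel)
      \<le> ennreal (C1 * (pi * (4 * A + 1)\<^sup>2)) * (\<integral>\<^sub>D z. (norm (deriv P z - (P z)\<^sup>2 / 2))\<^sup>2 * (1 - (norm z)\<^sup>2) powr (p + 2))"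
      using C1 by (simp add: bad_def S_def T_def ennreal_mult)
  qed (use C1 in auto)
qed

text \<open>Green's formula applied to \<open>z |P|\<^sup>2 T\<close> and \<open>P (P\<^sup>*)\<^sup>2 T\<close>, with \<open>T\<close> to the powers \<open>p + 1\<close> and
  \<open>p + 2\<close>. If the osculating pole lay outside the disk, then \<open>Re (z P) \<ge> |P|\<^sup>2 T / 4 - 1\<close>, and the
  gain over the coefficient \<open>1/2\<close> in \<open>P' = P\<^sup>2/2 + S\<close> is \<open>(p + 2)/4 - 1/2 = p/4\<close>, positive for
  every \<open>p > 0\<close>; \<open>e\<close> measures the failure of that inequality.\<close>
lemma energy_identities:
  fixes p r :: real and P :: "complex \<Rightarrow> complex"
  assumes P: "P holomorphic_on ball 0 1" and p: "0 < p" and r: "1 / 2 \<le> r" "r < 1"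
  defines "S \<equiv> \<lambda>z. deriv P z - (P z)\<^sup>2 / 2"
    and "e \<equiv> \<lambda>z. max 0 ((norm (P z))\<^sup>2 * (1 - (norm z)\<^sup>2) / 4 - 1 - Re (z * P z))"
  defines "X \<equiv> integral\<^sup>L lborel (\<lambda>z. tw r z powr p * (norm (P z))\<^sup>2)"
    and "Y \<equiv> integral\<^sup>L lborel (\<lambda>z. tw r z powr (p + 2) * (norm (P z)) ^ 4)"
    and "Z \<equiv> integral\<^sup>L lborel (\<lambda>z. tw r z powr (p + 1) * (norm (P z))\<^sup>2)"
    and "E \<equiv> integral\<^sup>L lborel (\<lambda>z. tw r z powr (p + 1) * ((norm (P z))\<^sup>2 * e z))"
    and "\<Sigma> \<equiv> integral\<^sup>L lborel (\<lambda>z. tw r z powr (p + 2) * (norm (S z))\<^sup>2)"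
  shows "X \<le> 8 * (p + 2) * Z + 32 * \<Sigma> + 8 * Y"
    and "p / 8 * Y \<le> (p + 2) * (Z + E) + 2 / p * \<Sigma>"
proof -
  have dP: "deriv P holomorphic_on ball 0 1" using P by (intro holomorphic_deriv) auto
  have cP: "continuous_on (ball 0 1) P" "continuous_on (ball 0 1) (deriv P)"
    using P dP by (auto intro: holomorphic_on_imp_continuous_on)
  have cS: "continuous_on (ball 0 1) S" unfolding S_def by (intro continuous_intros cP) auto
  have ce: "continuous_on (ball 0 1) e" unfolding e_def by (intro continuous_intros cP) auto
  have r0: "0 < r" using r by simp
  have hP: "(P has_derivative (\<lambda>v. deriv P z * v)) (at z)" if "z \<in> ball 0 1" for z
    using holomorphic_derivI[OF P open_ball that] by (simp add: has_field_derivative_def)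
  have hcP: "((\<lambda>z. cnj (P z)) has_derivative (\<lambda>v. cnj (deriv P z) * cnj v)) (at z)" if "z \<in> ball 0 1" for z
    using has_derivative_compose[OF hP[OF that] bounded_linear_imp_has_derivative[OF bounded_linear_cnj]] by simp
  have int: "integrable lborel (\<lambda>z. tw r z powr q * f z)" if "continuous_on (ball 0 1) f" "0 < q" for q and f :: "complex \<Rightarrow> real"
    using integrable_tw_powr[OF that(1) r0 r(2) that(2)] by simp
  have intc: "integrable lborel (\<lambda>z. tw r z powr q *\<^sub>R f z)" if "continuous_on (ball 0 1) f" "0 < q" for q and f :: "complex \<Rightarrow> complex"
    using integrable_tw_powr[OF that(1) r0 r(2) that(2)] .
  have iX: "integrable lborel (\<lambda>z. tw r z powr p * (norm (P z))\<^sup>2)"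
    and iY: "integrable lborel (\<lambda>z. tw r z powr (p + 2) * (norm (P z)) ^ 4)"
    and iZ: "integrable lborel (\<lambda>z. tw r z powr (p + 1) * (norm (P z))\<^sup>2)"
    and iE: "integrable lborel (\<lambda>z. tw r z powr (p + 1) * ((norm (P z))\<^sup>2 * e z))"
    and iS: "integrable lborel (\<lambda>z. tw r z powr (p + 2) * (norm (S z))\<^sup>2)"
    using p by (auto intro!: int continuous_intros cP cS ce)
  have q1: "tw r z powr (p + 1) = tw r z powr p * tw r z" for z by (simp add: powr_add)
  have q2: "tw r z powr (p + 2) = tw r z powr p * (tw r z)\<^sup>2" for z by (simp add: powr_add)
  have dPS: "deriv P z = S z + (P z)\<^sup>2 / 2" for z by (simp add: S_def)

  \<comment> \<open>Differentiating the weight against z |P|^2 produces |z|^2 |P|^2 tw^p, and |z|^2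
    = r^2 - t with r \<ge> 1/2. This yields a quarter of X, up to a multiple of Z.\<close>
  define a1 where "a1 z = z * P z * cnj (P z)" for z
  define b1 where "b1 z = P z * cnj (P z) + z * deriv P z * cnj (P z)" for z
  define G1 where "G1 z = tw r z powr (p + 1) *\<^sub>R b1 z - tw r z powr (p + 1 - 1) *\<^sub>R (of_real (p + 1) * cnj z * a1 z)" for z :: complex
  have "integral\<^sup>L lborel G1 = 0"
    unfolding G1_def
  proof (rule green_weight(1)[OF r0 r(2), where azb = "\<lambda>z. z * P z * cnj (deriv P z)"])
    show "(a1 has_derivative (\<lambda>v. b1 z * v + z * P z * cnj (deriv P z) * cnj v)) (at z)" if "z \<in> ball 0 1" for z
      unfolding a1_def b1_def
      by (rule has_derivative_eq_rhs, (rule derivative_intros hP[OF that] hcP[OF that])+) (simp add: fun_eq_iff algebra_simps)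
  qed (use p in \<open>auto simp: b1_def intro!: continuous_intros cP\<close>)
  moreover have iG1: "integrable lborel G1"
    unfolding G1_def a1_def b1_def using p
    by (intro Bochner_Integration.integrable_diff intc continuous_intros cP) auto
  ultimately have G1: "integral\<^sup>L lborel (\<lambda>z. Re (G1 z)) = 0" "integrable lborel (\<lambda>z. Re (G1 z))"
    by auto
  have "0 \<le> integral\<^sup>L lborel (\<lambda>z. (p + 2) * (tw r z powr (p + 1) * (norm (P z))\<^sup>2) - 1 / 8 * (tw r z powr p * (norm (P z))\<^sup>2)
      + 4 * (tw r z powr (p + 2) * (norm (S z))\<^sup>2) + tw r z powr (p + 2) * (norm (P z)) ^ 4)"
    unfolding G1(1)[symmetric]
  proof (rule integral_mono[OF G1(2)])
    show "integrable lborel (\<lambda>z. (p + 2) * (tw r z powr (p + 1) * (norm (P z))\<^sup>2) - 1 / 8 * (tw r z powr p * (norm (P z))\<^sup>2)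
      + 4 * (tw r z powr (p + 2) * (norm (S z))\<^sup>2) + tw r z powr (p + 2) * (norm (P z)) ^ 4)"
      by (intro Bochner_Integration.integrable_add Bochner_Integration.integrable_diff integrable_mult_right iX iY iZ iS)
    fix z :: complex
    define t where "t = tw r z"
    define q where "q = t powr p"
    define N where "N = norm (P z)"
    define D where "D = norm (deriv P z)"
    define s where "s = norm (S z)"
    have nn: "0 \<le> t" "0 \<le> q" "0 \<le> N" "0 \<le> D" "0 \<le> s" by (auto simp: t_def q_def N_def D_def s_def)
    have tq: "t powr (p + 1) = q * t" "t powr (1 + p) = q * t" "t powr (p + 2) = q * t\<^sup>2" "t powr p = q"
      by (simp_all add: t_def q_def q1 q2 powr_add)
    show "Re (G1 z) \<le> (p + 2) * (tw r z powr (p + 1) * (norm (P z))\<^sup>2) - 1 / 8 * (tw r z powr p * (norm (P z))\<^sup>2)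
      + 4 * (tw r z powr (p + 2) * (norm (S z))\<^sup>2) + tw r z powr (p + 2) * (norm (P z)) ^ 4"
    proof (cases "norm z < r")
      case True
      have "(norm z)\<^sup>2 \<le> r\<^sup>2" using True by (intro power_mono) auto
      then have zt: "(norm z)\<^sup>2 = r\<^sup>2 - t" by (simp add: t_def tw_def)
      have r2: "1 / 4 \<le> r\<^sup>2" using power_mono[OF r(1), of 2] by (simp add: power_divide)
      have z1: "norm z \<le> 1" using True r by simp
      have PP: "P z * cnj (P z) = of_real (N\<^sup>2)" by (simp add: N_def complex_norm_square del: of_real_power)
      have zz: "cnj z * z = of_real (r\<^sup>2 - t)" by (simp add: complex_norm_square zt[symmetric] mult.commute del: of_real_power of_real_diff)
      have "cnj z * a1 z = of_real ((r\<^sup>2 - t) * N\<^sup>2)"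
        using zz PP by (simp add: a1_def mult.assoc[symmetric])
      then have "Re (of_real (p + 1) * cnj z * a1 z) = (p + 1) * ((r\<^sup>2 - t) * N\<^sup>2)"
        by (simp add: mult.assoc del: of_real_mult of_real_add of_real_diff of_real_power)
      moreover have "Re (b1 z) = N\<^sup>2 + Re (z * deriv P z * cnj (P z))"
        using PP by (simp add: b1_def del: times_complex.sel)
      moreover have "Re (z * deriv P z * cnj (P z)) \<le> D * N"
      proof -
        have "Re (z * deriv P z * cnj (P z)) \<le> norm (z * deriv P z * cnj (P z))" by (rule complex_Re_le_cmod)
        also have "\<dots> = norm z * (D * N)" by (simp add: norm_mult D_def N_def)
        also have "\<dots> \<le> D * N" using z1 nn by (intro mult_left_le_one_le) auto
        finally show ?thesis .
      qed
      ultimately have "Re (G1 z) \<le> (q * t) * (N\<^sup>2 + D * N) - q * ((p + 1) * ((r\<^sup>2 - t) * N\<^sup>2))"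
        using nn unfolding G1_def by (simp add: t_def[symmetric] tq mult_left_mono del: times_complex.sel)
      \<comment> \<open>The coefficient 1/8 spends half of the quarter of X that is available; the
        rest of the inequality is paid by S and by the quartic term.\<close>
      moreover have "t * (D * N) \<le> N\<^sup>2 / 8 + 2 * (t * D)\<^sup>2"
        using zero_le_power2[of "N / 2 - 2 * (t * D)"] by (simp add: power2_diff power_divide algebra_simps power2_eq_square)
      moreover have "D\<^sup>2 \<le> 2 * s\<^sup>2 + N ^ 4 / 2"
      proof -
        have "D \<le> s + N\<^sup>2 / 2" unfolding D_def s_def N_def dPS[of z]
          using norm_triangle_ineq[of "S z" "(P z)\<^sup>2 / 2"] by (simp add: norm_divide norm_power)
        then have "D\<^sup>2 \<le> (s + N\<^sup>2 / 2)\<^sup>2" using nn by (intro power_mono) auto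
        also have "\<dots> \<le> 2 * s\<^sup>2 + 2 * (N\<^sup>2 / 2)\<^sup>2"
          using zero_le_power2[of "s - N\<^sup>2 / 2"] by (simp add: power2_sum power2_diff)
        finally show ?thesis by (simp add: power_divide flip: power_mult)
      qed
      then have "2 * (t * D)\<^sup>2 \<le> 2 * t\<^sup>2 * (2 * s\<^sup>2 + N ^ 4 / 2)"
        using mult_left_mono[of "D\<^sup>2" _ "2 * t\<^sup>2"] by (simp add: power_mult_distrib)
      ultimately have "Re (G1 z) \<le> (q * t) * N\<^sup>2 + q * (N\<^sup>2 / 8 + 2 * t\<^sup>2 * (2 * s\<^sup>2 + N ^ 4 / 2)) - q * ((p + 1) * ((r\<^sup>2 - t) * N\<^sup>2))"
        using mult_left_mono[of "t * (D * N)" "N\<^sup>2 / 8 + 2 * t\<^sup>2 * (2 * s\<^sup>2 + N ^ 4 / 2)" q] nn(2) by (simp add: algebra_simps)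
      moreover have "q * (1 / 4 * N\<^sup>2) \<le> q * ((p + 1) * r\<^sup>2 * N\<^sup>2)"
      proof (intro mult_left_mono mult_right_mono)
        show "1 / 4 \<le> (p + 1) * r\<^sup>2" using mult_right_mono[of 1 "p + 1" "r\<^sup>2"] p r2 by simp
      qed (use nn in auto)
      ultimately show ?thesis
        unfolding t_def[symmetric] tq N_def[symmetric] s_def[symmetric]
        by (simp add: algebra_simps)
    next
      case False
      then show ?thesis using r0 p by (simp add: G1_def tw_eq_0)
    qed
  qed
  also have "\<dots> = (p + 2) * Z - 1 / 8 * X + 4 * \<Sigma> + Y"
    unfolding X_def Y_def Z_def \<Sigma>_def using iX iY iZ iS by simp
  finally show "X \<le> 8 * (p + 2) * Z + 32 * \<Sigma> + 8 * Y" by (simp add: algebra_simps)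

  \<comment> \<open>The z-derivative does not see the conjugated factors, so only P' appears and the
    Riccati equation applies. The derivative of the weight produces Re (z P) |P|^2, where the
    position of the pole enters.\<close>
  define a2 where "a2 z = (cnj (P z))\<^sup>2 * P z" for z
  define b2 where "b2 z = (cnj (P z))\<^sup>2 * deriv P z" for z
  define G2 where "G2 z = tw r z powr (p + 2) *\<^sub>R b2 z - tw r z powr (p + 2 - 1) *\<^sub>R (of_real (p + 2) * cnj z * a2 z)" for z :: complex
  have "integral\<^sup>L lborel G2 = 0"
    unfolding G2_def
  proof (rule green_weight(1)[OF r0 r(2), where azb = "\<lambda>z. 2 * cnj (P z) * cnj (deriv P z) * P z"])
    show "(a2 has_derivative (\<lambda>v. b2 z * v + 2 * cnj (P z) * cnj (deriv P z) * P z * cnj v)) (at z)" if "z \<in> ball 0 1" for z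
      unfolding a2_def b2_def power2_eq_square
      by (rule has_derivative_eq_rhs, (rule derivative_intros hP[OF that] hcP[OF that])+) (simp add: fun_eq_iff algebra_simps)
  qed (use p in \<open>auto simp: b2_def intro!: continuous_intros cP\<close>)
  moreover have iG2: "integrable lborel G2"
    unfolding G2_def a2_def b2_def using p
    by (intro Bochner_Integration.integrable_diff intc continuous_intros cP) auto
  ultimately have G2: "integral\<^sup>L lborel (\<lambda>z. Re (G2 z)) = 0" "integrable lborel (\<lambda>z. Re (G2 z))"
    by auto
  have "0 \<le> integral\<^sup>L lborel (\<lambda>z. 2 / p * (tw r z powr (p + 2) * (norm (S z))\<^sup>2) - p / 8 * (tw r z powr (p + 2) * (norm (P z)) ^ 4)
      + (p + 2) * (tw r z powr (p + 1) * (norm (P z))\<^sup>2) + (p + 2) * (tw r z powr (p + 1) * ((norm (P z))\<^sup>2 * e z)))"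
    unfolding G2(1)[symmetric]
  proof (rule integral_mono[OF G2(2)])
    show "integrable lborel (\<lambda>z. 2 / p * (tw r z powr (p + 2) * (norm (S z))\<^sup>2) - p / 8 * (tw r z powr (p + 2) * (norm (P z)) ^ 4)
      + (p + 2) * (tw r z powr (p + 1) * (norm (P z))\<^sup>2) + (p + 2) * (tw r z powr (p + 1) * ((norm (P z))\<^sup>2 * e z)))"
      by (intro Bochner_Integration.integrable_add Bochner_Integration.integrable_diff integrable_mult_right iE iY iZ iS)
    fix z :: complex
    define t where "t = tw r z"
    define q where "q = t powr p"
    define N where "N = norm (P z)"
    define s where "s = norm (S z)"
    define R where "R = Re (z * P z)"
    have nn: "0 \<le> t" "0 \<le> q" "0 \<le> N" "0 \<le> s" "0 \<le> e z" by (auto simp: t_def q_def N_def s_def e_def)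
    have tq: "t powr (p + 1) = q * t" "t powr (1 + p) = q * t" "t powr (p + 2) = q * t\<^sup>2" "t powr p = q"
      by (simp_all add: t_def q_def q1 q2 powr_add)
    show "Re (G2 z) \<le> 2 / p * (tw r z powr (p + 2) * (norm (S z))\<^sup>2) - p / 8 * (tw r z powr (p + 2) * (norm (P z)) ^ 4)
      + (p + 2) * (tw r z powr (p + 1) * (norm (P z))\<^sup>2) + (p + 2) * (tw r z powr (p + 1) * ((norm (P z))\<^sup>2 * e z))"
    proof (cases "norm z < r")
      case True
      have "(norm z)\<^sup>2 \<le> r\<^sup>2" "r\<^sup>2 \<le> 1" using True r by (auto intro: power_mono simp: power_le_one)
      then have t1: "t \<le> 1 - (norm z)\<^sup>2" by (simp add: t_def tw_def)
      have PP: "cnj (P z) * P z = of_real (N\<^sup>2)" by (simp add: N_def complex_norm_square mult.commute del: of_real_power)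
      have PP2: "(cnj (P z))\<^sup>2 * (P z)\<^sup>2 = of_real (N ^ 4)"
        using arg_cong[OF PP, of "\<lambda>x. x\<^sup>2"] by (simp add: power_mult_distrib flip: power_mult)
      have eq: "of_real (p + 2) * cnj z * a2 z = of_real ((p + 2) * N\<^sup>2) * cnj (z * P z)"
        unfolding of_real_mult PP[symmetric] by (simp add: a2_def power2_eq_square mult_ac)
      have "Re (of_real c * cnj w) = c * Re w" for c w by simp
      then have "Re (of_real (p + 2) * cnj z * a2 z) = (p + 2) * (R * N\<^sup>2)"
        unfolding eq R_def by (simp only: mult_ac)
      moreover have "Re (b2 z) \<le> N\<^sup>2 * s + N ^ 4 / 2"
      proof -
        have "b2 z = (cnj (P z))\<^sup>2 * S z + of_real (N ^ 4) / 2"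
          unfolding PP2[symmetric] b2_def dPS[of z] by (simp add: algebra_simps)
        then have "Re (b2 z) = Re ((cnj (P z))\<^sup>2 * S z) + N ^ 4 / 2"
          by (simp del: times_complex.sel of_real_power)
        moreover have "Re ((cnj (P z))\<^sup>2 * S z) \<le> N\<^sup>2 * s"
          using complex_Re_le_cmod[of "(cnj (P z))\<^sup>2 * S z"] by (simp add: norm_mult norm_power N_def s_def)
        ultimately show ?thesis by simp
      qed
      ultimately have G: "Re (G2 z) \<le> (q * t\<^sup>2) * (N\<^sup>2 * s + N ^ 4 / 2) - (q * t) * ((p + 2) * (R * N\<^sup>2))"
        using nn unfolding G2_def
        by (simp add: t_def[symmetric] tq mult_left_mono del: times_complex.sel)
      \<comment> \<open>Weighted so that the mixed term uses p/8 of the gain p/4 and leaves p/8 of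
        the quartic integral.\<close>
      have Ns: "N\<^sup>2 * s \<le> p / 8 * N ^ 4 + 2 / p * s\<^sup>2"
      proof -
        have "0 \<le> (p / 4 * N\<^sup>2 - s)\<^sup>2 * (2 / p)" using p by simp
        also have "\<dots> = p / 8 * N ^ 4 + 2 / p * s\<^sup>2 - N\<^sup>2 * s"
          using p by (simp add: field_simps power2_eq_square power4_eq_xxxx)
        finally show ?thesis by simp
      qed
      have "N\<^sup>2 * t \<le> N\<^sup>2 * (1 - (norm z)\<^sup>2)" using t1 by (intro mult_left_mono) auto
      moreover have "N\<^sup>2 * (1 - (norm z)\<^sup>2) / 4 - 1 - R \<le> e z" unfolding e_def N_def R_def by (rule max.cobounded2)
      \<comment> \<open>The defect \<open>e\<close> is defined with the full 1 - |z|^2; since t is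
        smaller, the inequality passes to the truncated weight.\<close>
      ultimately have "- R \<le> e z + 1 - N\<^sup>2 * t / 4" by linarith
      then have "(q * t * (p + 2) * N\<^sup>2) * - R \<le> (q * t * (p + 2) * N\<^sup>2) * (e z + 1 - N\<^sup>2 * t / 4)"
        using nn p by (intro mult_left_mono) auto
      moreover have "(q * t\<^sup>2) * (N\<^sup>2 * s) \<le> (q * t\<^sup>2) * (p / 8 * N ^ 4 + 2 / p * s\<^sup>2)"
        using Ns nn by (intro mult_left_mono) auto
      ultimately have "Re (G2 z) \<le> (q * t\<^sup>2) * (p / 8 * N ^ 4 + 2 / p * s\<^sup>2) + (q * t\<^sup>2) * (N ^ 4 / 2)
          + (q * t * (p + 2) * N\<^sup>2) * (e z + 1 - N\<^sup>2 * t / 4)"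
        using G by (simp add: algebra_simps)
      also have "\<dots> = 2 / p * (q * t\<^sup>2 * s\<^sup>2) - p / 8 * (q * t\<^sup>2 * N ^ 4) + (p + 2) * (q * t * N\<^sup>2) + (p + 2) * (q * t * (N\<^sup>2 * e z))"
        by (simp add: algebra_simps power2_eq_square power4_eq_xxxx)
      finally show ?thesis
        unfolding t_def[symmetric] tq N_def[symmetric] s_def[symmetric] .
    next
      case False
      then show ?thesis using r0 p by (simp add: G2_def tw_eq_0)
    qed
  qed
  also have "\<dots> = 2 / p * \<Sigma> - p / 8 * Y + (p + 2) * Z + (p + 2) * E"
    unfolding E_def Y_def Z_def \<Sigma>_def using iE iY iZ iS by simp
  finally show "p / 8 * Y \<le> (p + 2) * (Z + E) + 2 / p * \<Sigma>" by (simp add: algebra_simps)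
qed

lemma tw_mono: "0 \<le> r \<Longrightarrow> r \<le> s \<Longrightarrow> tw r z \<le> tw s z"
  unfolding tw_def by (intro max.mono diff_mono power_mono) auto

text \<open>The energy identities leave two terms to absorb: Z, which has one more power of the
  weight and is thus small near the circle, and E, which is small off the bad set and controlled by
  S on it. The additive 1 accounts for solutions with S = 0 and P nonzero, such as pre-Schwarzians
  of Moebius maps.\<close>

theorem nn_integral_riccati_le:
  fixes C0 p :: real
  assumes C0: "0 < C0" and p: "0 < p"
  shows "\<exists>C\<ge>0. \<forall>P. P holomorphic_on ball 0 1 \<longrightarrow>
    (\<forall>x. norm x < 1 \<longrightarrow> norm (P x) * (1 - (norm x)\<^sup>2) \<le> C0) \<longrightarrow>
    (\<integral>\<^sub>D z. (norm (P z))\<^sup>2 * (1 - (norm z)\<^sup>2) powr p)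
    \<le> ennreal C * (1 + (\<integral>\<^sub>D z. (norm (deriv P z - (P z)\<^sup>2 / 2))\<^sup>2 * (1 - (norm z)\<^sup>2) powr (p + 2)))"
proof -
  \<comment> \<open>\<open>K\<close> collects all coefficients after Y is eliminated. With \<eta> =
    1 / (4 K), the terms Z and E each return at most a quarter of X.\<close>
  define K where "K = 8 * (p + 2) + 32 + 64 * (p + 2) / p + 128 / p\<^sup>2"
  define \<eta> where "\<eta> = 1 / (4 * K)"
  have K: "32 \<le> K" using p by (simp add: K_def)
  have \<eta>: "0 < \<eta>" "\<eta> \<le> 1" using K by (auto simp: \<eta>_def divide_le_eq)
  \<comment> \<open>With \<beta> = |P| T \<le> C0, one factor bounds |P|^2 T^2 by C0^2 and the other
    bounds the defect \<beta>^2 / 4 + \<beta>.\<close>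
  define D0 where "D0 = C0\<^sup>2 * (C0\<^sup>2 / 4 + C0)"
  have D0: "0 < D0" using C0 by (simp add: D0_def add_pos_pos)
  obtain Cb where Cb: "0 \<le> Cb" and bad_le: "\<forall>P. P holomorphic_on ball 0 1 \<longrightarrow>
    (\<forall>x. norm x < 1 \<longrightarrow> norm (P x) * (1 - (norm x)\<^sup>2) \<le> C0) \<longrightarrow>
    (\<integral>\<^sup>+z. ennreal ((1 - (norm z)\<^sup>2) powr (p - 2)) * (if norm z < 1 \<and>
       \<eta> < (norm (P z) * (1 - (norm z)\<^sup>2))\<^sup>2 / 4 - (1 - (norm z)\<^sup>2) - Re (z * P z) * (1 - (norm z)\<^sup>2)
       then 1 else 0) \<partial>lborel)
    \<le> ennreal Cb * (\<integral>\<^sub>D z. (norm (deriv P z - (P z)\<^sup>2 / 2))\<^sup>2 * (1 - (norm z)\<^sup>2) powr (p + 2))"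
    using nn_integral_bad_set_le[OF C0 \<eta> p] by (elim exE conjE) (rule that)
  define C where "C = 2 * K * (pi * C0\<^sup>2 / \<eta>\<^sup>2 + D0 * Cb + 1)"
  have C: "0 < C" using K D0 Cb C0 \<eta> by (auto simp: C_def intro!: mult_pos_pos add_nonneg_pos)
  show ?thesis
  proof (intro exI[of _ C] conjI allI impI)
    fix P :: "complex \<Rightarrow> complex"
    assume P: "P holomorphic_on ball 0 1" and bl: "\<forall>x. norm x < 1 \<longrightarrow> norm (P x) * (1 - (norm x)\<^sup>2) \<le> C0"
    define T where "T z = 1 - (norm z)\<^sup>2" for z :: complex
    define S where "S z = deriv P z - (P z)\<^sup>2 / 2" for z
    define f where "f z = (norm (P z) * T z)\<^sup>2 / 4 - T z - Re (z * P z) * T z" for z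
    define e where "e z = max 0 ((norm (P z))\<^sup>2 * T z / 4 - 1 - Re (z * P z))" for z
    define U where "U = ball 0 1 \<inter> f -` {\<eta><..}"
    have T: "0 < T z" "T z \<le> 1" if "norm z < 1" for z
      using one_minus_norm_power2(1)[OF that] by (auto simp: T_def)
    have cP: "continuous_on (ball 0 1) P" by (rule holomorphic_on_imp_continuous_on[OF P])
    have S: "S holomorphic_on ball 0 1"
      unfolding S_def using P by (intro holomorphic_intros holomorphic_deriv) auto
    have cS: "continuous_on (ball 0 1) S" by (rule holomorphic_on_imp_continuous_on[OF S])
    have ce: "continuous_on (ball 0 1) e" unfolding e_def T_def by (intro continuous_intros cP) auto
    have "continuous_on (ball 0 1) f" unfolding f_def T_def by (intro continuous_intros cP) auto
    then have U: "open U" unfolding U_def by (intro continuous_open_preimage) auto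
    have UD: "U \<subseteq> ball 0 1" by (auto simp: U_def)
    define N where "N = (\<integral>\<^sub>D z. (norm (S z))\<^sup>2 * T z powr (p + 2))"
    define h where "h z = ennreal (T z powr (p - 2)) * indicator U z" for z
    have mh: "h \<in> borel_measurable borel"
      unfolding h_def T_def using continuous_on_subset[OF continuous_on_one_minus_norm_powr UD] U
      by (rule measurable_ennreal_indicator)
    have hN: "(\<integral>\<^sup>+z. h z \<partial>lborel) \<le> ennreal Cb * N"
    proof -
      have "h z = ennreal ((1 - (norm z)\<^sup>2) powr (p - 2)) * (if norm z < 1 \<and>
       \<eta> < (norm (P z) * (1 - (norm z)\<^sup>2))\<^sup>2 / 4 - (1 - (norm z)\<^sup>2) - Re (z * P z) * (1 - (norm z)\<^sup>2)
       then 1 else 0)" for z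
        by (simp add: h_def U_def f_def T_def indicator_def)
      then show ?thesis using bad_le[THEN spec, THEN mp, OF P, THEN mp, OF bl] by (simp add: N_def S_def T_def)
    qed
    have "(\<integral>\<^sub>D z. (norm (P z))\<^sup>2 * T z powr p) \<le> ennreal C * (1 + N)"
    proof (cases "N = \<infinity>")
      case True
      then show ?thesis using C by (simp add: ennreal_mult_top)
    next
      case False
      then obtain s where s: "N = ennreal s" "0 \<le> s" by (cases N) auto
      \<comment> \<open>For r < 1 all integrals are finite, so half of X can be moved to the left;
        the resulting bound does not depend on r.\<close>
      have bound: "(\<integral>\<^sup>+z. ennreal (tw r z powr p * (norm (P z))\<^sup>2) \<partial>lborel) \<le> ennreal (C * (1 + s))"
        if r: "1 / 2 \<le> r" "r < 1" for r
      proof -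
        have r0: "0 < r" using r by simp
        have tT: "tw r z \<le> T z" if "norm z < 1" for z
          using tw_mono[of r 1 z] r r0 tw_1[OF that] by (simp add: T_def)
        define X where "X = integral\<^sup>L lborel (\<lambda>z. tw r z powr p * (norm (P z))\<^sup>2)"
        define Y where "Y = integral\<^sup>L lborel (\<lambda>z. tw r z powr (p + 2) * (norm (P z)) ^ 4)"
        define Z where "Z = integral\<^sup>L lborel (\<lambda>z. tw r z powr (p + 1) * (norm (P z))\<^sup>2)"
        define E where "E = integral\<^sup>L lborel (\<lambda>z. tw r z powr (p + 1) * ((norm (P z))\<^sup>2 * e z))"
        define \<Sigma> where "\<Sigma> = integral\<^sup>L lborel (\<lambda>z. tw r z powr (p + 2) * (norm (S z))\<^sup>2)"
        have int: "integrable lborel (\<lambda>z. tw r z powr q * f z)" if "continuous_on (ball 0 1) f" "0 < q" for q and f :: "complex \<Rightarrow> real"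
          using integrable_tw_powr[OF that(1) r0 r(2) that(2)] by simp
        have iX: "integrable lborel (\<lambda>z. tw r z powr p * (norm (P z))\<^sup>2)"
          and iZ: "integrable lborel (\<lambda>z. tw r z powr (p + 1) * (norm (P z))\<^sup>2)"
          and iE: "integrable lborel (\<lambda>z. tw r z powr (p + 1) * ((norm (P z))\<^sup>2 * e z))"
          and iS: "integrable lborel (\<lambda>z. tw r z powr (p + 2) * (norm (S z))\<^sup>2)"
          using p by (auto intro!: int continuous_intros cP cS ce)
        have nonneg: "0 \<le> X" "0 \<le> Z" "0 \<le> E" "0 \<le> \<Sigma>"
          unfolding X_def Z_def E_def \<Sigma>_def by (auto intro!: integral_nonneg_AE simp: e_def)
        note en = energy_identities[OF P p r, folded S_def T_def, folded e_def, folded X_def Y_def Z_def E_def \<Sigma>_def]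
        have \<Sigma>: "\<Sigma> \<le> s"
        proof -
          have "ennreal \<Sigma> = (\<integral>\<^sup>+z. ennreal (tw r z powr (p + 2) * (norm (S z))\<^sup>2) \<partial>lborel)"
            unfolding \<Sigma>_def using iS by (intro nn_integral_eq_integral[symmetric]) auto
          also have "\<dots> \<le> N"
            unfolding N_def
          proof (rule nn_integral_mono)
            fix z :: complex
            show "ennreal (tw r z powr (p + 2) * (norm (S z))\<^sup>2) \<le> ennreal ((norm (S z))\<^sup>2 * T z powr (p + 2)) * indicator (ball 0 1) z"
            proof (cases "norm z < 1")
              case True
              have "tw r z powr (p + 2) \<le> T z powr (p + 2)" using tT[OF True] p by (intro powr_mono2) auto
              then show ?thesis using True by (auto intro!: ennreal_leI mult_right_mono simp: mult.commute[of "(norm (S z))\<^sup>2"])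
            next
              case False
              then show ?thesis using tw_eq_0[of r z] r r0 p by simp
            qed
          qed
          finally show ?thesis using s by simp
        qed
        have Z: "Z \<le> \<eta> * X + pi * C0\<^sup>2 / \<eta>\<^sup>2"
        proof -
          have iB: "integrable lborel (\<lambda>z::complex. indicator (ball 0 1) z * (C0\<^sup>2 / \<eta>\<^sup>2))"
            by (intro integrable_mult_left integrable_real_indicator emeasure_bounded_finite) auto
          have "Z \<le> integral\<^sup>L lborel (\<lambda>z. \<eta> * (tw r z powr p * (norm (P z))\<^sup>2) + indicator (ball 0 1) z * (C0\<^sup>2 / \<eta>\<^sup>2))"
            unfolding Z_def
          proof (rule integral_mono[OF iZ])
            show "integrable lborel (\<lambda>z. \<eta> * (tw r z powr p * (norm (P z))\<^sup>2) + indicator (ball 0 1) z * (C0\<^sup>2 / \<eta>\<^sup>2))"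
              by (intro Bochner_Integration.integrable_add integrable_mult_right iX iB)
            fix z :: complex
            show "tw r z powr (p + 1) * (norm (P z))\<^sup>2 \<le> \<eta> * (tw r z powr p * (norm (P z))\<^sup>2) + indicator (ball 0 1) z * (C0\<^sup>2 / \<eta>\<^sup>2)"
            proof (cases "norm z < r")
              case False
              then show ?thesis using r0 p C0 by (simp add: tw_eq_0 indicator_def)
            next
              case True
              then have z1: "norm z < 1" using r by simp
              \<comment> \<open>Where the weight is at most \<eta>, the extra power gives the factor
                \<eta>. Elsewhere T is at least \<eta>, so |P| \<le> C0 / \<eta> and a constant over
                the unit disk suffices.\<close>
              show ?thesis
              proof (cases "tw r z \<le> \<eta>")
                case True
                have "(tw r z powr p * (norm (P z))\<^sup>2) * tw r z \<le> (tw r z powr p * (norm (P z))\<^sup>2) * \<eta>"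
                  using True by (intro mult_left_mono) auto
                then show ?thesis using z1 by (simp add: powr_add mult_ac add_increasing2)
              next
                case False
                then have "norm (P z) * \<eta> \<le> norm (P z) * T z" using tT[OF z1] by (intro mult_left_mono) auto
                then have "norm (P z) \<le> C0 / \<eta>"
                  using bl z1 \<eta> by (force simp: T_def le_divide_eq intro: order_trans)
                then have "(norm (P z))\<^sup>2 \<le> (C0 / \<eta>)\<^sup>2" by (intro power_mono) auto
                moreover have "tw r z powr (p + 1) \<le> 1 powr (p + 1)"
                  using tT[OF z1] T(2)[OF z1] p by (intro powr_mono2) auto
                ultimately have "tw r z powr (p + 1) * (norm (P z))\<^sup>2 \<le> 1 * (C0 / \<eta>)\<^sup>2"
                  by (intro mult_mono) auto
                moreover have "0 \<le> \<eta> * (tw r z powr p * (norm (P z))\<^sup>2)" using \<eta> by simp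
                ultimately show ?thesis using z1 by (simp add: power_divide)
              qed
            qed
          qed
          also have "\<dots> = \<eta> * X + measure lborel (ball (0::complex) 1) * (C0\<^sup>2 / \<eta>\<^sup>2)"
            unfolding X_def using iX iB by simp
          also have "measure lborel (ball (0::complex) 1) = pi"
            using content_ball[of 1 "0::complex"] by (simp add: unit_ball_vol_2)
          finally show ?thesis by simp
        qed
        have E: "E \<le> \<eta> * X + D0 * Cb * s"
        proof -
          have "ennreal E = (\<integral>\<^sup>+z. ennreal (tw r z powr (p + 1) * ((norm (P z))\<^sup>2 * e z)) \<partial>lborel)"
            unfolding E_def using iE by (intro nn_integral_eq_integral[symmetric]) (auto simp: e_def)
          also have "\<dots> \<le> (\<integral>\<^sup>+z. ennreal (\<eta> * (tw r z powr p * (norm (P z))\<^sup>2)) + ennreal D0 * h z \<partial>lborel)"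
          proof (rule nn_integral_mono)
            fix z :: complex
            show "ennreal (tw r z powr (p + 1) * ((norm (P z))\<^sup>2 * e z))
              \<le> ennreal (\<eta> * (tw r z powr p * (norm (P z))\<^sup>2)) + ennreal D0 * h z"
            proof (cases "norm z < r")
              case False
              then show ?thesis using r0 p by (simp add: tw_eq_0)
            next
              case True
              then have z1: "norm z < 1" using r by simp
              define Q where "Q = tw r z powr p * (norm (P z))\<^sup>2"
              have Q0: "0 \<le> Q" by (simp add: Q_def)
              have e0: "0 \<le> e z" by (simp add: e_def)
              have Te: "T z * e z = max 0 (f z)"
                using T(1)[OF z1] by (simp add: e_def f_def max_mult_distrib_left algebra_simps power2_eq_square)
              have "tw r z powr (p + 1) * ((norm (P z))\<^sup>2 * e z) = Q * (tw r z * e z)"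
                by (simp add: Q_def powr_add mult_ac)
              also have "\<dots> \<le> Q * (T z * e z)"
                using tT[OF z1] e0 Q0 by (intro mult_left_mono mult_right_mono) auto
              finally have le: "tw r z powr (p + 1) * ((norm (P z))\<^sup>2 * e z) \<le> Q * max 0 (f z)" by (simp add: Te)
              \<comment> \<open>Off \<open>U\<close> the defect times T is at most \<eta> and is
                absorbed; on \<open>U\<close> it is merely bounded, and the bad set estimate takes
                over.\<close>
              show ?thesis
              proof (cases "z \<in> U")
                case False
                then have "max 0 (f z) \<le> \<eta>" using z1 \<eta> by (auto simp: U_def)
                then have "Q * max 0 (f z) \<le> \<eta> * Q" using Q0 by (simp add: mult_left_mono mult.commute[of \<eta>])
                with le have "tw r z powr (p + 1) * ((norm (P z))\<^sup>2 * e z) \<le> \<eta> * Q" by simp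
                then show ?thesis using False by (simp add: h_def Q_def ennreal_leI)
              next
                case True
                define \<beta> where "\<beta> = norm (P z) * T z"
                have \<beta>: "0 \<le> \<beta>" "\<beta> \<le> C0" using bl z1 T[OF z1] by (auto simp: \<beta>_def T_def)
                have "- Re (z * P z) \<le> norm (z * P z)" using abs_Re_le_cmod[of "z * P z"] by linarith
                also have "\<dots> \<le> norm (P z)" using z1 by (simp add: norm_mult mult_left_le_one_le)
                finally have "- Re (z * P z) * T z \<le> \<beta>"
                  unfolding \<beta>_def using T[OF z1] by (intro mult_right_mono) auto
                moreover have "f z = \<beta>\<^sup>2 / 4 - T z - Re (z * P z) * T z" by (simp add: f_def \<beta>_def)
                moreover have "\<beta>\<^sup>2 \<le> C0\<^sup>2" using \<beta> by (intro power_mono) auto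
                ultimately have "f z \<le> C0\<^sup>2 / 4 + C0" using T(1)[OF z1] \<beta> by linarith
                then have mf: "max 0 (f z) \<le> C0\<^sup>2 / 4 + C0" using C0 by simp
                have "Q \<le> T z powr p * (norm (P z))\<^sup>2"
                  unfolding Q_def using tT[OF z1] p by (intro mult_right_mono powr_mono2) auto
                also have "\<dots> = (T z powr (p - 2) * T z powr 2) * (norm (P z))\<^sup>2" by (simp flip: powr_add)
                also have "\<dots> = T z powr (p - 2) * \<beta>\<^sup>2"
                  using T(1)[OF z1] by (simp add: \<beta>_def power_mult_distrib)
                also have "\<dots> \<le> T z powr (p - 2) * C0\<^sup>2" using \<open>\<beta>\<^sup>2 \<le> C0\<^sup>2\<close> by (intro mult_left_mono) auto
                finally have "Q * max 0 (f z) \<le> (T z powr (p - 2) * C0\<^sup>2) * (C0\<^sup>2 / 4 + C0)"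
                  using mf Q0 by (intro mult_mono) auto
                with le have "tw r z powr (p + 1) * ((norm (P z))\<^sup>2 * e z) \<le> D0 * T z powr (p - 2)"
                  by (simp add: D0_def mult_ac)
                then have "ennreal (tw r z powr (p + 1) * ((norm (P z))\<^sup>2 * e z)) \<le> ennreal D0 * h z"
                  using True D0 by (simp add: h_def ennreal_mult[symmetric] ennreal_leI)
                then show ?thesis by (simp add: add_increasing)
              qed
            qed
          qed
          also have "\<dots> = (\<integral>\<^sup>+z. ennreal (\<eta> * (tw r z powr p * (norm (P z))\<^sup>2)) \<partial>lborel) + (\<integral>\<^sup>+z. ennreal D0 * h z \<partial>lborel)"
            using iX mh by (intro nn_integral_add) auto
          also have "(\<integral>\<^sup>+z. ennreal (\<eta> * (tw r z powr p * (norm (P z))\<^sup>2)) \<partial>lborel) = ennreal (\<eta> * X)"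
            unfolding X_def using iX \<eta>
            by (subst nn_integral_eq_integral) (auto intro!: integrable_mult_right)
          also have "(\<integral>\<^sup>+z. ennreal D0 * h z \<partial>lborel) = ennreal D0 * (\<integral>\<^sup>+z. h z \<partial>lborel)"
            using mh by (intro nn_integral_cmult) auto
          also have "ennreal D0 * (\<integral>\<^sup>+z. h z \<partial>lborel) \<le> ennreal D0 * (ennreal Cb * N)"
            by (intro mult_left_mono hN) auto
          also have "\<dots> = ennreal (D0 * Cb * s)"
            using s D0 Cb by (simp add: ennreal_mult mult.assoc)
          finally have "ennreal E \<le> ennreal (\<eta> * X + D0 * Cb * s)"
            using nonneg \<eta> D0 Cb s by (simp add: ennreal_plus[symmetric] del: ennreal_plus)
          moreover have "0 \<le> \<eta> * X + D0 * Cb * s" using nonneg \<eta> D0 Cb s by simp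
          ultimately show ?thesis by (simp only: ennreal_le_iff)
        qed
        have "Y \<le> 8 / p * ((p + 2) * (Z + E) + 2 / p * \<Sigma>)"
          using en(2) p by (simp add: field_simps)
        also have "\<dots> = 8 * (p + 2) / p * Z + 8 * (p + 2) / p * E + 16 / p\<^sup>2 * \<Sigma>"
          using p by (simp add: field_simps power2_eq_square)
        finally have "X \<le> 8 * (p + 2) * Z + 32 * \<Sigma> + 8 * (8 * (p + 2) / p * Z + 8 * (p + 2) / p * E + 16 / p\<^sup>2 * \<Sigma>)"
          using en(1) by simp
        also have "\<dots> = (8 * (p + 2) + 64 * (p + 2) / p) * Z + (64 * (p + 2) / p) * E + (32 + 128 / p\<^sup>2) * \<Sigma>"
          by (simp add: algebra_simps)
        also have "\<dots> \<le> K * Z + K * E + K * \<Sigma>"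
          using p nonneg by (intro add_mono mult_right_mono) (auto simp: K_def)
        also have "\<dots> \<le> K * (\<eta> * X + pi * C0\<^sup>2 / \<eta>\<^sup>2) + K * (\<eta> * X + D0 * Cb * s) + K * s"
          using Z E \<Sigma> K by (intro add_mono mult_left_mono) auto
        also have "\<dots> = X / 2 + K * (pi * C0\<^sup>2 / \<eta>\<^sup>2 + (D0 * Cb + 1) * s)"
          using K by (simp add: \<eta>_def algebra_simps)
        finally have "X \<le> 2 * K * (pi * C0\<^sup>2 / \<eta>\<^sup>2 + (D0 * Cb + 1) * s)" by simp
        also have "\<dots> \<le> 2 * K * ((pi * C0\<^sup>2 / \<eta>\<^sup>2 + D0 * Cb + 1) * (1 + s))"
        proof -
          have "a + (b + 1) * s \<le> (a + b + 1) * (1 + s)" if "0 \<le> a" "0 \<le> b" for a b :: real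
            using mult_nonneg_nonneg[OF that(1) s(2)] that by (simp add: algebra_simps)
          then show ?thesis using K D0 Cb C0 \<eta> by (intro mult_left_mono) auto
        qed
        also have "\<dots> = C * (1 + s)" by (simp add: C_def)
        finally have "X \<le> C * (1 + s)" .
        moreover have "(\<integral>\<^sup>+z. ennreal (tw r z powr p * (norm (P z))\<^sup>2) \<partial>lborel) = ennreal X"
          unfolding X_def using iX by (intro nn_integral_eq_integral) auto
        ultimately show ?thesis by (simp add: ennreal_leI)
      qed
      \<comment> \<open>Increasing to 1 and starting at 1/2, the smallest radius that the energy
        identities admit; monotone convergence removes the truncation.\<close>
      define rr where "rr n = 1 - 1 / (real n + 2)" for n
      have rr: "1 / 2 \<le> rr n" "rr n < 1" for n by (auto simp: rr_def field_simps)
      have rrm: "rr m \<le> rr n" if "m \<le> n" for m n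
        using that by (auto simp: rr_def intro!: divide_left_mono)
      have rrl: "rr \<longlonglongrightarrow> 1" unfolding rr_def by real_asymp
      define F where "F n z = ennreal (tw (rr n) z powr p * (norm (P z))\<^sup>2)" for n z
      have "(\<lambda>n. \<integral>\<^sup>+z. F n z \<partial>lborel) \<longlonglongrightarrow> (\<integral>\<^sup>+z. ennreal (tw 1 z powr p * (norm (P z))\<^sup>2) \<partial>lborel)"
      proof (rule nn_integral_LIMSEQ)
        show "incseq F"
        proof (intro incseq_SucI le_funI)
          fix n z
          have "0 \<le> rr n" using rr(1)[of n] by linarith
          then show "F n z \<le> F (Suc n) z"
            unfolding F_def using tw_mono[OF _ rrm[of n "Suc n"]] p
            by (intro ennreal_leI mult_right_mono powr_mono2) auto
        qed
        show "F n \<in> borel_measurable lborel" for n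
        proof -
          have "0 < rr n" using rr(1)[of n] by linarith
          then have "integrable lborel (\<lambda>z. tw (rr n) z powr p *\<^sub>R (norm (P z))\<^sup>2)"
            using p rr by (intro integrable_tw_powr[of 1] continuous_intros cP) auto
          then show ?thesis unfolding F_def by simp
        qed
        show "(\<lambda>n. F n z) \<longlonglongrightarrow> ennreal (tw 1 z powr p * (norm (P z))\<^sup>2)" for z
          unfolding F_def tw_def
          by (intro tendsto_ennrealI tendsto_mult tendsto_const tendsto_powr' tendsto_max tendsto_diff tendsto_power rrl)
            (use p in auto)
      qed
      moreover have "(\<integral>\<^sup>+z. F n z \<partial>lborel) \<le> ennreal (C * (1 + s))" for n
        unfolding F_def by (rule bound[OF rr])
      ultimately have "(\<integral>\<^sup>+z. ennreal (tw 1 z powr p * (norm (P z))\<^sup>2) \<partial>lborel) \<le> ennreal (C * (1 + s))"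
        by (intro LIMSEQ_le_const2) auto
      also have "(\<integral>\<^sup>+z. ennreal (tw 1 z powr p * (norm (P z))\<^sup>2) \<partial>lborel)
        = (\<integral>\<^sub>D z. (norm (P z))\<^sup>2 * T z powr p)"
      proof (rule nn_integral_cong)
        fix z :: complex
        show "ennreal (tw 1 z powr p * (norm (P z))\<^sup>2) = ennreal ((norm (P z))\<^sup>2 * T z powr p) * indicator (ball 0 1) z"
          using p by (cases "norm z < 1") (auto simp: tw_1 T_def tw_eq_0 mult.commute)
      qed
      also have "ennreal (C * (1 + s)) = ennreal C * (1 + N)"
        using C s by (simp add: ennreal_mult)
      finally show ?thesis .
    qed
    then show "(\<integral>\<^sub>D z. (norm (P z))\<^sup>2 * (1 - (norm z)\<^sup>2) powr p)
      \<le> ennreal C * (1 + (\<integral>\<^sub>D z. (norm (deriv P z - (P z)\<^sup>2 / 2))\<^sup>2 * (1 - (norm z)\<^sup>2) powr (p + 2)))"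
      by (simp add: N_def T_def S_def)
  qed (use C in auto)
qed

section \<open>Moebius invariance\<close>

text \<open>The change of variables theorem used below speaks about Cartesian vectors, so area
  integrals are carried to \<open>real^2\<close> and back.\<close>

definition vec_of_complex :: "complex \<Rightarrow> real^2" where
  "vec_of_complex z = (\<chi> i. if i = 1 then Re z else Im z)"

definition complex_of_vec :: "real^2 \<Rightarrow> complex" where
  "complex_of_vec x = Complex (x $ 1) (x $ 2)"

lemma vec_complex_inverse [simp]:
  "complex_of_vec (vec_of_complex z) = z" "vec_of_complex (complex_of_vec x) = x"
proof -
  show "complex_of_vec (vec_of_complex z) = z"
    by (simp add: complex_of_vec_def vec_of_complex_def complex_eq_iff)
  show "vec_of_complex (complex_of_vec x) = x"
    unfolding complex_of_vec_def vec_of_complex_def vec_eq_iff using exhaust_2 by auto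
qed

lemma bounded_linear_vec_of_complex: "bounded_linear vec_of_complex"
  unfolding vec_of_complex_def
  by (intro linear_conv_bounded_linear[THEN iffD1] linearI) (auto simp: vec_eq_iff)

lemma bounded_linear_complex_of_vec: "bounded_linear complex_of_vec"
  unfolding complex_of_vec_def
  by (intro linear_conv_bounded_linear[THEN iffD1] linearI) (auto simp: complex_eq_iff)

lemma continuous_on_complex_of_vec: "continuous_on A complex_of_vec"
  by (rule linear_continuous_on[OF bounded_linear_complex_of_vec])

lemma lborel_complex_eq_distr: "lborel = distr lborel borel complex_of_vec"
proof (rule lborel_eqI)
  have [measurable]: "complex_of_vec \<in> borel \<rightarrow>\<^sub>M borel"
    by (rule borel_measurable_continuous_onI[OF continuous_on_complex_of_vec])
  fix l u :: complex assume le: "\<And>b. b \<in> Basis \<Longrightarrow> l \<bullet> b \<le> u \<bullet> b"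
  then have le': "Re l \<le> Re u" "Im l \<le> Im u" using le[of 1] le[of \<i>] by (auto simp: Basis_complex_def)
  have "complex_of_vec -` box l u = box (vec_of_complex l) (vec_of_complex u)"
    by (auto simp: in_box_complex_iff complex_of_vec_def vec_of_complex_def mem_box_cart forall_2)
  moreover have "emeasure lborel (box (vec_of_complex l) (vec_of_complex u))
      = (\<Prod>b\<in>Basis. (vec_of_complex u - vec_of_complex l) \<bullet> b)"
    using le' by (intro emeasure_lborel_box) (auto simp: Basis_vec_def inner_axis vec_of_complex_def)
  moreover have "(\<Prod>b\<in>Basis. (vec_of_complex u - vec_of_complex l) \<bullet> b) = (Re u - Re l) * (Im u - Im l)"
  proof -
    have B: "(Basis :: (real^2) set) = {axis 1 1, axis 2 1}" by (auto simp: Basis_vec_def UNIV_2)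
    have "axis 1 (1::real) \<noteq> (axis 2 1 :: real^2)" by (simp add: axis_eq_axis)
    then show ?thesis unfolding B by (simp add: inner_axis vec_of_complex_def)
  qed
  ultimately show "emeasure (distr lborel borel complex_of_vec) (box l u) = (\<Prod>b\<in>Basis. (u - l) \<bullet> b)"
    by (simp add: emeasure_distr Basis_complex_def)
qed auto

lemma nn_integral_complex_of_vec:
  assumes "F \<in> borel_measurable borel"
  shows "(\<integral>\<^sup>+z. F z \<partial>lborel) = (\<integral>\<^sup>+x. F (complex_of_vec x) \<partial>lborel)"
  by (subst lborel_complex_eq_distr, subst nn_integral_distr)
    (use assms borel_measurable_continuous_onI[OF continuous_on_complex_of_vec] in auto)

lemma det_matrix_complex_mult:
  "det (matrix (\<lambda>h. vec_of_complex (c * complex_of_vec h))) = (norm c)\<^sup>2"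
  unfolding cmod_power2
  by (simp add: det_2 matrix_def vec_of_complex_def complex_of_vec_def axis_def power2_eq_square)

text \<open>The Jacobian determinant of multiplication by c is |c|^2. As an inequality the statement
  is trivial when the right side is infinite, and otherwise f is integrable, as the change of
  variables theorem requires. For the involutions \<phi>_a the reverse direction comes from applying
  it again.\<close>

lemma nn_integral_holomorphic_substitution_le:
  fixes f :: "complex \<Rightarrow> real"
  assumes S: "open S" and \<phi>: "\<phi> holomorphic_on S" "inj_on \<phi> S"
    and f: "continuous_on (\<phi> ` S) f" "\<And>z. z \<in> \<phi> ` S \<Longrightarrow> 0 \<le> f z"
  shows "(\<integral>\<^sup>+z\<in>S. ennreal (f (\<phi> z) * (norm (deriv \<phi> z))\<^sup>2) \<partial>lborel) \<le> (\<integral>\<^sup>+z\<in>\<phi> ` S. ennreal (f z) \<partial>lborel)"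
proof (cases "(\<integral>\<^sup>+z\<in>\<phi> ` S. ennreal (f z) \<partial>lborel) = \<infinity>")
  case False
  have oS: "open (\<phi> ` S)" using open_mapping_thm3[OF \<phi>(1) S \<phi>(2)] by simp
  define V where "V = complex_of_vec -` S"
  define g where "g x = vec_of_complex (\<phi> (complex_of_vec x))" for x
  define f' where "f' x = f (complex_of_vec x)" for x
  have V: "open V" unfolding V_def by (rule open_vimage[OF S continuous_on_complex_of_vec])
  have gV: "g ` V = complex_of_vec -` (\<phi> ` S)"
  proof (intro set_eqI iffI)
    fix x assume "x \<in> complex_of_vec -` (\<phi> ` S)"
    then obtain z where "z \<in> S" "complex_of_vec x = \<phi> z" by auto
    then have "x = g (vec_of_complex z)" "vec_of_complex z \<in> V"
      by (auto simp: g_def V_def) (metis vec_complex_inverse(2))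
    then show "x \<in> g ` V" by blast
  qed (auto simp: g_def V_def)
  have ogV: "open (g ` V)" unfolding gV by (rule open_vimage[OF oS continuous_on_complex_of_vec])
  have mf: "(\<lambda>z. ennreal (f z) * indicator (\<phi> ` S) z) \<in> borel_measurable borel"
    by (rule measurable_ennreal_indicator[OF f(1) oS])
  have c\<phi>: "continuous_on S \<phi>" "continuous_on S (deriv \<phi>)"
    using \<phi>(1) S by (auto intro!: holomorphic_on_imp_continuous_on holomorphic_deriv)
  have mL: "(\<lambda>z. ennreal (f (\<phi> z) * (norm (deriv \<phi> z))\<^sup>2) * indicator S z) \<in> borel_measurable borel"
    using c\<phi> by (intro measurable_ennreal_indicator S continuous_intros continuous_on_compose2[OF f(1)]) auto
  define F where "F x = f' x * indicator (g ` V) x" for x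
  have eqF: "ennreal (F x) = ennreal (f (complex_of_vec x)) * indicator (\<phi> ` S) (complex_of_vec x)" for x
    by (simp add: F_def gV f'_def indicator_def)
  have "continuous_on (g ` V) f'"
    unfolding f'_def by (rule continuous_on_compose2[OF f(1) continuous_on_complex_of_vec]) (simp add: gV)
  then have mF: "F \<in> borel_measurable borel"
    using borel_measurable_continuous_on_indicator[of "g ` V" f'] ogV by (simp add: F_def[abs_def] mult.commute)
  have F0: "0 \<le> F x" for x using f(2) by (auto simp: F_def gV f'_def indicator_def)
  have If: "(\<integral>\<^sup>+z\<in>\<phi> ` S. ennreal (f z) \<partial>lborel) = (\<integral>\<^sup>+x. ennreal (F x) \<partial>lborel)"
    unfolding eqF by (rule nn_integral_complex_of_vec[OF mf])
  then obtain I where I: "(\<integral>\<^sup>+x. ennreal (F x) \<partial>lborel) = ennreal I" "0 \<le> I"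
    using False by (cases "\<integral>\<^sup>+x. ennreal (F x) \<partial>lborel") auto
  have "(F has_integral I) UNIV" by (rule nn_integral_has_integral[OF mF F0 I])
  moreover have "F = (\<lambda>x. if x \<in> g ` V then f' x else 0)" by (auto simp: F_def indicator_def)
  ultimately have fI: "(f' has_integral I) (g ` V)" by (simp only: has_integral_restrict_UNIV)
  have f'0: "0 \<le> f' x" if "x \<in> g ` V" for x using that f(2) by (auto simp: gV f'_def)
  then have "f' absolutely_integrable_on g ` V"
    using fI by (subst absolutely_integrable_on_iff_nonneg) auto
  then have *: "(\<lambda>x. vec (f' x) :: real^1) absolutely_integrable_on g ` V \<and> integral (g ` V) (\<lambda>x. vec (f' x) :: real^1) = vec I"
    using fI by (simp add: absolutely_integrable_on_1_iff integral_on_1_eq integral_unique)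
  have der: "(g has_derivative (\<lambda>h. vec_of_complex (deriv \<phi> (complex_of_vec x) * complex_of_vec h))) (at x within V)"
    if "x \<in> V" for x
  proof -
    have "(\<phi> has_derivative (*) (deriv \<phi> (complex_of_vec x))) (at (complex_of_vec x))"
      using holomorphic_derivI[OF \<phi>(1) S, of "complex_of_vec x"] that by (simp add: V_def has_field_derivative_def)
    from has_derivative_compose[OF bounded_linear_imp_has_derivative[OF bounded_linear_complex_of_vec] this]
    have "((\<lambda>x. \<phi> (complex_of_vec x)) has_derivative (\<lambda>h. deriv \<phi> (complex_of_vec x) * complex_of_vec h)) (at x within V)" .
    then show ?thesis unfolding g_def
      by (rule bounded_linear.has_derivative[OF bounded_linear_vec_of_complex])
  qed
  have inj: "inj_on g V"
  proof (rule inj_onI)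
    fix x y assume "x \<in> V" "y \<in> V" "g x = g y"
    then have "\<phi> (complex_of_vec x) = \<phi> (complex_of_vec y)"
      unfolding g_def by (metis vec_complex_inverse(1))
    then have "complex_of_vec x = complex_of_vec y"
      using \<phi>(2) \<open>x \<in> V\<close> \<open>y \<in> V\<close> by (auto simp: V_def inj_on_def)
    then show "x = y" by (metis vec_complex_inverse(2))
  qed
  define L where "L x = (norm (deriv \<phi> (complex_of_vec x)))\<^sup>2 * f' (g x)" for x
  have "V \<in> sets lebesgue" using V by (simp add: borel_open)
  from has_absolute_integral_change_of_variables[OF this der inj, of "\<lambda>x. vec (f' x) :: real^1" "vec I"] *
  have "(\<lambda>x. vec (L x) :: real^1) absolutely_integrable_on V \<and> integral V (\<lambda>x. vec (L x) :: real^1) = vec I"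
    unfolding det_matrix_complex_mult by (simp add: L_def vec_def vec_eq_iff scaleR_vec_def)
  then have "L absolutely_integrable_on V" "integral V L = I"
    by (simp_all add: absolutely_integrable_on_1_iff integral_on_1_eq vec_eq_iff)
  then have LI: "(L has_integral I) V"
    using has_integral_integral set_lebesgue_integral_eq_integral(1) by blast
  have "(\<integral>\<^sup>+z\<in>S. ennreal (f (\<phi> z) * (norm (deriv \<phi> z))\<^sup>2) \<partial>lborel) = (\<integral>\<^sup>+x. ennreal (L x) * indicator V x \<partial>lborel)"
    by (subst nn_integral_complex_of_vec[OF mL])
      (auto intro!: nn_integral_cong simp: L_def V_def f'_def g_def indicator_def mult.commute)
  also have "\<dots> = ennreal I"
    by (rule nn_integral_has_integral_lebesgue'[OF _ LI]) (auto simp: L_def f'0)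
  finally show ?thesis using If I by simp
qed simp

section \<open>The involutive automorphisms of the disk\<close>

lemma disk_aut_ball:
  assumes "norm a < 1" "norm z < 1"
  shows "norm (disk_aut a z) < 1"
proof -
  have "(norm (disk_aut a z))\<^sup>2 < 1\<^sup>2" using one_minus_norm_disk_aut_pos[OF assms] by simp
  then show ?thesis by (rule power2_less_imp_less) simp
qed

lemma one_minus_cnj_mult_self: "1 - cnj a * a = of_real (1 - (norm a)\<^sup>2)"
  by (simp add: complex_norm_square mult.commute del: of_real_power)

lemma disk_aut_disk_aut:
  assumes "norm a < 1" "norm z < 1"
  shows "disk_aut a (disk_aut a z) = z"
proof -
  have d: "1 - cnj a * z \<noteq> 0" using one_minus_norm_disk_aut(2)[OF assms] .
  have "1 - cnj a * a \<noteq> 0" using one_minus_norm_disk_aut(2)[OF assms(1) assms(1)] .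
  have "1 - cnj a * disk_aut a z = (1 - cnj a * a) / (1 - cnj a * z)"
    using d by (simp add: disk_aut_def field_simps)
  moreover have "a - disk_aut a z = z * (1 - cnj a * a) / (1 - cnj a * z)"
    using d by (simp add: disk_aut_def field_simps)
  ultimately show ?thesis
    using d \<open>1 - cnj a * a \<noteq> 0\<close> by (simp add: disk_aut_def[of a "disk_aut a z"])
qed

lemma disk_aut_image: "norm a < 1 \<Longrightarrow> disk_aut a ` ball 0 1 = ball 0 1"
proof (intro set_eqI iffI)
  fix z assume a: "norm a < 1" and "z \<in> ball (0::complex) 1"
  then have "disk_aut a z \<in> ball 0 1" "z = disk_aut a (disk_aut a z)"
    by (auto simp: disk_aut_ball disk_aut_disk_aut)
  then show "z \<in> disk_aut a ` ball 0 1" by blast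
qed (auto simp: disk_aut_ball)

lemma inj_on_disk_aut: "norm a < 1 \<Longrightarrow> inj_on (disk_aut a) (ball 0 1)"
  by (rule inj_on_inverseI[where g = "disk_aut a"]) (simp add: disk_aut_disk_aut)

lemma holomorphic_on_disk_aut: "norm a < 1 \<Longrightarrow> disk_aut a holomorphic_on ball 0 1"
  unfolding disk_aut_def using one_minus_norm_disk_aut(2)[of a] by (intro holomorphic_intros) auto

lemma has_field_derivative_disk_aut:
  assumes "norm a < 1" "norm z < 1"
  shows "(disk_aut a has_field_derivative - (1 - cnj a * a) / (1 - cnj a * z)\<^sup>2) (at z)"
  unfolding disk_aut_def using one_minus_norm_disk_aut(2)[OF assms]
  by (auto intro!: derivative_eq_intros simp: field_simps power2_eq_square)

lemma deriv_disk_aut: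
  assumes "norm a < 1" "norm z < 1"
  shows "deriv (disk_aut a) z = - (1 - cnj a * a) / (1 - cnj a * z)\<^sup>2"
  using DERIV_imp_deriv[OF has_field_derivative_disk_aut[OF assms]] .

text \<open>Equality in the Schwarz-Pick lemma: automorphisms preserve the hyperbolic metric. This
  identity links the Carleson kernel with the weight of the Q_p integrals.\<close>

lemma norm_deriv_disk_aut:
  assumes "norm a < 1" "norm z < 1"
  shows "norm (deriv (disk_aut a) z) * (1 - (norm z)\<^sup>2) = 1 - (norm (disk_aut a z))\<^sup>2"
proof -
  have "norm (1 - cnj a * a) = 1 - (norm a)\<^sup>2"
    unfolding one_minus_cnj_mult_self norm_of_real using one_minus_norm_power2(1)[OF assms(1)] by simp
  then show ?thesis
    by (simp add: deriv_disk_aut[OF assms] one_minus_norm_disk_aut(1)[OF assms] norm_divide norm_power)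
      (metis norm_minus_commute minus_diff_eq norm_minus_cancel)
qed

lemma has_field_derivative_deriv_disk_aut:
  assumes a: "norm a < 1" and z: "norm z < 1"
  shows "(deriv (disk_aut a) has_field_derivative 2 * cnj a / (1 - cnj a * z) * deriv (disk_aut a) z) (at z)"
proof -
  note d = one_minus_norm_disk_aut(2)[OF a z]
  have inv: "((\<lambda>z. - K / (f z)\<^sup>2) has_field_derivative (- 2 * f' / f z) * (- K / (f z)\<^sup>2)) (at z)"
    if "(f has_field_derivative f') (at z)" "f z \<noteq> 0" for f f' K
    using that by (auto intro!: derivative_eq_intros simp: field_simps power2_eq_square)
  have "((\<lambda>z. 1 - cnj a * z) has_field_derivative - cnj a) (at z)" by (auto intro!: derivative_eq_intros)
  from inv[OF this d, of "1 - cnj a * a"]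
  have "((\<lambda>z. - (1 - cnj a * a) / (1 - cnj a * z)\<^sup>2) has_field_derivative 2 * cnj a / (1 - cnj a * z) * deriv (disk_aut a) z) (at z)"
    by (simp add: deriv_disk_aut[OF a z])
  then show ?thesis
    by (rule has_field_derivative_transform_within_open[where S = "ball 0 1"])
      (use z a in \<open>auto simp: deriv_disk_aut\<close>)
qed

lemma norm_deriv_disk_aut_involution:
  assumes a: "norm a < 1" and z: "norm z < 1"
  shows "norm (deriv (disk_aut a) (disk_aut a z)) * norm (deriv (disk_aut a) z) = 1"
proof -
  have "norm (deriv (disk_aut a) (disk_aut a z)) * (norm (deriv (disk_aut a) z) * (1 - (norm z)\<^sup>2)) = 1 - (norm z)\<^sup>2"
    using norm_deriv_disk_aut[OF a disk_aut_ball[OF a z]] norm_deriv_disk_aut[OF a z] disk_aut_disk_aut[OF a z] by simp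
  then show ?thesis using one_minus_norm_power2(1)[OF z] by simp
qed

text \<open>By Moebius invariance it suffices to treat \<open>a = 0\<close>: the pre-Schwarzian of \<open>h \<circ> \<phi>\<^sub>a\<close> is
  \<open>Q = (P \<circ> \<phi>\<^sub>a) \<phi>\<^sub>a' + A\<close> with \<open>A = \<phi>\<^sub>a''/\<phi>\<^sub>a'\<close>. The extra term \<open>A\<close> is itself a pre-Schwarzian, of a map with
  vanishing Schwarzian, so its energy is bounded by the same estimate.\<close>
theorem nn_integral_riccati_weighted_le:
  fixes C0 p :: real
  assumes C0: "0 < C0" and p: "0 < p"
  shows "\<exists>C\<ge>0. \<forall>P a. P holomorphic_on ball 0 1 \<longrightarrow>
    (\<forall>x. norm x < 1 \<longrightarrow> norm (P x) * (1 - (norm x)\<^sup>2) \<le> C0) \<longrightarrow> norm a < 1 \<longrightarrow>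
    (\<integral>\<^sub>D z. (norm (P z))\<^sup>2 * disk_weight p a z)
    \<le> ennreal C * (1 + (\<integral>\<^sub>D z. (norm (deriv P z - (P z)\<^sup>2 / 2) * (1 - (norm z)\<^sup>2))\<^sup>2 * disk_weight p a z))"
proof -
  \<comment> \<open>The 4 bounds |A| T for the pre-Schwarzian A of \<phi>_a, so that C0 + 4 serves
    both Q and A.\<close>
  have C04: "0 < C0 + 4" using C0 by simp
  obtain C where C: "0 \<le> C" and main: "\<forall>P. P holomorphic_on ball 0 1 \<longrightarrow>
    (\<forall>x. norm x < 1 \<longrightarrow> norm (P x) * (1 - (norm x)\<^sup>2) \<le> C0 + 4) \<longrightarrow>
    (\<integral>\<^sub>D z. (norm (P z))\<^sup>2 * (1 - (norm z)\<^sup>2) powr p)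
    \<le> ennreal C * (1 + (\<integral>\<^sub>D z. (norm (deriv P z - (P z)\<^sup>2 / 2))\<^sup>2 * (1 - (norm z)\<^sup>2) powr (p + 2)))"
    using nn_integral_riccati_le[OF C04 p] by (elim exE conjE) (rule that)
  show ?thesis
  proof (intro exI[of _ "4 * C"] conjI allI impI)
    fix P :: "complex \<Rightarrow> complex" and a :: complex
    assume P: "P holomorphic_on ball 0 1" and bl: "\<forall>x. norm x < 1 \<longrightarrow> norm (P x) * (1 - (norm x)\<^sup>2) \<le> C0"
      and a: "norm a < 1"
    define \<phi> where "\<phi> = disk_aut a"
    define T where "T z = 1 - (norm z)\<^sup>2" for z :: complex
    define S where "S z = deriv P z - (P z)\<^sup>2 / 2" for z
    define A where "A z = 2 * cnj a / (1 - cnj a * z)" for z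
    define Q where "Q z = P (\<phi> z) * deriv \<phi> z + A z" for z
    define om where "om z = (1 - (norm (\<phi> z))\<^sup>2) powr p" for z
    have T: "0 < T z" if "norm z < 1" for z using one_minus_norm_power2(1)[OF that] by (simp add: T_def)
    have \<phi>1: "norm (\<phi> z) < 1" if "norm z < 1" for z unfolding \<phi>_def using disk_aut_ball[OF a that] .
    have \<phi>T: "norm (deriv \<phi> z) * T z = T (\<phi> z)" if "norm z < 1" for z
      using norm_deriv_disk_aut[OF a that] by (simp add: T_def \<phi>_def)
    have \<phi>\<phi>: "\<phi> (\<phi> z) = z" if "norm z < 1" for z unfolding \<phi>_def using disk_aut_disk_aut[OF a that] .
    have \<phi>h: "\<phi> holomorphic_on ball 0 1" unfolding \<phi>_def by (rule holomorphic_on_disk_aut[OF a])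
    have d\<phi>h: "deriv \<phi> holomorphic_on ball 0 1" by (intro holomorphic_deriv \<phi>h) auto
    have img: "\<phi> ` ball 0 1 = ball 0 1" unfolding \<phi>_def by (rule disk_aut_image[OF a])
    have inj: "inj_on \<phi> (ball 0 1)" unfolding \<phi>_def by (rule inj_on_disk_aut[OF a])
    have den: "1 - cnj a * z \<noteq> 0" if "norm z < 1" for z using one_minus_norm_disk_aut(2)[OF a that] .
    have Ah: "A holomorphic_on ball 0 1"
      unfolding A_def using den by (intro holomorphic_intros) auto
    have P\<phi>h: "(\<lambda>z. P (\<phi> z)) holomorphic_on ball 0 1"
      using holomorphic_on_compose_gen[OF \<phi>h P] img by (simp add: o_def)
    have Qh: "Q holomorphic_on ball 0 1"
      unfolding Q_def by (intro holomorphic_intros P\<phi>h d\<phi>h Ah)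
    have Ab: "norm (A z) * T z \<le> 4" if z: "norm z < 1" for z
    proof -
      have "norm a * norm z \<le> norm z" using a by (simp add: mult_left_le_one_le)
      then have "1 - norm z \<le> norm (1 - cnj a * z)"
        using norm_triangle_ineq2[of 1 "cnj a * z"] by (simp add: norm_mult)
      then have "T z \<le> 2 * norm (1 - cnj a * z)"
        using one_minus_norm_power2(3)[OF z] by (simp add: T_def)
      then have "norm a * T z \<le> 1 * (2 * norm (1 - cnj a * z))"
        using a T[OF z] by (intro mult_mono) auto
      moreover have "0 < norm (1 - cnj a * z)" using den[OF z] by simp
      ultimately show ?thesis by (simp add: A_def norm_divide norm_mult divide_le_eq)
    qed
    have Qb: "norm (Q z) * T z \<le> C0 + 4" if z: "norm z < 1" for z
    proof -
      have "norm (Q z) * T z \<le> (norm (P (\<phi> z)) * norm (deriv \<phi> z) + norm (A z)) * T z"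
        unfolding Q_def using T[OF z] by (intro mult_right_mono norm_triangle_le) (auto simp: norm_mult)
      also have "\<dots> = norm (P (\<phi> z)) * T (\<phi> z) + norm (A z) * T z"
        by (simp add: \<phi>T[OF z, symmetric] algebra_simps)
      also have "\<dots> \<le> C0 + 4" using bl \<phi>1[OF z] Ab[OF z] by (intro add_mono) (auto simp: T_def)
      finally show ?thesis .
    qed
    have dA: "(A has_field_derivative (A z)\<^sup>2 / 2) (at z)" if "norm z < 1" for z
    proof -
      have inv: "((\<lambda>z. K / f z) has_field_derivative (- f' / f z) * (K / f z)) (at z)"
        if "(f has_field_derivative f') (at z)" "f z \<noteq> 0" for f f' K
        using that by (auto intro!: derivative_eq_intros simp: field_simps)
      have "((\<lambda>z. 1 - cnj a * z) has_field_derivative - cnj a) (at z)" by (auto intro!: derivative_eq_intros)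
      from inv[OF this den[OF that], of "2 * cnj a"] show ?thesis
        unfolding A_def[abs_def] by (simp add: power2_eq_square mult_ac)
    qed
    \<comment> \<open>The chain rule for the Schwarzian: the terms with A cancel because A' = A^2 /
      2, which says that \<phi>_a has vanishing Schwarzian.\<close>
    have SQ: "deriv Q z - (Q z)\<^sup>2 / 2 = S (\<phi> z) * (deriv \<phi> z)\<^sup>2" if z: "norm z < 1" for z
    proof -
      have d1: "(\<phi> has_field_derivative deriv \<phi> z) (at z)"
        using z by (intro holomorphic_derivI[OF \<phi>h]) auto
      have d2: "(deriv \<phi> has_field_derivative A z * deriv \<phi> z) (at z)"
        using has_field_derivative_deriv_disk_aut[OF a z] by (simp add: \<phi>_def A_def)
      have d3: "((\<lambda>z. P (\<phi> z)) has_field_derivative deriv P (\<phi> z) * deriv \<phi> z) (at z)"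
        using \<phi>1[OF z] by (intro DERIV_chain2[OF _ d1] holomorphic_derivI[OF P]) auto
      have "deriv Q z = deriv P (\<phi> z) * (deriv \<phi> z)\<^sup>2 + P (\<phi> z) * (A z * deriv \<phi> z) + (A z)\<^sup>2 / 2"
        unfolding Q_def[abs_def]
        by (rule DERIV_imp_deriv) (rule derivative_eq_intros d2 d3 dA[OF z] refl | simp add: power2_eq_square)+
      then show ?thesis by (simp add: Q_def S_def power2_eq_square algebra_simps add_divide_distrib)
    qed
    define M where "M = (\<integral>\<^sub>D z. (norm (S z) * T z)\<^sup>2 * om z)"
    have cT: "continuous_on (ball 0 1) T" unfolding T_def by (intro continuous_intros)
    have c\<phi>: "continuous_on (ball 0 1) \<phi>" "continuous_on (ball 0 1) (deriv \<phi>)"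
      using \<phi>h d\<phi>h by (auto intro: holomorphic_on_imp_continuous_on)
    have cP: "continuous_on (ball 0 1) P" "continuous_on (ball 0 1) (\<lambda>z. P (\<phi> z))"
      using P P\<phi>h by (auto intro: holomorphic_on_imp_continuous_on)
    have cS: "continuous_on (ball 0 1) S"
      unfolding S_def using P by (intro holomorphic_on_imp_continuous_on holomorphic_intros holomorphic_deriv) auto
    have com: "continuous_on (ball 0 1) om" unfolding om_def \<phi>_def by (rule continuous_on_weight[OF a])
    have cTp: "continuous_on (ball 0 1) (\<lambda>z. T z powr p)"
      unfolding T_def by (rule continuous_on_one_minus_norm_powr)
    have om\<phi>: "om (\<phi> z) = T z powr p" if "norm z < 1" for z by (simp add: om_def \<phi>\<phi>[OF that] T_def)

    have "(\<integral>\<^sub>D z. (norm (deriv Q z - (Q z)\<^sup>2 / 2))\<^sup>2 * T z powr (p + 2))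
      = (\<integral>\<^sub>D z. (norm (S (\<phi> z)) * T (\<phi> z))\<^sup>2 * om (\<phi> z) * (norm (deriv \<phi> z))\<^sup>2)"
    proof (intro nn_integral_cong)
      fix z :: complex
      show "ennreal ((norm (deriv Q z - (Q z)\<^sup>2 / 2))\<^sup>2 * T z powr (p + 2)) * indicator (ball 0 1) z
        = ennreal ((norm (S (\<phi> z)) * T (\<phi> z))\<^sup>2 * om (\<phi> z) * (norm (deriv \<phi> z))\<^sup>2) * indicator (ball 0 1) z"
      proof (cases "norm z < 1")
        case True
        have "(norm (deriv Q z - (Q z)\<^sup>2 / 2))\<^sup>2 * T z powr (p + 2)
          = (norm (S (\<phi> z)) * T (\<phi> z))\<^sup>2 * om (\<phi> z) * (norm (deriv \<phi> z))\<^sup>2"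
        proof -
          have "norm (deriv Q z - (Q z)\<^sup>2 / 2) = norm (S (\<phi> z)) * (norm (deriv \<phi> z))\<^sup>2"
            unfolding SQ[OF True] by (simp add: norm_mult norm_power)
          then show ?thesis
            using T[OF True] by (simp add: om\<phi>[OF True] \<phi>T[OF True, symmetric] powr_add
              power_mult_distrib algebra_simps power2_eq_square)
        qed
        then show ?thesis by simp
      qed simp
    qed
    also have "\<dots> \<le> (\<integral>\<^sup>+z\<in>\<phi> ` ball 0 1. ennreal ((norm (S z) * T z)\<^sup>2 * om z) \<partial>lborel)"
      by (rule nn_integral_holomorphic_substitution_le[OF open_ball \<phi>h inj])
        (auto simp: img om_def intro!: continuous_intros cS cT com[unfolded om_def])
    finally have QM: "(\<integral>\<^sub>D z. (norm (deriv Q z - (Q z)\<^sup>2 / 2))\<^sup>2 * T z powr (p + 2)) \<le> M"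
      by (simp add: M_def img)
    have "(\<integral>\<^sub>D z. (norm (Q z))\<^sup>2 * T z powr p)
      \<le> ennreal C * (1 + (\<integral>\<^sub>D z. (norm (deriv Q z - (Q z)\<^sup>2 / 2))\<^sup>2 * T z powr (p + 2)))"
      using main[THEN spec, THEN mp, OF Qh] Qb by (simp add: T_def)
    also have "\<dots> \<le> ennreal C * (1 + M)" by (intro mult_left_mono add_left_mono QM) auto
    finally have IQ: "(\<integral>\<^sub>D z. (norm (Q z))\<^sup>2 * T z powr p) \<le> ennreal C * (1 + M)" .
    have "(\<integral>\<^sub>D z. (norm (A z))\<^sup>2 * T z powr p)
      \<le> ennreal C * (1 + (\<integral>\<^sub>D z. (norm (deriv A z - (A z)\<^sup>2 / 2))\<^sup>2 * T z powr (p + 2)))"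
    proof -
      have "norm (A z) * T z \<le> C0 + 4" if "norm z < 1" for z using Ab[OF that] C0 by linarith
      then show ?thesis using main[THEN spec, THEN mp, OF Ah] by (simp add: T_def)
    qed
    also have "(\<integral>\<^sub>D z. (norm (deriv A z - (A z)\<^sup>2 / 2))\<^sup>2 * T z powr (p + 2)) = integral\<^sup>N lborel (\<lambda>z::complex. 0)"
      by (intro nn_integral_cong) (auto simp: DERIV_imp_deriv[OF dA] indicator_def)
    finally have IA: "(\<integral>\<^sub>D z. (norm (A z))\<^sup>2 * T z powr p) \<le> ennreal C * (1 + M)"
    proof -
      assume "(\<integral>\<^sub>D z. (norm (A z))\<^sup>2 * T z powr p) \<le> ennreal C * (1 + integral\<^sup>N lborel (\<lambda>z::complex. 0))"
      also have "\<dots> \<le> ennreal C * (1 + M)" by (intro mult_left_mono add_left_mono) auto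
      finally show ?thesis .
    qed
    have "(\<integral>\<^sub>D z. (norm (P z))\<^sup>2 * om z)
      = (\<integral>\<^sub>D z. (norm (P (\<phi> (\<phi> z)) * deriv \<phi> (\<phi> z)))\<^sup>2 * T (\<phi> z) powr p * (norm (deriv \<phi> z))\<^sup>2)"
    proof (intro nn_integral_cong)
      fix z :: complex
      show "ennreal ((norm (P z))\<^sup>2 * om z) * indicator (ball 0 1) z
        = ennreal ((norm (P (\<phi> (\<phi> z)) * deriv \<phi> (\<phi> z)))\<^sup>2 * T (\<phi> z) powr p * (norm (deriv \<phi> z))\<^sup>2) * indicator (ball 0 1) z"
      proof (cases "norm z < 1")
        case True
        \<comment> \<open>Inserting this factor 1 writes the integrand as a function of \<phi> z
          times |\<phi>'|^2, so the substitution inequality applies in the opposite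
          direction.\<close>
        have "(norm (deriv \<phi> (\<phi> z)))\<^sup>2 * (norm (deriv \<phi> z))\<^sup>2 = 1"
          using norm_deriv_disk_aut_involution[OF a True] by (simp add: \<phi>_def flip: power_mult_distrib)
        then have "(norm (P z))\<^sup>2 * om z = (norm (P z))\<^sup>2 * om z * ((norm (deriv \<phi> (\<phi> z)))\<^sup>2 * (norm (deriv \<phi> z))\<^sup>2)"
          by simp
        also have "\<dots> = (norm (P (\<phi> (\<phi> z)) * deriv \<phi> (\<phi> z)))\<^sup>2 * T (\<phi> z) powr p * (norm (deriv \<phi> z))\<^sup>2"
          by (simp add: \<phi>\<phi>[OF True] om_def T_def norm_mult power_mult_distrib)
        finally show ?thesis by simp
      qed simp
    qed
    also have "\<dots> \<le> (\<integral>\<^sup>+z\<in>\<phi> ` ball 0 1. ennreal ((norm (P (\<phi> z) * deriv \<phi> z))\<^sup>2 * T z powr p) \<partial>lborel)"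
      by (rule nn_integral_holomorphic_substitution_le[OF open_ball \<phi>h inj])
        (auto simp: img intro!: continuous_intros cP c\<phi> cTp)
    also have "\<dots> \<le> (\<integral>\<^sup>+z. 2 * (ennreal ((norm (Q z))\<^sup>2 * T z powr p) * indicator (ball 0 1) z)
        + 2 * (ennreal ((norm (A z))\<^sup>2 * T z powr p) * indicator (ball 0 1) z) \<partial>lborel)"
    proof (intro nn_integral_mono)
      fix z :: complex
      show "ennreal ((norm (P (\<phi> z) * deriv \<phi> z))\<^sup>2 * T z powr p) * indicator (\<phi> ` ball 0 1) z
        \<le> 2 * (ennreal ((norm (Q z))\<^sup>2 * T z powr p) * indicator (ball 0 1) z)
        + 2 * (ennreal ((norm (A z))\<^sup>2 * T z powr p) * indicator (ball 0 1) z)"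
      proof (cases "norm z < 1")
        case True
        have "norm (P (\<phi> z) * deriv \<phi> z) \<le> norm (Q z) + norm (A z)"
          using norm_triangle_ineq4[of "Q z" "A z"] by (simp add: Q_def)
        then have "(norm (P (\<phi> z) * deriv \<phi> z))\<^sup>2 \<le> (norm (Q z) + norm (A z))\<^sup>2" by (intro power_mono) auto
        also have "\<dots> \<le> 2 * (norm (Q z))\<^sup>2 + 2 * (norm (A z))\<^sup>2"
          using zero_le_power2[of "norm (Q z) - norm (A z)"] by (simp add: power2_sum power2_diff)
        finally have "(norm (P (\<phi> z) * deriv \<phi> z))\<^sup>2 * T z powr p \<le> (2 * (norm (Q z))\<^sup>2 + 2 * (norm (A z))\<^sup>2) * T z powr p"
          by (intro mult_right_mono) auto
        then have "ennreal ((norm (P (\<phi> z) * deriv \<phi> z))\<^sup>2 * T z powr p)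
          \<le> ennreal (2 * ((norm (Q z))\<^sup>2 * T z powr p) + 2 * ((norm (A z))\<^sup>2 * T z powr p))"
          by (intro ennreal_leI) (simp add: algebra_simps)
        then show ?thesis using True by (simp add: img ennreal_mult')
      qed (simp add: img)
    qed
    also have "\<dots> = 2 * (\<integral>\<^sub>D z. (norm (Q z))\<^sup>2 * T z powr p)
        + 2 * (\<integral>\<^sub>D z. (norm (A z))\<^sup>2 * T z powr p)"
    proof -
      have "(\<lambda>z. ennreal ((norm (Q z))\<^sup>2 * T z powr p) * indicator (ball 0 1) z) \<in> borel_measurable borel"
        "(\<lambda>z. ennreal ((norm (A z))\<^sup>2 * T z powr p) * indicator (ball 0 1) z) \<in> borel_measurable borel"
        using Qh Ah by (auto intro!: measurable_ennreal_indicator continuous_intros cTp holomorphic_on_imp_continuous_on)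
      then show ?thesis by (simp add: nn_integral_add nn_integral_cmult)
    qed
    also have "\<dots> \<le> 2 * (ennreal C * (1 + M)) + 2 * (ennreal C * (1 + M))"
      by (intro add_mono mult_left_mono IQ IA) auto
    also have "\<dots> = ennreal (4 * C) * (1 + M)"
      using C by (simp add: ennreal_mult' mult.assoc flip: distrib_right)
    finally show "(\<integral>\<^sub>D z. (norm (P z))\<^sup>2 * disk_weight p a z)
      \<le> ennreal (4 * C) * (1 + (\<integral>\<^sub>D z. (norm (deriv P z - (P z)\<^sup>2 / 2) * (1 - (norm z)\<^sup>2))\<^sup>2 * disk_weight p a z))"
      by (simp add: om_def \<phi>_def M_def S_def T_def)
  qed (use C in auto)
qed

section \<open>The Schwarzian of a harmonic mapping\<close>

text \<open>Real derivatives are kept in the form A v + B cnj v throughout, so that Wirtinger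
  derivatives can be read off as coefficients.\<close>

lemma wirt_of_has_derivative:
  assumes "(G has_derivative (\<lambda>v. A * v + B * cnj v)) (at z)"
  shows "wirt_z G z = A" "wirt_zbar G z = B"
proof -
  have "frechet_derivative G (at z) = (\<lambda>v. A * v + B * cnj v)"
    using frechet_derivative_at[OF assms] by simp
  then show "wirt_z G z = A" "wirt_zbar G z = B"
    by (simp_all add: wirt_z_def wirt_zbar_def algebra_simps)
qed

lemma has_derivative_holomorphic:
  assumes "f holomorphic_on ball 0 1" "norm z < 1"
  shows "(f has_derivative (\<lambda>v. deriv f z * v)) (at z)"
  using holomorphic_derivI[OF assms(1), of z] assms(2) by (simp add: has_field_derivative_def)

lemma has_derivative_norm_power2_holomorphic:
  assumes "f holomorphic_on ball 0 1" "norm z < 1"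
  shows "((\<lambda>z. (norm (f z))\<^sup>2) has_derivative (\<lambda>v. 2 * Re (cnj (f z) * deriv f z * v))) (at z)"
  unfolding power2_norm_eq_inner
  by (rule has_derivative_eq_rhs, (rule derivative_intros has_derivative_holomorphic[OF assms])+)
    (auto simp: inner_complex_def algebra_simps)

locale sense_preserving =
  fixes h g :: "complex \<Rightarrow> complex"
  assumes h: "h holomorphic_on ball 0 1" and g: "g holomorphic_on ball 0 1"
    and h': "\<And>z. norm z < 1 \<Longrightarrow> deriv h z \<noteq> 0"
    and gh: "\<And>z. norm z < 1 \<Longrightarrow> norm (deriv g z) < norm (deriv h z)"
begin

definition pre :: "complex \<Rightarrow> complex" where "pre z = deriv (deriv h) z / deriv h z"

abbreviation w :: "complex \<Rightarrow> complex" where "w \<equiv> dilat h g"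

text \<open>- w' times \<open>coef\<close> is the z-derivative of log (1 - |w|^2). Writing |w|^2 as
  w times its conjugate makes the quotient rule over the complex numbers applicable.\<close>

definition coef :: "complex \<Rightarrow> complex" where "coef z = cnj (w z) / (1 - w z * cnj (w z))"

lemma dh: "deriv h holomorphic_on ball 0 1" "deriv (deriv h) holomorphic_on ball 0 1"
  and dg: "deriv g holomorphic_on ball 0 1"
  using h g by (auto intro!: holomorphic_deriv)

lemma pre_holomorphic: "pre holomorphic_on ball 0 1"
  unfolding pre_def[abs_def] using dh h' by (auto intro!: holomorphic_intros h)

lemma w_holomorphic: "w holomorphic_on ball 0 1" "deriv w holomorphic_on ball 0 1"
proof -
  show w: "w holomorphic_on ball 0 1"
    unfolding dilat_def[abs_def] using dh dg h' by (auto intro!: holomorphic_intros h g)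
  show "deriv w holomorphic_on ball 0 1" by (intro holomorphic_deriv w) auto
qed

lemma norm_w: "norm z < 1 \<Longrightarrow> norm (w z) < 1"
  using gh[of z] h'[of z] by (simp add: dilat_def norm_divide)

lemma one_minus_w: "1 - w z * cnj (w z) = of_real (1 - (norm (w z))\<^sup>2)"
  by (simp add: complex_norm_square del: of_real_power)

lemma one_minus_w_nonzero: "norm z < 1 \<Longrightarrow> 1 - w z * cnj (w z) \<noteq> 0"
  unfolding one_minus_w of_real_eq_0_iff using one_minus_norm_power2(1)[OF norm_w[of z]] by auto

lemma jac_pos: "norm z < 1 \<Longrightarrow> 0 < jac h g z"
  unfolding jac_def using gh[of z] power_strict_mono[of "norm (deriv g z)" "norm (deriv h z)" 2] by simp

lemma of_real_jac: "of_real (jac h g z) = deriv h z * cnj (deriv h z) - deriv g z * cnj (deriv g z)"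
  by (simp add: jac_def complex_norm_square del: of_real_power)

lemma deriv_w:
  assumes z: "norm z < 1"
  shows "deriv w z = (deriv (deriv g) z * deriv h z - deriv g z * deriv (deriv h) z) / (deriv h z)\<^sup>2"
proof -
  have "(deriv g has_field_derivative deriv (deriv g) z) (at z)" "(deriv h has_field_derivative deriv (deriv h) z) (at z)"
    using z by (auto intro!: holomorphic_derivI[OF dg] holomorphic_derivI[OF dh(1)])
  then have "((\<lambda>z. deriv g z / deriv h z) has_field_derivative
      (deriv (deriv g) z * deriv h z - deriv g z * deriv (deriv h) z) / (deriv h z * deriv h z)) (at z)"
    using h'[OF z] by (rule DERIV_divide)
  then show ?thesis
    using DERIV_imp_deriv by (simp add: dilat_def[abs_def] power2_eq_square)
qed

text \<open>J = |h'|^2 (1 - |w|^2), so the z-derivative of log J is h''/h' minus the contribution w'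
  \<open>coef\<close> of the dilatation. Since log J is real, its other Wirtinger derivative is the
  conjugate.\<close>

lemma has_derivative_logjac:
  assumes z: "norm z < 1"
  defines "F \<equiv> pre z - deriv w z * coef z"
  shows "(logjac h g has_derivative (\<lambda>v. F * v + cnj F * cnj v)) (at z)"
proof -
  \<comment> \<open>The z-derivative of the Jacobian, so that F must be n / J.\<close>
  define n where "n = cnj (deriv h z) * deriv (deriv h) z - cnj (deriv g z) * deriv (deriv g) z"
  note J = jac_pos[OF z]
  have "((\<lambda>z. jac h g z) has_derivative (\<lambda>v. 2 * Re (cnj (deriv h z) * deriv (deriv h) z * v)
      - 2 * Re (cnj (deriv g z) * deriv (deriv g) z * v))) (at z)"
    unfolding jac_def
    by (intro has_derivative_diff has_derivative_norm_power2_holomorphic dh dg z)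
  then have "((\<lambda>z. jac h g z) has_derivative (\<lambda>v. 2 * Re (n * v))) (at z)"
    by (rule has_derivative_eq_rhs) (auto simp: n_def algebra_simps)
  from has_derivative_ln[OF J this]
  have ln: "((\<lambda>z. ln (jac h g z)) has_derivative (\<lambda>v. 2 * Re (n * v) * inverse (jac h g z))) (at z)"
    by (simp add: mult_ac)
  have 1: "(logjac h g has_derivative (\<lambda>v. of_real (2 * Re (n * v) * inverse (jac h g z)))) (at z)"
    unfolding logjac_def[abs_def] by (rule bounded_linear.has_derivative[OF bounded_linear_of_real ln])
  have "F = n / of_real (jac h g z)"
  proof -
    define a where "a = deriv h z"
    define b where "b = deriv g z"
    define a' where "a' = deriv (deriv h) z"
    define b' where "b' = deriv (deriv g) z"
    have a: "a \<noteq> 0" using h'[OF z] by (simp add: a_def)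
    have j: "a * cnj a - b * cnj b \<noteq> 0" using J of_real_jac[of z] by (auto simp: a_def b_def)
    have "coef z = (cnj b / cnj a) / (1 - (b / a) * cnj (b / a))"
      by (simp add: coef_def dilat_def a_def b_def)
    also have "1 - (b / a) * cnj (b / a) = (a * cnj a - b * cnj b) / (a * cnj a)"
      using a by (simp add: field_simps)
    also have "(cnj b / cnj a) / ((a * cnj a - b * cnj b) / (a * cnj a)) = cnj b * a / (a * cnj a - b * cnj b)"
      using a by simp
    finally have c: "coef z = cnj b * a / (a * cnj a - b * cnj b)" .
    have "deriv w z * coef z = ((b' * a - b * a') / a) * (cnj b / (a * cnj a - b * cnj b))"
      unfolding c deriv_w[OF z] using a by (simp add: a_def b_def a'_def b'_def power2_eq_square)
    then have "F = a' / a - ((b' * a - b * a') / a) * (cnj b / (a * cnj a - b * cnj b))"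
      by (simp add: F_def pre_def a_def a'_def)
    also have "\<dots> = (a' * (a * cnj a - b * cnj b) - (b' * a - b * a') * cnj b) / (a * (a * cnj a - b * cnj b))"
      using a j by (simp add: divide_simps)
    also have "a' * (a * cnj a - b * cnj b) - (b' * a - b * a') * cnj b = a * (cnj a * a' - cnj b * b')"
      by (simp add: algebra_simps)
    also have "a * (cnj a * a' - cnj b * b') / (a * (a * cnj a - b * cnj b)) = (cnj a * a' - cnj b * b') / (a * cnj a - b * cnj b)"
      using a by simp
    finally show ?thesis
      by (simp add: n_def a_def b_def a'_def b'_def of_real_jac)
  qed
  then have "F * v + cnj F * cnj v = of_real (2 * Re (n * v) * inverse (jac h g z))" for v
  proof -
    assume F: "F = n / of_real (jac h g z)"
    have "F * v + cnj F * cnj v = (n * v + cnj (n * v)) / of_real (jac h g z)"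
      unfolding F by (simp add: add_divide_distrib)
    also have "n * v + cnj (n * v) = of_real (2 * Re (n * v))" by (rule complex_add_cnj)
    finally show ?thesis by (simp only: of_real_mult of_real_inverse divide_inverse)
  qed
  then show ?thesis using 1 by simp
qed

lemma wirt_logjac:
  assumes "norm z < 1"
  shows "wirt_z (logjac h g) z = pre z - deriv w z * coef z"
    and "wirt_zbar (logjac h g) z = cnj (pre z - deriv w z * coef z)"
  using wirt_of_has_derivative[OF has_derivative_logjac[OF assms]] by auto

text \<open>The key is that the z-derivative of \<open>coef\<close> is w' times its square, because
  cnj w has z-derivative zero. The second derivative then contributes -1 and the square of the first
  -1/2 to the coefficient -3/2.\<close>

lemma schwarzian_eq:
  assumes z: "norm z < 1"
  shows "schwarzian h g z = (deriv pre z - (pre z)\<^sup>2 / 2)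
    + coef z * (deriv w z * pre z - deriv (deriv w) z) - 3 / 2 * (deriv w z * coef z)\<^sup>2"
proof -
  note nz = one_minus_w_nonzero[OF z]
  have dw: "(w has_derivative (\<lambda>v. deriv w z * v)) (at z)"
    "(deriv w has_derivative (\<lambda>v. deriv (deriv w) z * v)) (at z)"
    "(pre has_derivative (\<lambda>v. deriv pre z * v)) (at z)"
    by (intro has_derivative_holomorphic w_holomorphic pre_holomorphic z)+
  have dcw: "((\<lambda>z. cnj (w z)) has_derivative (\<lambda>v. cnj (deriv w z) * cnj v)) (at z)"
    using has_derivative_compose[OF dw(1) bounded_linear_imp_has_derivative[OF bounded_linear_cnj]] by simp
  define B where "B = cnj (deriv w z) / (1 - w z * cnj (w z)) + coef z * w z * cnj (deriv w z) / (1 - w z * cnj (w z))"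
  have dc: "(coef has_derivative (\<lambda>v. (deriv w z * (coef z)\<^sup>2) * v + B * cnj v)) (at z)"
  proof -
    have "((\<lambda>z. 1 - w z * cnj (w z)) has_derivative
        (\<lambda>v. - (w z * (cnj (deriv w z) * cnj v) + deriv w z * v * cnj (w z)))) (at z)"
      by (rule has_derivative_eq_rhs, (rule derivative_intros dw dcw)+) (simp add: fun_eq_iff)
    note quot = has_derivative_divide'[OF dcw this nz]
    have id: "(c * v' * D - wc * - (x * (c * v') + y * v * wc)) / (D * D)
        = (y * (wc / D)\<^sup>2) * v + (c / D + wc / D * x * c / D) * v'"
      if "D \<noteq> 0" for c D wc x y v v' :: complex
      using that by (simp add: field_simps power2_eq_square)
    show ?thesis
      unfolding coef_def[abs_def] B_def
      by (rule has_derivative_eq_rhs[OF quot]) (rule ext, rule id[OF nz])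
  qed
  have "((\<lambda>z. pre z - deriv w z * coef z) has_derivative (\<lambda>v. (deriv pre z - deriv (deriv w) z * coef z
      - deriv w z * (deriv w z * (coef z)\<^sup>2)) * v + (- deriv w z * B) * cnj v)) (at z)"
    by (rule has_derivative_eq_rhs, (rule derivative_intros dw dc)+) (simp add: fun_eq_iff algebra_simps)
  then have "(wirt_z (logjac h g) has_derivative (\<lambda>v. (deriv pre z - deriv (deriv w) z * coef z
      - deriv w z * (deriv w z * (coef z)\<^sup>2)) * v + (- deriv w z * B) * cnj v)) (at z)"
    by (rule has_derivative_transform_within_open[of _ _ _ _ "ball 0 1"]) (use z in \<open>auto simp: wirt_logjac\<close>)
  then have ww: "wirt_z (wirt_z (logjac h g)) z = deriv pre z - deriv (deriv w) z * coef z - deriv w z * (deriv w z * (coef z)\<^sup>2)"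
    by (rule wirt_of_has_derivative(1))
  show ?thesis
    unfolding schwarzian_def wirt_logjac(1)[OF z] ww by (simp add: field_simps power2_eq_square)
qed

lemma continuous_on_coef: "continuous_on (ball 0 1) coef"
  unfolding coef_def[abs_def] using one_minus_w_nonzero
  by (intro continuous_intros holomorphic_on_imp_continuous_on[OF w_holomorphic(1)]) auto

end

section \<open>A common form for the Q_p and Carleson conditions\<close>

definition weight_bounded :: "real \<Rightarrow> (complex \<Rightarrow> real) \<Rightarrow> bool" where
  "weight_bounded p f \<longleftrightarrow> (\<exists>C::real. \<forall>a\<in>ball 0 1.
     (\<integral>\<^sub>D z. (f z)\<^sup>2 * disk_weight p a z) \<le> ennreal C)"

text \<open>Membership of w in Q_p, of log J in the tilde class, and the Carleson condition are all
  \<open>weight_bounded\<close> for a suitable function. With this rule and closure under sums, the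
  equivalences reduce to pointwise inequalities; continuity of the majorant provides
  measurability.\<close>

lemma weight_bounded_dominated:
  assumes g: "weight_bounded p g" and c: "continuous_on (ball 0 1) g" "0 \<le> c"
    and le: "\<And>z. norm z < 1 \<Longrightarrow> \<bar>f z\<bar> \<le> c * \<bar>g z\<bar>"
  shows "weight_bounded p f"
proof -
  obtain C where C: "\<And>a. a \<in> ball 0 1 \<Longrightarrow>
     (\<integral>\<^sub>D z. (g z)\<^sup>2 * disk_weight p a z) \<le> ennreal C"
    using g unfolding weight_bounded_def by blast
  show ?thesis
    unfolding weight_bounded_def
  proof (intro exI[of _ "c\<^sup>2 * C"] ballI)
    fix a :: complex assume a: "a \<in> ball 0 1"
    define om where "om z = disk_weight p a z" for z
    have m: "(\<lambda>z. ennreal ((g z)\<^sup>2 * om z) * indicator (ball 0 1) z) \<in> borel_measurable borel"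
      unfolding om_def using a
      by (intro measurable_ennreal_indicator continuous_intros c continuous_on_weight) auto
    have "(\<integral>\<^sub>D z. (f z)\<^sup>2 * om z)
        \<le> (\<integral>\<^sup>+z. ennreal (c\<^sup>2) * (ennreal ((g z)\<^sup>2 * om z) * indicator (ball 0 1) z) \<partial>lborel)"
    proof (rule nn_integral_mono)
      fix z :: complex
      show "ennreal ((f z)\<^sup>2 * om z) * indicator (ball 0 1) z
          \<le> ennreal (c\<^sup>2) * (ennreal ((g z)\<^sup>2 * om z) * indicator (ball 0 1) z)"
      proof (cases "norm z < 1")
        case True
        have "(f z)\<^sup>2 \<le> (c * \<bar>g z\<bar>)\<^sup>2" using power_mono[OF le[OF True], of 2] by simp
        then have "(f z)\<^sup>2 * om z \<le> c\<^sup>2 * (g z)\<^sup>2 * om z"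
          by (intro mult_right_mono) (auto simp: om_def power_mult_distrib)
        then show ?thesis
          using True by (simp add: om_def ennreal_mult[symmetric] mult.assoc ennreal_leI)
      qed simp
    qed
    also have "\<dots> = ennreal (c\<^sup>2) * (\<integral>\<^sub>D z. (g z)\<^sup>2 * om z)"
      using m by (intro nn_integral_cmult) simp
    also have "\<dots> \<le> ennreal (c\<^sup>2) * ennreal C"
      using C[OF a] by (intro mult_left_mono) (auto simp: om_def)
    also have "\<dots> = ennreal (c\<^sup>2 * C)" by (simp add: ennreal_mult'[symmetric])
    finally show "(\<integral>\<^sub>D z. (f z)\<^sup>2 * disk_weight p a z) \<le> ennreal (c\<^sup>2 * C)"
      by (simp add: om_def)
  qed
qed

lemma weight_bounded_add:
  assumes f: "weight_bounded p f" "continuous_on (ball 0 1) f"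
    and g: "weight_bounded p g" "continuous_on (ball 0 1) g"
  shows "weight_bounded p (\<lambda>z. f z + g z)"
proof -
  obtain C where C: "\<And>a. a \<in> ball 0 1 \<Longrightarrow>
     (\<integral>\<^sub>D z. (f z)\<^sup>2 * disk_weight p a z) \<le> ennreal C"
    using f(1) unfolding weight_bounded_def by blast
  obtain D where D: "\<And>a. a \<in> ball 0 1 \<Longrightarrow>
     (\<integral>\<^sub>D z. (g z)\<^sup>2 * disk_weight p a z) \<le> ennreal D"
    using g(1) unfolding weight_bounded_def by blast
  show ?thesis
    unfolding weight_bounded_def
  proof (intro exI[of _ "2 * max 0 C + 2 * max 0 D"] ballI)
    fix a :: complex assume a: "a \<in> ball 0 1"
    define om where "om z = disk_weight p a z" for z
    have m: "(\<lambda>z. ennreal ((f z)\<^sup>2 * om z) * indicator (ball 0 1) z) \<in> borel_measurable borel"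
       "(\<lambda>z. ennreal ((g z)\<^sup>2 * om z) * indicator (ball 0 1) z) \<in> borel_measurable borel"
      unfolding om_def using a
      by (intro measurable_ennreal_indicator continuous_intros f g continuous_on_weight; simp)+
    have "(\<integral>\<^sub>D z. (f z + g z)\<^sup>2 * om z)
        \<le> (\<integral>\<^sup>+z. 2 * (ennreal ((f z)\<^sup>2 * om z) * indicator (ball 0 1) z)
           + 2 * (ennreal ((g z)\<^sup>2 * om z) * indicator (ball 0 1) z) \<partial>lborel)"
    proof (rule nn_integral_mono)
      fix z :: complex
      have "(f z + g z)\<^sup>2 \<le> 2 * (f z)\<^sup>2 + 2 * (g z)\<^sup>2"
        using zero_le_power2[of "f z - g z"] by (simp add: power2_sum power2_diff)
      then have "(f z + g z)\<^sup>2 * om z \<le> (2 * (f z)\<^sup>2 + 2 * (g z)\<^sup>2) * om z"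
        by (intro mult_right_mono) (auto simp: om_def)
      then have "ennreal ((f z + g z)\<^sup>2 * om z) \<le> ennreal (2 * ((f z)\<^sup>2 * om z) + 2 * ((g z)\<^sup>2 * om z))"
        by (intro ennreal_leI) (simp add: algebra_simps)
      then show "ennreal ((f z + g z)\<^sup>2 * om z) * indicator (ball 0 1) z
          \<le> 2 * (ennreal ((f z)\<^sup>2 * om z) * indicator (ball 0 1) z) + 2 * (ennreal ((g z)\<^sup>2 * om z) * indicator (ball 0 1) z)"
        by (simp add: indicator_def om_def ennreal_mult')
    qed
    also have "\<dots> = 2 * (\<integral>\<^sub>D z. (f z)\<^sup>2 * om z)
        + 2 * (\<integral>\<^sub>D z. (g z)\<^sup>2 * om z)"
      using m by (simp add: nn_integral_add nn_integral_cmult)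
    also have "\<dots> \<le> 2 * ennreal (max 0 C) + 2 * ennreal (max 0 D)"
      using C[OF a] D[OF a]
      by (intro add_mono mult_left_mono) (auto simp: om_def max_def ennreal_neg split: if_splits)
    also have "\<dots> = ennreal (2 * max 0 C + 2 * max 0 D)" by (simp add: ennreal_mult')
    finally show "(\<integral>\<^sub>D z. (f z + g z)\<^sup>2 * disk_weight p a z)
        \<le> ennreal (2 * max 0 C + 2 * max 0 D)"
      by (simp add: om_def)
  qed
qed

lemma weight_bounded_deriv:
  assumes "0 < p" and u: "u holomorphic_on ball 0 1" and b: "weight_bounded p (\<lambda>z. norm (u z))"
  shows "weight_bounded p (\<lambda>z. norm (deriv u z) * (1 - (norm z)\<^sup>2))"
proof -
  obtain K where K: "0 \<le> K" "\<forall>u a. u holomorphic_on ball 0 1 \<longrightarrow> norm a < 1 \<longrightarrow>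
    (\<integral>\<^sub>D z. (norm (deriv u z) * (1 - (norm z)\<^sup>2))\<^sup>2 * disk_weight p a z)
      \<le> ennreal K * (\<integral>\<^sub>D z. (norm (u z))\<^sup>2 * disk_weight p a z)"
    using nn_integral_deriv_weighted_le[OF \<open>0 < p\<close>] by (elim exE conjE) (rule that)
  obtain C where C: "\<And>a. a \<in> ball 0 1 \<Longrightarrow>
     (\<integral>\<^sub>D z. (norm (u z))\<^sup>2 * disk_weight p a z) \<le> ennreal C"
    using b unfolding weight_bounded_def by blast
  show ?thesis
    unfolding weight_bounded_def
  proof (intro exI[of _ "K * C"] ballI)
    fix a :: complex assume a: "a \<in> ball 0 1"
    have "(\<integral>\<^sub>D z. (norm (deriv u z) * (1 - (norm z)\<^sup>2))\<^sup>2 * disk_weight p a z)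
      \<le> ennreal K * (\<integral>\<^sub>D z. (norm (u z))\<^sup>2 * disk_weight p a z)"
      using K(2)[THEN spec, THEN spec, THEN mp, OF u, THEN mp, of a] a by simp
    also have "\<dots> \<le> ennreal K * ennreal C" by (intro mult_left_mono C a) auto
    also have "\<dots> = ennreal (K * C)" using K(1) by (simp add: ennreal_mult')
    finally show "(\<integral>\<^sub>D z. (norm (deriv u z) * (1 - (norm z)\<^sup>2))\<^sup>2 * disk_weight p a z)
      \<le> ennreal (K * C)" .
  qed
qed

lemma weight_bounded_riccati:
  assumes p: "0 < p" and P: "P holomorphic_on ball 0 1"
    and bl: "\<And>z. norm z < 1 \<Longrightarrow> norm (P z) * (1 - (norm z)\<^sup>2) \<le> C0"
    and b: "weight_bounded p (\<lambda>z. norm (deriv P z - (P z)\<^sup>2 / 2) * (1 - (norm z)\<^sup>2))"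
  shows "weight_bounded p (\<lambda>z. norm (P z))"
proof -
  define C1 where "C1 = max 1 C0"
  have C1: "0 < C1" by (simp add: C1_def)
  have bl1: "\<forall>x. norm x < 1 \<longrightarrow> norm (P x) * (1 - (norm x)\<^sup>2) \<le> C1"
    using bl unfolding C1_def by (auto intro: max.coboundedI2)
  obtain K where K: "0 \<le> K" "\<forall>P a. P holomorphic_on ball 0 1 \<longrightarrow>
    (\<forall>x. norm x < 1 \<longrightarrow> norm (P x) * (1 - (norm x)\<^sup>2) \<le> C1) \<longrightarrow> norm a < 1 \<longrightarrow>
    (\<integral>\<^sub>D z. (norm (P z))\<^sup>2 * disk_weight p a z)
    \<le> ennreal K * (1 + (\<integral>\<^sub>D z. (norm (deriv P z - (P z)\<^sup>2 / 2) * (1 - (norm z)\<^sup>2))\<^sup>2 * disk_weight p a z))"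
    using nn_integral_riccati_weighted_le[OF C1 p] by (elim exE conjE) (rule that)
  obtain C where C: "\<And>a. a \<in> ball 0 1 \<Longrightarrow>
     (\<integral>\<^sub>D z. (norm (deriv P z - (P z)\<^sup>2 / 2) * (1 - (norm z)\<^sup>2))\<^sup>2 * disk_weight p a z) \<le> ennreal C"
    using b unfolding weight_bounded_def by blast
  show ?thesis
    unfolding weight_bounded_def
  proof (intro exI[of _ "K * (1 + max 0 C)"] ballI)
    fix a :: complex assume a: "a \<in> ball 0 1"
    have "(\<integral>\<^sub>D z. (norm (P z))\<^sup>2 * disk_weight p a z)
      \<le> ennreal K * (1 + (\<integral>\<^sub>D z. (norm (deriv P z - (P z)\<^sup>2 / 2) * (1 - (norm z)\<^sup>2))\<^sup>2 * disk_weight p a z))"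
      using K(2)[THEN spec, THEN spec, THEN mp, OF P, THEN mp, OF bl1, THEN mp, of a] a by simp
    also have "\<dots> \<le> ennreal K * (1 + ennreal C)" by (intro mult_left_mono add_left_mono C a) auto
    also have "\<dots> \<le> ennreal K * (ennreal 1 + ennreal (max 0 C))"
      by (intro mult_left_mono add_mono) (auto intro: ennreal_leI)
    also have "\<dots> = ennreal (K * (1 + max 0 C))"
      using K(1) by (simp add: ennreal_mult' ennreal_plus[symmetric] del: ennreal_plus ennreal_1)
    finally show "(\<integral>\<^sub>D z. (norm (P z))\<^sup>2 * disk_weight p a z)
      \<le> ennreal (K * (1 + max 0 C))" .
  qed
qed

text \<open>Of the density's factor (1 - |z|^2)^(2+p), the power p combines with |\<phi>_a'|^p into
  (1 - |\<phi>_a|^2)^p, and the remaining square goes with |s|^2.\<close>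

lemma p_carleson_density_iff:
  assumes c: "continuous_on (ball 0 1) (\<lambda>z. norm (s z))"
  shows "p_carleson p (density (restrict_space lborel (ball 0 1))
      (\<lambda>z. ennreal ((norm (s z))\<^sup>2 * (1 - (norm z)\<^sup>2) powr (2 + p))))
    \<longleftrightarrow> weight_bounded p (\<lambda>z. norm (s z) * (1 - (norm z)\<^sup>2))"
proof -
  let ?M = "restrict_space lborel (ball (0::complex) 1)"
  let ?G = "\<lambda>z. ennreal ((norm (s z))\<^sup>2 * (1 - (norm z)\<^sup>2) powr (2 + p))"
  have meas: "(\<lambda>z. ennreal (f z)) \<in> borel_measurable ?M" if "continuous_on (ball 0 1) f" for f
  proof -
    have "f \<in> borel_measurable (restrict_space borel (ball 0 1))"
      by (rule borel_measurable_continuous_on_restrict[OF that])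
    then have "f \<in> borel_measurable ?M" by (simp cong: measurable_cong_sets add: sets_restrict_space)
    then show ?thesis by simp
  qed
  have mG: "?G \<in> borel_measurable ?M"
    by (intro meas continuous_intros c continuous_on_one_minus_norm_powr)
  have eq: "(\<integral>\<^sup>+z. ennreal ((norm (deriv (disk_aut a) z)) powr p) \<partial>density ?M ?G)
    = (\<integral>\<^sub>D z. (norm (s z) * (1 - (norm z)\<^sup>2))\<^sup>2 * disk_weight p a z)"
    if a: "a \<in> ball 0 1" for a
  proof -
    have a1: "norm a < 1" using a by simp
    have "deriv (disk_aut a) z \<noteq> 0" if "norm z < 1" for z
      using norm_deriv_disk_aut_involution[OF a1 that] by auto
    moreover have "continuous_on (ball 0 1) (deriv (disk_aut a))"
      by (intro holomorphic_on_imp_continuous_on holomorphic_deriv holomorphic_on_disk_aut a1) auto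
    ultimately have cd: "continuous_on (ball 0 1) (\<lambda>z. norm (deriv (disk_aut a) z) powr p)"
      by (intro continuous_on_powr continuous_intros) auto
    have "(\<integral>\<^sup>+z. ennreal ((norm (deriv (disk_aut a) z)) powr p) \<partial>density ?M ?G)
      = (\<integral>\<^sup>+z. ?G z * ennreal ((norm (deriv (disk_aut a) z)) powr p) \<partial>?M)"
      by (rule nn_integral_density[OF mG meas[OF cd]])
    also have "\<dots> = (\<integral>\<^sup>+z\<in>ball 0 1. ?G z * ennreal ((norm (deriv (disk_aut a) z)) powr p) \<partial>lborel)"
      by (rule nn_integral_restrict_space) simp
    also have "\<dots> = (\<integral>\<^sub>D z. (norm (s z) * (1 - (norm z)\<^sup>2))\<^sup>2 * disk_weight p a z)"
    proof (rule nn_integral_cong)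
      fix z :: complex
      show "?G z * ennreal ((norm (deriv (disk_aut a) z)) powr p) * indicator (ball 0 1) z
        = ennreal ((norm (s z) * (1 - (norm z)\<^sup>2))\<^sup>2 * disk_weight p a z) * indicator (ball 0 1) z"
      proof (cases "norm z < 1")
        case True
        have T: "0 < 1 - (norm z)\<^sup>2" using one_minus_norm_power2(1)[OF True] .
        have "disk_weight p a z = norm (deriv (disk_aut a) z) powr p * (1 - (norm z)\<^sup>2) powr p"
          unfolding norm_deriv_disk_aut[OF a1 True, symmetric] by (rule powr_mult)
        moreover have "(1 - (norm z)\<^sup>2) powr (2 + p) = (1 - (norm z)\<^sup>2)\<^sup>2 * (1 - (norm z)\<^sup>2) powr p"
          using T by (simp add: powr_add)
        ultimately show ?thesis
          using True by (simp add: ennreal_mult[symmetric] power_mult_distrib mult_ac)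
      qed simp
    qed
    finally show ?thesis .
  qed
  show ?thesis unfolding p_carleson_def weight_bounded_def by (simp only: eq cong: ball_cong)
qed

context sense_preserving
begin

lemma differentiable_logjac: "norm z < 1 \<Longrightarrow> logjac h g differentiable (at z)"
  using has_derivative_logjac[of z] by (auto simp: differentiable_def)

text \<open>The two Wirtinger derivatives of the real function log J are conjugate, hence of equal
  modulus; this is the factor 2.\<close>

lemma Qp_tilde_logjac_iff:
  "Qp_tilde p (logjac h g) \<longleftrightarrow> weight_bounded p (\<lambda>z. 2 * norm (pre z - deriv w z * coef z))"
proof -
  have "(\<integral>\<^sub>D z. (norm (wirt_z (logjac h g) z) + norm (wirt_zbar (logjac h g) z))\<^sup>2 * om z)
    = (\<integral>\<^sub>D z. (2 * norm (pre z - deriv w z * coef z))\<^sup>2 * om z)" for om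
    by (rule nn_integral_cong) (auto simp: wirt_logjac indicator_def simp del: complex_cnj_diff)
  then show ?thesis
    unfolding Qp_tilde_def weight_bounded_def using differentiable_logjac by simp
qed

end

section \<open>The equivalence as a chain of comparisons\<close>

theorem theorem3:
  fixes p :: real and h g :: "complex \<Rightarrow> complex"
  assumes "0 < p"
    and "h holomorphic_on ball 0 1" and "g holomorphic_on ball 0 1"
    and "h 0 = 0" and "g 0 = 0"
    and "\<forall>z\<in>ball 0 1. deriv h z \<noteq> 0"
    and "\<forall>z\<in>ball 0 1. norm (deriv g z) < norm (deriv h z)"
    and "unif_loc_univalent (harm h g)"
    and "Qp p (dilat h g)"
    and "\<exists>k<1. \<forall>z\<in>ball 0 1. norm (dilat h g z) \<le> k"
  shows "Qp_tilde p (logjac h g) \<longleftrightarrow>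
         p_carleson p (density (restrict_space lborel (ball 0 1))
            (\<lambda>z. ennreal ((norm (schwarzian h g z))\<^sup>2 * (1 - (norm z)\<^sup>2) powr (2 + p))))"
proof -
  interpret sense_preserving h g
    using assms by unfold_locales auto
  obtain k where k: "k < 1" "\<And>z. z \<in> ball 0 1 \<Longrightarrow> norm (w z) \<le> k" using assms(10) by blast
  obtain M where M: "0 < M" "\<And>z. z \<in> ball 0 1 \<Longrightarrow> norm (deriv (deriv h) z / deriv h z) * (1 - norm z) \<le> M"
    using preschwarzian_bounded[OF assms(2,3) _ assms(8) k] assms(6) by blast
  define T where "T z = 1 - (norm z)\<^sup>2" for z :: complex
  define S where "S z = deriv pre z - (pre z)\<^sup>2 / 2" for z
  \<comment> \<open>The factor 2 passes from the weight 1 - |z| of the rescaling argument to 1 -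
    |z|^2.\<close>
  define C0 where "C0 = 2 * M"
  define K where "K = 1 / (1 - k\<^sup>2)"
  have T: "0 < T z" "T z \<le> 2 * (1 - norm z)" if "norm z < 1" for z
    using one_minus_norm_power2[OF that] by (auto simp: T_def)
  have C0: "norm (pre z) * T z \<le> C0" if z: "norm z < 1" for z
  proof -
    have "norm (pre z) * T z \<le> norm (pre z) * (2 * (1 - norm z))" using T[OF z] by (intro mult_left_mono) auto
    also have "\<dots> = 2 * (norm (pre z) * (1 - norm z))" by simp
    also have "\<dots> \<le> 2 * M" using M(2)[of z] z by (intro mult_left_mono) (auto simp: pre_def)
    finally show ?thesis by (simp add: C0_def)
  qed
  have k0: "0 \<le> k" using k(2)[of 0] norm_ge_zero[of "w 0"] by (simp del: norm_ge_zero)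
  have K: "0 < K" using k0 k(1) by (simp add: K_def power_less_one_iff)
  have coef: "norm (coef z) \<le> K" if z: "norm z < 1" for z
  proof -
    have wk: "(norm (w z))\<^sup>2 \<le> k\<^sup>2" using k(2)[of z] z by (intro power_mono) auto
    have k21: "k\<^sup>2 < 1" using k0 k(1) by (simp add: power_less_one_iff)
    have "norm (coef z) = norm (w z) / (1 - (norm (w z))\<^sup>2)"
      unfolding coef_def one_minus_w norm_divide norm_of_real using wk k21 by simp
    also have "\<dots> \<le> 1 / (1 - k\<^sup>2)"
      using wk k21 norm_w[OF z] by (intro frac_le) auto
    finally show ?thesis by (simp add: K_def)
  qed
  \<comment> \<open>A crude Schwarz-Pick bound from |w| < 1. It lets one factor be dropped from the
    square of w', so that only the first power, controlled by Q_p, remains.\<close>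
  have dwT: "norm (deriv w z) * T z \<le> 4" if z: "norm z < 1" for z
  proof -
    have sub: "ball z (1 - norm z) \<subseteq> ball 0 1"
    proof
      fix x assume "x \<in> ball z (1 - norm z)"
      then show "x \<in> ball 0 1" using norm_triangle_sub[of x z] by (auto simp: dist_norm norm_minus_commute)
    qed
    have "norm (deriv w z) \<le> 2 * 1 / (1 - norm z)"
    proof (rule norm_deriv_le_bound)
      show "w holomorphic_on ball z (1 - norm z)" by (rule holomorphic_on_subset[OF w_holomorphic(1) sub])
      show "norm (w x) \<le> 1" if "x \<in> ball z (1 - norm z)" for x
        using norm_w[of x] subsetD[OF sub that] by simp
    qed (use z in auto)
    then have "norm (deriv w z) * T z \<le> 2 * 1 / (1 - norm z) * (2 * (1 - norm z))"
      using T[OF z] z by (intro mult_mono) auto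
    also have "\<dots> = 4" using z by (simp add: field_simps)
    finally show ?thesis .
  qed
  have cT: "continuous_on (ball 0 1) T" unfolding T_def by (intro continuous_intros)
  have cw: "continuous_on (ball 0 1) (deriv w)" "continuous_on (ball 0 1) (deriv (deriv w))"
    by (intro holomorphic_on_imp_continuous_on holomorphic_deriv w_holomorphic; simp)+
  have cp: "continuous_on (ball 0 1) pre" "continuous_on (ball 0 1) (deriv pre)"
    by (intro holomorphic_on_imp_continuous_on holomorphic_deriv pre_holomorphic; simp)+
  note cc = cT cw cp continuous_on_coef
  have cS: "continuous_on (ball 0 1) (schwarzian h g)"
  proof -
    have "continuous_on (ball 0 1) (\<lambda>z. (deriv pre z - (pre z)\<^sup>2 / 2)
        + coef z * (deriv w z * pre z - deriv (deriv w) z) - 3 / 2 * (deriv w z * coef z)\<^sup>2)"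
      by (intro continuous_intros cc) auto
    then show ?thesis by (rule continuous_on_eq) (simp add: schwarzian_eq)
  qed
  \<comment> \<open>Everything that the dilatation contributes: w' is controlled by the hypothesis w
    in Q_p, and w'' T by the Cauchy estimate.\<close>
  define E where "E z = norm (deriv (deriv w) z) * T z + norm (deriv w z)" for z
  have cE: "continuous_on (ball 0 1) E" unfolding E_def by (intro continuous_intros cc)
  have wb_w: "weight_bounded p (\<lambda>z. norm (deriv w z))"
    using assms(9) by (simp add: Qp_def weight_bounded_def)
  have wb_E: "weight_bounded p E"
    unfolding E_def using weight_bounded_deriv[OF assms(1) w_holomorphic(2) wb_w]
    by (intro weight_bounded_add wb_w continuous_intros cc) (auto simp: T_def)
  \<comment> \<open>K C0 comes from the mixed term w' P, K from w'', and 6 K^2 = 3/2 * 4 * K^2 from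
    the square of w', using |w'| T \<le> 4.\<close>
  define L where "L = K * C0 + K + 6 * K\<^sup>2"
  have L: "0 \<le> L" using K M(1) by (simp add: L_def C0_def)
  have diff: "norm (schwarzian h g z - S z) * T z \<le> L * E z" if z: "norm z < 1" for z
  proof -
    define x where "x = norm (deriv w z)"
    define y where "y = norm (deriv (deriv w) z)"
    define t where "t = T z"
    define b where "b = norm (coef z)"
    define q where "q = norm (pre z)"
    have nn: "0 \<le> x" "0 \<le> y" "0 < t" "0 \<le> b" "0 \<le> q" "b \<le> K" "q * t \<le> C0" "x * t \<le> 4"
      using T[OF z] coef[OF z] C0[OF z] dwT[OF z] by (auto simp: x_def y_def t_def b_def q_def)
    have eq: "schwarzian h g z - S z = coef z * (deriv w z * pre z - deriv (deriv w) z) - 3 / 2 * (deriv w z * coef z)\<^sup>2"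
      using schwarzian_eq[OF z] by (simp add: S_def)
    have "norm (schwarzian h g z - S z)
        \<le> norm (coef z * (deriv w z * pre z - deriv (deriv w) z)) + norm (3 / 2 * (deriv w z * coef z)\<^sup>2)"
      unfolding eq by (rule norm_triangle_ineq4)
    also have "\<dots> \<le> b * (x * q + y) + 3 / 2 * (x * b)\<^sup>2"
    proof (rule add_mono)
      have "norm (deriv w z * pre z - deriv (deriv w) z) \<le> x * q + y"
        using norm_triangle_ineq4[of "deriv w z * pre z" "deriv (deriv w) z"]
        by (simp add: norm_mult x_def y_def q_def)
      then show "norm (coef z * (deriv w z * pre z - deriv (deriv w) z)) \<le> b * (x * q + y)"
        unfolding norm_mult[of "coef z"] b_def by (rule mult_left_mono) simp
      show "norm (3 / 2 * (deriv w z * coef z)\<^sup>2) \<le> 3 / 2 * (x * b)\<^sup>2"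
        by (simp add: norm_mult norm_power x_def b_def)
    qed
    finally have "norm (schwarzian h g z - S z) * t \<le> (b * (x * q + y) + 3 / 2 * (x * b)\<^sup>2) * t"
      using nn by (intro mult_right_mono) auto
    also have "\<dots> = b * (x * (q * t)) + b * (y * t) + 3 / 2 * (b\<^sup>2 * (x * (x * t)))"
      by (simp add: algebra_simps power2_eq_square)
    also have "\<dots> \<le> K * (x * C0) + K * (y * t) + 3 / 2 * (K\<^sup>2 * (x * 4))"
      using nn K by (intro add_mono mult_mono mult_left_mono power_mono mult_nonneg_nonneg) auto
    also have "\<dots> = (K * C0 + 6 * K\<^sup>2) * x + K * (y * t)" by (simp add: algebra_simps)
    also have "\<dots> \<le> L * x + L * (y * t)"
      using nn K M(1) by (intro add_mono mult_right_mono) (auto simp: L_def C0_def)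
    also have "\<dots> = L * E z" by (simp add: E_def x_def y_def t_def algebra_simps)
    finally show ?thesis by (simp add: t_def)
  qed
  have "Qp_tilde p (logjac h g) \<longleftrightarrow> weight_bounded p (\<lambda>z. 2 * norm (pre z - deriv w z * coef z))"
    by (rule Qp_tilde_logjac_iff)
  \<comment> \<open>The two functions differ by w' \<open>coef\<close>, which is at most K |w'|
    because |w| stays away from 1.\<close>
  also have "\<dots> \<longleftrightarrow> weight_bounded p (\<lambda>z. norm (pre z))"
  proof
    assume "weight_bounded p (\<lambda>z. 2 * norm (pre z - deriv w z * coef z))"
    then have "weight_bounded p (\<lambda>z. 2 * norm (pre z - deriv w z * coef z) + norm (deriv w z))"
      by (intro weight_bounded_add wb_w continuous_intros cc)
    then show "weight_bounded p (\<lambda>z. norm (pre z))"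
    proof (rule weight_bounded_dominated[where c = "1 + K"])
      fix z :: complex assume z: "norm z < 1"
      have "norm (pre z) \<le> norm (pre z - deriv w z * coef z) + norm (deriv w z * coef z)"
        using norm_triangle_sub[of "pre z" "deriv w z * coef z"] by simp
      also have "norm (deriv w z * coef z) \<le> K * norm (deriv w z)"
        unfolding norm_mult using coef[OF z] by (subst mult.commute) (intro mult_right_mono, auto)
      also have "norm (pre z - deriv w z * coef z) + K * norm (deriv w z)
          \<le> (1 + K) * (2 * norm (pre z - deriv w z * coef z)) + (1 + K) * norm (deriv w z)"
      proof (intro add_mono mult_right_mono)
        have "1 * norm (pre z - deriv w z * coef z) \<le> ((1 + K) * 2) * norm (pre z - deriv w z * coef z)"
          using K by (intro mult_right_mono) auto
        then show "norm (pre z - deriv w z * coef z) \<le> (1 + K) * (2 * norm (pre z - deriv w z * coef z))"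
          by (simp only: mult_1 mult.assoc)
      qed auto
      finally show "\<bar>norm (pre z)\<bar> \<le> (1 + K) * \<bar>2 * norm (pre z - deriv w z * coef z) + norm (deriv w z)\<bar>"
        by (simp add: distrib_left)
    qed (use K in \<open>auto intro!: continuous_intros cc\<close>)
  next
    assume "weight_bounded p (\<lambda>z. norm (pre z))"
    then have "weight_bounded p (\<lambda>z. norm (pre z) + norm (deriv w z))"
      by (intro weight_bounded_add wb_w continuous_intros cc)
    then show "weight_bounded p (\<lambda>z. 2 * norm (pre z - deriv w z * coef z))"
    proof (rule weight_bounded_dominated[where c = "2 * (1 + K)"])
      fix z :: complex assume z: "norm z < 1"
      have "norm (pre z - deriv w z * coef z) \<le> norm (pre z) + norm (deriv w z * coef z)"
        by (rule norm_triangle_ineq4)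
      also have "norm (deriv w z * coef z) \<le> K * norm (deriv w z)"
        unfolding norm_mult using coef[OF z] by (subst mult.commute) (intro mult_right_mono, auto)
      also have "norm (pre z) + K * norm (deriv w z) \<le> (1 + K) * norm (pre z) + (1 + K) * norm (deriv w z)"
        using K by (intro add_mono mult_right_mono) (auto simp: mult_le_cancel_right1)
      finally show "\<bar>2 * norm (pre z - deriv w z * coef z)\<bar> \<le> 2 * (1 + K) * \<bar>norm (pre z) + norm (deriv w z)\<bar>"
        by (simp add: algebra_simps)
    qed (use K in \<open>auto intro!: continuous_intros cc\<close>)
  qed
  \<comment> \<open>From \<open>pre\<close> to \<open>S\<close>, the derivative is handled by the
    Cauchy estimate and |P|^2 T \<le> C0 |P|. The converse is the energy estimate.\<close>
  also have "\<dots> \<longleftrightarrow> weight_bounded p (\<lambda>z. norm (S z) * T z)"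
  proof
    assume wb: "weight_bounded p (\<lambda>z. norm (pre z))"
    have "weight_bounded p (\<lambda>z. norm (deriv pre z) * T z + norm (pre z))"
      using weight_bounded_deriv[OF assms(1) pre_holomorphic wb]
      by (intro weight_bounded_add wb continuous_intros cc) (auto simp: T_def)
    then show "weight_bounded p (\<lambda>z. norm (S z) * T z)"
    proof (rule weight_bounded_dominated[where c = "1 + C0"])
      fix z :: complex assume z: "norm z < 1"
      have "norm (S z) \<le> norm (deriv pre z) + (norm (pre z))\<^sup>2 / 2"
        unfolding S_def using norm_triangle_ineq4[of "deriv pre z" "(pre z)\<^sup>2 / 2"] by (simp add: norm_divide norm_power)
      then have "norm (S z) * T z \<le> (norm (deriv pre z) + (norm (pre z))\<^sup>2 / 2) * T z"
        using T(1)[OF z] by (intro mult_right_mono) auto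
      also have "\<dots> = norm (deriv pre z) * T z + norm (pre z) * (norm (pre z) * T z) / 2"
        by (simp add: algebra_simps power2_eq_square)
      also have "norm (pre z) * (norm (pre z) * T z) \<le> norm (pre z) * C0"
        using C0[OF z] by (intro mult_left_mono) auto
      also have "norm (deriv pre z) * T z + norm (pre z) * C0 / 2
          \<le> (1 + C0) * (norm (deriv pre z) * T z) + (1 + C0) * norm (pre z)"
        using T(1)[OF z] M(1) by (intro add_mono) (auto simp: C0_def algebra_simps)
      finally show "\<bar>norm (S z) * T z\<bar> \<le> (1 + C0) * \<bar>norm (deriv pre z) * T z + norm (pre z)\<bar>"
        using T(1)[OF z] by (simp add: distrib_left)
    qed (use M(1) in \<open>auto intro!: continuous_intros cc simp: C0_def\<close>)
  next
    assume "weight_bounded p (\<lambda>z. norm (S z) * T z)"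
    then show "weight_bounded p (\<lambda>z. norm (pre z))"
      using C0 by (intro weight_bounded_riccati[OF assms(1) pre_holomorphic]) (auto simp: S_def T_def)
  qed
  also have "\<dots> \<longleftrightarrow> weight_bounded p (\<lambda>z. norm (schwarzian h g z) * T z)"
  proof -
    have cS': "continuous_on (ball 0 1) S" unfolding S_def by (intro continuous_intros cc) auto
    \<comment> \<open>Stated for arbitrary u and v because the bound on their difference is
      symmetric: it is used once in each direction.\<close>
    have le: "weight_bounded p (\<lambda>z. norm (u z) * T z)"
      if wb: "weight_bounded p (\<lambda>z. norm (v z) * T z)" and cv: "continuous_on (ball 0 1) v"
        and uv: "\<And>z. norm z < 1 \<Longrightarrow> norm (u z - v z) * T z \<le> L * E z" for u v :: "complex \<Rightarrow> complex"
    proof -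
      have "weight_bounded p (\<lambda>z. norm (v z) * T z + E z)"
        by (intro weight_bounded_add wb wb_E cE continuous_intros cv cc)
      then show ?thesis
      proof (rule weight_bounded_dominated[where c = "1 + L"])
        fix z :: complex assume z: "norm z < 1"
        have E0: "0 \<le> E z" using T(1)[OF z] by (simp add: E_def)
        have "norm (u z) \<le> norm (v z) + norm (u z - v z)" by (rule norm_triangle_sub)
        then have "norm (u z) * T z \<le> (norm (v z) + norm (u z - v z)) * T z"
          using T(1)[OF z] by (intro mult_right_mono) auto
        also have "\<dots> \<le> norm (v z) * T z + L * E z" using uv[OF z] by (simp add: distrib_right)
        also have "\<dots> \<le> (1 + L) * (norm (v z) * T z) + (1 + L) * E z"
        proof -
          have "0 \<le> norm (v z) * T z" using T(1)[OF z] by simp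
          then show ?thesis using mult_nonneg_nonneg[OF L, of "norm (v z) * T z"] E0 by (simp add: distrib_right)
        qed
        finally show "\<bar>norm (u z) * T z\<bar> \<le> (1 + L) * \<bar>norm (v z) * T z + E z\<bar>"
          using T(1)[OF z] E0 by (simp add: distrib_left)
      qed (use L in \<open>auto intro!: continuous_intros cv cc cE\<close>)
    qed
    show ?thesis
      using le[of S "schwarzian h g"] le[of "schwarzian h g" S] cS cS' diff
      by (metis norm_minus_commute)
  qed
  also have "\<dots> \<longleftrightarrow> p_carleson p (density (restrict_space lborel (ball 0 1))
            (\<lambda>z. ennreal ((norm (schwarzian h g z))\<^sup>2 * (1 - (norm z)\<^sup>2) powr (2 + p))))"
    unfolding T_def by (rule p_carleson_density_iff[symmetric]) (intro continuous_intros cS)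
  finally show ?thesis .
qed

end
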